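(* Let $p(\cdot):G\to[1,\infty)$ be a measurable function with $1<p_-\le p_+<\infty$. Then the following two statements are equivalent: (i) $p(\cdot)\in\mathcal{A}(G)$; (ii) there is a constant $C$, depending only on $p(\cdot)$, such that for every $f\in L^{p(\cdot)}(G)$, $$\|Mf\|_{p(\cdot)}\le C\|f\|_{p(\cdot)}.$$
   Context: Group. Let $\{p_i\}_{i\ge0}$ be a sequence of integers with $p_i\ge2$ (no boundedness is assumed), $G=\prod_{i=0}^\infty\mathbb{Z}_{p_i}$ the direct product of cyclic groups of order $p_i$, and $\mu$ the Haar measure on $G$ normalized by $\mu(G)=1$. Elements of $G$ are sequences $x=\{x_i\}$ with $0\le x_i<p_i$; addition is coordinatewise modulo $p_i$. Generalized intervals. $\mathcal{F}$ is the collection of all sets of the form $x+\{y\in G: y_i=0 \text{ for } i<k,\ 0\le y_k<j\}$ with $x\in G$, $k\ge0$, $1\le j\le p_k$. Equivalently, with $G_0=G$ and $G_k=\{y\in G:y_i=0\text{ for } i<k\}$, $I\in\mathcal{F}$ iff for some $x$ and $k$, $I\subset x+G_k$, $I$ is a (nonempty) union of cosets of $G_{k+1}$, and $I$ is an interval when $x+G_k$ is viewed as a circle (of the $p_k$ cosets of $G_{k+1}$ in cyclic order). In particular $G\in\mathcal{F}$. Maximal function. $Mf(x)=\sup_{x\in I,\,I\in\mathcal{F}}\frac{1}{\mu(I)}\int_I|f|\,d\mu$. Variable Lebesgue space. For measurable $p(\cdot):G\to[1,\infty)$, $L^{p(\cdot)}(G)$ is the set of measurable $f$ such that $\int_G(|f(x)|/\lambda)^{p(x)}d\mu<\infty$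 for some $\lambda>0$, with norm $\|f\|_{p(\cdot)}=\inf\{\lambda>0:\int_G(|f(x)|/\lambda)^{p(x)}d\mu\le1\}$. Write $p_-=\operatorname{ess\,inf}_{x\in G}p(x)$, $p_+=\operatorname{ess\,sup}_{x\in G}p(x)$, and let $p'(\cdot)$ be the conjugate exponent, $1/p(x)+1/p'(x)=1$. Condition $\mathcal{A}(G)$. An exponent $p(\cdot)$ with $1<p_-\le p_+<\infty$ satisfies $p(\cdot)\in\mathcal{A}(G)$ if there is a constant $C$ such that for every $I\in\mathcal{F}$, $\frac{1}{\mu(I)}\|\chi_I\|_{p(\cdot)}\|\chi_I\|_{p'(\cdot)}\le C$, where $\chi_I$ is the characteristic function of $I$. *)

theory Defs
  imports "HOL-Probability.Probability"
begin

section \<open>The group and its Haar measure\<close>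

text \<open>
  The cyclic group of order \<open>m i\<close> is represented by \<open>{..<m i}\<close> with addition
  modulo \<open>m i\<close>; elements of the product group are sequences \<open>x :: nat \<Rightarrow> nat\<close>.
\<close>

definition G_set :: "(nat \<Rightarrow> nat) \<Rightarrow> (nat \<Rightarrow> nat) set" where
  "G_set m = {x. \<forall>i. x i < m i}"

definition G_add :: "(nat \<Rightarrow> nat) \<Rightarrow> (nat \<Rightarrow> nat) \<Rightarrow> (nat \<Rightarrow> nat) \<Rightarrow> nat \<Rightarrow> nat" where
  "G_add m x y = (\<lambda>i. (x i + y i) mod m i)"

text \<open>
  The normalized Haar measure of a product of finite groups is the product of the uniform
  measures; the lemmas \<open>prob_space_haar\<close> and \<open>haar_translation_invariant\<close> below confirm
  normalization and invariance. Since \<open>G\<close> is a countable product of finite discrete spaces,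
  the product \<open>\<sigma>\<close>-algebra is the Borel \<open>\<sigma>\<close>-algebra of \<open>G\<close>.
\<close>

definition haar :: "(nat \<Rightarrow> nat) \<Rightarrow> (nat \<Rightarrow> nat) measure" where
  "haar m = (\<Pi>\<^sub>M i\<in>UNIV. uniform_count_measure {..<m i})"

lemma space_haar: "space (haar m) = G_set m"
  by (auto simp: haar_def G_set_def space_PiM PiE_def Pi_def space_uniform_count_measure)

lemma product_prob_space_uniform:
  assumes "\<And>i. 2 \<le> m i"
  shows "product_prob_space (\<lambda>i. uniform_count_measure {..<m i :: nat})"
proof (rule product_prob_spaceI)
  fix i
  from assms[of i] have "{..<m i} \<noteq> {}"
    by (auto simp: lessThan_empty_iff)
  then show "prob_space (uniform_count_measure {..<m i})"
    by (intro prob_space_uniform_count_measure) auto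
qed

lemma prob_space_haar:
  assumes "\<And>i. 2 \<le> m i"
  shows "prob_space (haar m)"
proof -
  interpret product_prob_space "\<lambda>i. uniform_count_measure {..<m i}" UNIV
    by (rule product_prob_space_uniform[OF assms])
  show ?thesis
    unfolding haar_def by (rule P.prob_space_axioms)
qed

lemma bij_betw_add_mod:
  fixes a n :: nat
  assumes "0 < n"
  shows "bij_betw (\<lambda>y. (a + y) mod n) {..<n} {..<n}"
proof -
  have inj: "inj_on (\<lambda>y. (a + y) mod n) {..<n}"
  proof (rule inj_onI)
    have le: "z \<le> y" if "z < n" "(a + y) mod n = (a + z) mod n" for y z
    proof (rule ccontr)
      assume "\<not> z \<le> y"
      then have "n dvd z - y"
        using that by (metis add_diff_cancel_left add_le_cancel_left mod_eq_dvd_iff_nat nat_le_linear)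
      then show False
        using \<open>\<not> z \<le> y\<close> \<open>z < n\<close> by (auto dest: dvd_imp_le)
    qed
    fix y z assume "y \<in> {..<n}" "z \<in> {..<n}" "(a + y) mod n = (a + z) mod n"
    then show "y = z"
      using le[of z y] le[of y z] by (auto intro: antisym)
  qed
  moreover have "(\<lambda>y. (a + y) mod n) ` {..<n} = {..<n}"
    using assms by (intro endo_inj_surj inj) auto
  ultimately show ?thesis
    by (simp add: bij_betw_def)
qed

lemma haar_translation_invariant:
  assumes m: "\<And>i. 2 \<le> m i"
  shows "distr (haar m) (haar m) (G_add m a) = haar m"
proof -
  let ?U = "\<lambda>i. uniform_count_measure {..<m i}"
  interpret product_prob_space ?U UNIV
    by (rule product_prob_space_uniform[OF m])
  have pos: "0 < m i" for i
    using m[of i] by simp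
  have comp: "(\<lambda>y. (a i + y) mod m i) \<in> ?U i \<rightarrow>\<^sub>M ?U i" for i
    using pos[of i] by (auto simp: measurable_def space_uniform_count_measure sets_uniform_count_measure)
  have meas: "G_add m a \<in> PiM UNIV ?U \<rightarrow>\<^sub>M PiM UNIV ?U"
    unfolding G_add_def
  proof (rule measurable_PiM_single')
    show "(\<lambda>x. (a i + x i) mod m i) \<in> PiM UNIV ?U \<rightarrow>\<^sub>M ?U i" for i
      using measurable_comp[OF measurable_component_singleton[OF UNIV_I, of i ?U] comp[of i]]
      by (simp add: comp_def)
  qed (auto simp: space_PiM space_uniform_count_measure pos)
  show ?thesis
    unfolding haar_def
  proof (rule PiM_eq)
    fix J A assume J: "finite J" "J \<subseteq> UNIV" and A: "\<And>j. j \<in> J \<Longrightarrow> A j \<in> sets (?U j)"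
    let ?B = "\<lambda>j. (\<lambda>y. (a j + y) mod m j) -` A j \<inter> {..<m j}"
    have vim: "G_add m a -` prod_emb UNIV ?U J (Pi\<^sub>E J A) \<inter> space (PiM UNIV ?U)
        = prod_emb UNIV ?U J (Pi\<^sub>E J ?B)"
      using pos
      by (auto simp: G_add_def prod_emb_def space_PiM space_uniform_count_measure PiE_iff)
    have card: "emeasure (?U j) (?B j) = emeasure (?U j) (A j)" if "j \<in> J" for j
    proof -
      from A[OF that] have Aj: "A j \<subseteq> {..<m j}"
        by (simp add: sets_uniform_count_measure)
      have bij: "bij_betw (\<lambda>y. (a j + y) mod m j) {..<m j} {..<m j}"
        by (rule bij_betw_add_mod[OF pos])
      have "A j \<subseteq> (\<lambda>y. (a j + y) mod m j) ` {..<m j}"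
        using Aj bij by (simp add: bij_betw_def)
      then have "(\<lambda>y. (a j + y) mod m j) ` ?B j = A j"
        by blast
      moreover have "inj_on (\<lambda>y. (a j + y) mod m j) (?B j)"
        using bij by (auto simp: bij_betw_def intro: inj_on_subset)
      ultimately have "card (?B j) = card (A j)"
        by (metis card_image)
      then show ?thesis
        using Aj by (simp add: emeasure_uniform_count_measure)
    qed
    have "emeasure (distr (PiM UNIV ?U) (PiM UNIV ?U) (G_add m a)) (prod_emb UNIV ?U J (Pi\<^sub>E J A))
        = emeasure (PiM UNIV ?U) (prod_emb UNIV ?U J (Pi\<^sub>E J ?B))"
      using J A by (subst emeasure_distr[OF meas]) (auto simp: vim)
    also have "\<dots> = (\<Prod>j\<in>J. emeasure (?U j) (?B j))"
      using J by (intro emeasure_PiM_emb) (auto simp: sets_uniform_count_measure)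
    also have "\<dots> = (\<Prod>j\<in>J. emeasure (?U j) (A j))"
      by (intro prod.cong refl card)
    finally show "emeasure (distr (PiM UNIV ?U) (PiM UNIV ?U) (G_add m a))
        (prod_emb UNIV ?U J (Pi\<^sub>E J A)) = (\<Prod>j\<in>J. emeasure (?U j) (A j))" .
  qed simp
qed


section \<open>Generalized intervals and the maximal function\<close>

definition gen_intervals :: "(nat \<Rightarrow> nat) \<Rightarrow> (nat \<Rightarrow> nat) set set" where
  "gen_intervals m =
     {G_add m x ` {y \<in> G_set m. (\<forall>i<k. y i = 0) \<and> y k < j} | x k j.
        x \<in> G_set m \<and> 1 \<le> j \<and> j \<le> m k}"

definition maximal_fun ::
  "(nat \<Rightarrow> nat) \<Rightarrow> ((nat \<Rightarrow> nat) \<Rightarrow> complex) \<Rightarrow> (nat \<Rightarrow> nat) \<Rightarrow> ennreal" where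
  "maximal_fun m f x =
     (SUP I\<in>{I \<in> gen_intervals m. x \<in> I}.
        (\<integral>\<^sup>+ y\<in>I. ennreal (cmod (f y)) \<partial>haar m) / emeasure (haar m) I)"


section \<open>Variable Lebesgue spaces\<close>

definition ennpowr :: "ennreal \<Rightarrow> real \<Rightarrow> ennreal" where
  "ennpowr t a = (if t = \<infinity> then \<infinity> else ennreal (enn2real t powr a))"

definition modular :: "'a measure \<Rightarrow> ('a \<Rightarrow> real) \<Rightarrow> ('a \<Rightarrow> ennreal) \<Rightarrow> real \<Rightarrow> ennreal" where
  "modular M p g l = (\<integral>\<^sup>+ x. ennpowr (g x / ennreal l) (p x) \<partial>M)"

text \<open>
  The Luxemburg norm of a \<open>[0,\<infinity>]\<close>-valued function, with value \<open>\<infinity>\<close> if there is no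
  admissible \<open>l\<close>. The norm of a complex function \<open>f\<close> is that of \<open>\<lambda>x. ennreal (cmod (f x))\<close>.
\<close>

definition var_norm :: "'a measure \<Rightarrow> ('a \<Rightarrow> real) \<Rightarrow> ('a \<Rightarrow> ennreal) \<Rightarrow> ennreal" where
  "var_norm M p g = (INF l\<in>{l :: real. 0 < l \<and> modular M p g l \<le> 1}. ennreal l)"

definition var_Lp :: "'a measure \<Rightarrow> ('a \<Rightarrow> real) \<Rightarrow> ('a \<Rightarrow> complex) set" where
  "var_Lp M p = {f \<in> borel_measurable M.
     \<exists>l>0. modular M p (\<lambda>x. ennreal (cmod (f x))) l < \<infinity>}"

definition exp_plus :: "'a measure \<Rightarrow> ('a \<Rightarrow> real) \<Rightarrow> ereal" where
  "exp_plus M p = esssup M (\<lambda>x. ereal (p x))"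

definition exp_minus :: "'a measure \<Rightarrow> ('a \<Rightarrow> real) \<Rightarrow> ereal" where
  "exp_minus M p = - esssup M (\<lambda>x. - ereal (p x))"

text \<open>
  The solution of \<open>1 / p x + 1 / p' x = 1\<close> when \<open>p x > 1\<close>. At points with \<open>p x = 1\<close> the value
  is \<open>0\<close> instead of \<open>\<infinity>\<close>; for exponents with \<open>1 < exp_minus M p\<close> these points form a null set,
  so norms are unaffected.
\<close>

definition conj_exp :: "('a \<Rightarrow> real) \<Rightarrow> 'a \<Rightarrow> real" where
  "conj_exp p x = p x / (p x - 1)"

lemma conj_exp_eq:
  assumes "1 < p x"
  shows "1 / p x + 1 / conj_exp p x = 1"
  using assms by (simp add: conj_exp_def field_simps)

definition cond_A :: "(nat \<Rightarrow> nat) \<Rightarrow> ((nat \<Rightarrow> nat) \<Rightarrow> real) \<Rightarrow> bool" where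
  "cond_A m p \<longleftrightarrow>
     1 < exp_minus (haar m) p \<and> exp_minus (haar m) p \<le> exp_plus (haar m) p \<and>
     exp_plus (haar m) p < \<infinity> \<and>
     (\<exists>C::real. \<forall>I\<in>gen_intervals m.
        var_norm (haar m) p (indicator I) * var_norm (haar m) (conj_exp p) (indicator I)
          / emeasure (haar m) I \<le> ennreal C)"

end

theory Submission
  imports Defs
begin

text \<open>
  For a fixed level \<open>t \<ge> 1\<close> consider the weight \<open>t powr p x\<close>. If \<open>t = 1 / \<parallel>\<chi>\<^sub>I\<parallel>\<close>, so that the weight has
  mass 1 on \<open>I\<close>, then condition \<open>\<A>\<close> on \<open>I\<close> is a variable exponent Muckenhoupt condition for this weight;
  by Jensen's inequality it persists for every smaller \<open>t \<ge> 1\<close>, that is, whenever the mass on \<open>I\<close> is at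
  most 1, and hence on all subintervals of \<open>I\<close>. The same holds for the weights \<open>u powr p' x\<close>, which
  therefore satisfy a reverse Hoelder inequality (a Calderon-Zygmund decomposition along the binary
  subdivision of the interval, followed by Gehring's absorption argument). Taking for \<open>u\<close> the average of
  \<open>t powr p\<close> divided by \<open>t\<close> turns \<open>u powr p'\<close> into the dual weight of \<open>t powr p\<close>, so the Muckenhoupt condition improves to
  the exponent \<open>q = 1 + (p - 1) / (1 + \<delta>)\<close>, which is smaller than \<open>p\<close>. A Vitali covering of \<open>{Mf > K t}\<close> then gives
  \<open>\<integral>\<^bsub>{Mf > K t}\<^esub> t powr p \<le> K' \<integral>\<^bsub>{2 f > t}\<^esub> f powr q * t powr (p - q)\<close>, and summing over \<open>t = 2 ^ k\<close>
  bounds the modular of \<open>Mf\<close>. Values of \<open>Mf\<close> below a fixed constant are harmless because the measure is finite.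

  Conversely, testing the maximal inequality on \<open>u powr (p' - 1)\<close> restricted to \<open>I\<close>, with
  \<open>u = 1 / \<parallel>\<chi>\<^sub>I\<parallel>\<close> (norm in the dual space), gives condition \<open>\<A>\<close>.
\<close>

section \<open>Elementary inequalities\<close>

text \<open>The integral of \<open>t powr p x\<close> is not homogeneous in \<open>t\<close>, so the
  level cannot be scaled away: every level carries its own weight, and all constants must be uniform
  in the level. Condition A speaks only of the one \<open>t\<close> that has mass 1 on a given set,
  and Jensen's inequality carries it to smaller \<open>t\<close> only. In the covering argument,
  mass at most 1 on the enlarged intervals must therefore be extracted from the normalization of
  \<open>f\<close>. The normalizing \<open>t\<close> is at least 1 because the mass at
  \<open>t = 1\<close> is the measure of the set.

  The orders \<open>m k\<close> may be unbounded, so a coset of the next subgroup can be arbitrarily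
  small inside its parent. Intervals repair this: within the family each can be cut into two parts
  of at least a third of its measure, and enlarged to at most three times its measure. The locale
  below keeps these properties and an approximation property.

  The exponent \<open>q\<close> comes from \<open>1 / (q - 1) = (1 + \<delta>) / (p - 1)\<close>:
  the dual weight for \<open>q\<close> is the power \<open>1 + \<delta>\<close> of the dual weight
  for \<open>p\<close>, which is what the reverse Hoelder inequality controls.\<close>

lemma powr_le_sum_ends:
  fixes t y :: real
  assumes "a \<le> y" "y \<le> b"
  shows "t powr y \<le> t powr a + t powr b"
proof (cases "0 \<le> ln t")
  case True
  then have "t powr y \<le> t powr b" using assms by (auto simp: powr_def intro: mult_right_mono)
  then show ?thesis by (simp add: add_increasing)
next
  case False
  then have "t powr y \<le> t powr a" using assms by (auto simp: powr_def mult_le_cancel_right)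
  then show ?thesis by (simp add: add_increasing2)
qed

text \<open>The right-hand side is the tangent of the concave function
  \<open>X powr \<theta>\<close> at \<open>A\<close>; integrating it gives Jensen's inequality with
  an explicit point of tangency.\<close>

lemma powr_interpolate:
  fixes X A \<theta> :: real
  assumes "0 < X" "0 < A" "0 \<le> \<theta>" "\<theta> \<le> 1"
  shows "X powr \<theta> \<le> \<theta> * A powr (\<theta> - 1) * X + (1 - \<theta>) * A powr \<theta>"
proof -
  have "X powr \<theta> * A powr (1 - \<theta>) \<le> \<theta> * X + (1 - \<theta>) * A"
    using Youngs_inequality_0[of \<theta> "1 - \<theta>" X A] assms by simp
  then have "X powr \<theta> * A powr (1 - \<theta>) * A powr (\<theta> - 1) \<le> (\<theta> * X + (1 - \<theta>) * A) * A powr (\<theta> - 1)"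
    by (intro mult_right_mono) auto
  also have "X powr \<theta> * A powr (1 - \<theta>) * A powr (\<theta> - 1) = X powr \<theta>"
    using assms by (simp add: mult.assoc powr_add[symmetric])
  also have "(\<theta> * X + (1 - \<theta>) * A) * A powr (\<theta> - 1) = \<theta> * A powr (\<theta> - 1) * X + (1 - \<theta>) * A powr \<theta>"
    using assms by (simp add: field_simps powr_diff)
  finally show ?thesis .
qed

text \<open>Either \<open>g\<close> is at most the first summand, or the factor
  \<open>w / W * (g / \<eta>) powr r\<close> is at least 1 and multiplying \<open>g\<close> by it
  gives the second. This replaces Hoelder's inequality when the exponent \<open>1 + r\<close> varies
  from point to point.\<close>

lemma pointwise_duality:
  fixes g W w r \<eta> :: real
  assumes "0 \<le> g" "0 < W" "0 < w" "0 < r" "0 < \<eta>"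
  shows "g \<le> \<eta> * (W / w) powr (1 / r) + w / W * \<eta> powr (-r) * g powr (1 + r)"
proof (cases "g \<le> \<eta> * (W / w) powr (1 / r)")
  case True
  then show ?thesis using assms by (intro order_trans[OF True]) simp
next
  case False
  then have g: "0 < g" and "(W / w) powr (1 / r) < g / \<eta>"
    using assms by (auto simp: field_simps intro: le_less_trans[rotated] simp flip: not_le)
  then have "((W / w) powr (1 / r)) powr r \<le> (g / \<eta>) powr r"
    using assms by (intro powr_mono2) auto
  then have "W / w \<le> g powr r * \<eta> powr (-r)"
    using assms g by (simp add: powr_powr powr_divide powr_minus field_simps)
  then have "g * (W / w) \<le> g * (g powr r * \<eta> powr (-r))"
    using g by (intro mult_left_mono) auto
  then have "g \<le> w / W * \<eta> powr (-r) * g powr (1 + r)"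
    using assms g by (simp add: field_simps powr_add)
  also have "\<dots> \<le> \<eta> * (W / w) powr (1 / r) + w / W * \<eta> powr (-r) * g powr (1 + r)"
    using assms by simp
  finally show ?thesis .
qed

lemma dyadic_sum_le:
  fixes y d :: real
  assumes "0 < d" "0 \<le> y"
  shows "(\<Sum>k<n. 2 powr (real k * d) * of_bool (2 ^ k < y)) \<le> y powr d / (1 - 2 powr (-d))"
proof -
  define c where "c = 1 / (1 - 2 powr (-d) :: real)"
  have "2 powr (-d) < (2::real) powr 0" using assms by (intro powr_less_mono) auto
  then have "2 powr (-d) < (1::real)" by simp
  then have c: "0 < c" "c * (1 - 2 powr (-d)) = 1" by (auto simp: c_def)
  from this(2) have c2: "2 powr (-d) * c + 1 = c" by (simp add: algebra_simps)
  \<comment> \<open>The first bound, by the geometric series up to the last index, is what allows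
    adding a term with \<open>2 ^ n < y\<close>; the second bound is the goal and stays unchanged
    once \<open>2 ^ n\<close> has passed \<open>y\<close>.\<close>
  have "(\<Sum>k<n. 2 powr (real k * d) * of_bool (2 ^ k < y)) \<le> 2 powr ((real n - 1) * d) * c \<and>
    (\<Sum>k<n. 2 powr (real k * d) * of_bool (2 ^ k < y)) \<le> y powr d * c"
  proof (induction n)
    case 0
    then show ?case using c by simp
  next
    case (Suc n)
    have pn: "2 powr ((real n - 1) * d) * c + 2 powr (real n * d) = 2 powr (real n * d) * c"
    proof -
      have "2 powr ((real n - 1) * d) = 2 powr (real n * d) * 2 powr (-d)"
        by (simp add: powr_add[symmetric] algebra_simps)
      then show ?thesis using c2 by (metis distrib_left mult.assoc mult.right_neutral)
    qed
    show ?case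
    proof (cases "2 ^ n < y")
      case True
      have "2 powr (real n * d) \<le> y powr d"
        using True assms by (metis powr_powr powr_realpow powr_mono2 less_imp_le powr_ge_zero zero_less_numeral)
      then have "2 powr (real n * d) * c \<le> y powr d * c" using c by simp
      then show ?thesis using Suc True pn by simp
    next
      case False
      have "2 powr ((real n - 1) * d) * c \<le> 2 powr (real n * d) * c"
        using c assms by (intro mult_right_mono powr_mono) auto
      then show ?thesis using Suc False by simp
    qed
  qed
  then show ?thesis by (simp add: c_def)
qed

text \<open>A discrete layer cake formula: the coefficients are increments of dyadic powers, so the
  active ones telescope to the power of a dyadic number above \<open>v\<close>. Being increments,
  they are small of order \<open>\<delta>\<close>, and this smallness later pays for the
  absorption.\<close>

lemma powr_le_dyadic_sum:
  fixes v \<delta> :: real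
  assumes "0 < \<delta>" "0 \<le> v" "v \<le> 2 ^ (N + 1)"
  shows "v powr \<delta> \<le> 2 powr \<delta> +
    (\<Sum>k<N. (2 powr (real (k + 2) * \<delta>) - 2 powr (real (k + 1) * \<delta>)) * of_bool (2 ^ (k + 1) < v))"
  using assms(3)
proof (induction N)
  case 0
  then show ?case using assms by (simp add: powr_mono2)
next
  case (Suc N)
  let ?c = "\<lambda>k. 2 powr (real (k + 2) * \<delta>) - 2 powr (real (k + 1) * \<delta>)"
  have c: "0 \<le> ?c k" for k using assms by (simp add: powr_mono mult_right_mono)
  show ?case
  proof (cases "v \<le> 2 ^ (N + 1)")
    case True
    then show ?thesis using Suc.IH[OF True] c[of N] by simp
  next
    case False
    have "(2::real) ^ (k + 1) < v" if "k < Suc N" for k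
    proof -
      have "(2::real) ^ (k + 1) \<le> 2 ^ (N + 1)" using that by (intro power_increasing) auto
      then show ?thesis using False by linarith
    qed
    then have "(\<Sum>k<Suc N. ?c k * of_bool (2 ^ (k + 1) < v)) = (\<Sum>k<Suc N. ?c k)"
      by (intro sum.cong) auto
    also have "\<dots> = 2 powr (real (Suc N + 1) * \<delta>) - 2 powr \<delta>"
      using sum_lessThan_telescope[of "\<lambda>k. 2 powr (real (k + 1) * \<delta>)" "Suc N"]
      by (simp add: algebra_simps)
    finally have *: "2 powr \<delta> + (\<Sum>k<Suc N. ?c k * of_bool (2 ^ (k + 1) < v)) = 2 powr (real (Suc N + 1) * \<delta>)"
      by simp
    have "v powr \<delta> \<le> (2 ^ (Suc N + 1)) powr \<delta>" using Suc.prems assms by (intro powr_mono2) auto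
    also have "\<dots> = 2 powr (real (Suc N + 1) * \<delta>)"
      by (metis powr_powr powr_realpow zero_less_numeral)
    finally show ?thesis using * by simp
  qed
qed

lemma two_powr_minus_one_le:
  fixes d :: real
  assumes "0 \<le> d" "d \<le> 1"
  shows "2 powr d - 1 \<le> d"
  using powr_interpolate[of 2 1 d] assms by simp

section \<open>Gehring's lemma for a basis of sets\<close>

text \<open>
  \<open>F_dense\<close> stands in for the Lebesgue differentiation theorem, \<open>F_split\<close> for the dyadic subdivision of a cube.
\<close>

locale maximal_basis = prob_space M for M :: "'a measure" +
  fixes F :: "'a set set"
  assumes F_countable: "countable F"
    and F_sets: "I \<in> F \<Longrightarrow> I \<in> sets M"
    and F_pos: "I \<in> F \<Longrightarrow> 0 < measure M I"
    and F_enlarge: "I \<in> F \<Longrightarrow> \<exists>I'\<in>F. I \<subseteq> I' \<and> measure M I' \<le> 3 * measure M I \<and>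
      (\<forall>J\<in>F. J \<inter> I \<noteq> {} \<longrightarrow> measure M J \<le> measure M I \<longrightarrow> J \<subseteq> I')"
    and F_split: "I \<in> F \<Longrightarrow> \<exists>L\<in>F. \<exists>R\<in>F. L \<union> R = I \<and> L \<inter> R = {} \<and>
      measure M I \<le> 3 * measure M L \<and> measure M I \<le> 3 * measure M R"
    and F_dense: "E \<in> sets M \<Longrightarrow> 0 < \<epsilon> \<Longrightarrow> \<exists>A\<in>sets M. measure M (E - A) + measure M (A - E) < \<epsilon> \<and>
      (\<exists>\<eta>>0. \<forall>J\<in>F. measure M J < \<eta> \<longrightarrow> J \<subseteq> A \<or> J \<inter> A = {})"
begin

lemma bdd_set_integrable:
  fixes g :: "'a \<Rightarrow> real"
  assumes [measurable]: "g \<in> borel_measurable M" "A \<in> sets M"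
    and "\<And>x. x \<in> A \<Longrightarrow> x \<in> space M \<Longrightarrow> \<bar>g x\<bar> \<le> B"
  shows "set_integrable M A g"
  unfolding set_integrable_def
  by (rule integrable_const_bound[where B = "max B 0"])
     (use assms(3) in \<open>auto split: split_indicator intro: le_max_iff_disj[THEN iffD2]\<close>)

lemma set_integral_const': "A \<in> sets M \<Longrightarrow> (LINT x:A|M. (c::real)) = c * measure M A"
  by (simp add: set_lebesgue_integral_def)

lemma set_integral_subset_le:
  fixes g :: "'a \<Rightarrow> real"
  assumes "set_integrable M B g" "A \<in> sets M" "A \<subseteq> B" "\<And>x. x \<in> B \<Longrightarrow> 0 \<le> g x"
  shows "(LINT x:A|M. g x) \<le> (LINT x:B|M. g x)"
proof -
  have "set_integrable M A g" using set_integrable_subset assms by blast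
  then show ?thesis
    using assms unfolding set_lebesgue_integral_def set_integrable_def
    by (intro integral_mono) (auto split: split_indicator)
qed

text \<open>Stopping time argument, cut off after \<open>n\<close> generations. \<open>U\<close>
  collects the halves \<open>J\<close> at which the average first exceeds \<open>\<kappa>\<close>,
  and \<open>D\<close> is what survives. The parent of such a \<open>J\<close> has average at most
  \<open>\<kappa>\<close> and at most three times its measure, so the integral over \<open>J\<close>
  is at most \<open>3 * \<kappa> * measure M J\<close>; \<open>large\<close> contributes the further
  factor 2. Survivors shrink by \<open>2/3\<close> per generation since the sibling keeps at least a
  third.\<close>

lemma calderon_zygmund:
  fixes v :: "'a \<Rightarrow> real"
  assumes v[measurable]: "v \<in> borel_measurable M" and v0: "\<And>x. 0 \<le> v x" and vB: "\<And>x. x \<in> space M \<Longrightarrow> v x \<le> B"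
    and \<beta>: "0 < \<beta>" and k0: "0 < \<kappa>"
    and large: "\<And>J. J \<in> F \<Longrightarrow> J \<subseteq> I0 \<Longrightarrow>
      measure M J \<le> 2 * measure M {x\<in>J. v x > \<beta> * ((LINT x:J|M. v x) / measure M J)}"
    and "I \<in> F" "I \<subseteq> I0" "(LINT x:I|M. v x) \<le> \<kappa> * measure M I"
  shows "\<exists>U D. U \<subseteq> I \<and> U \<in> sets M \<and>
    (LINT x:U|M. v x) \<le> 6 * \<kappa> * measure M {x\<in>I. v x > \<beta> * \<kappa>} \<and>
    finite D \<and> D \<subseteq> F \<and> disjoint D \<and> \<Union>D = I - U \<and>
    (\<forall>J\<in>D. (LINT x:J|M. v x) \<le> \<kappa> * measure M J \<and> measure M J \<le> (2/3)^n * measure M I)"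
    (is "\<exists>U D. ?P I n U D")
  using assms(7-9)
proof (induction n arbitrary: I)
  case 0
  have "(LINT x:{}|M. v x) \<le> 6 * \<kappa> * measure M {x\<in>I. v x > \<beta> * \<kappa>}"
    using k0 by (simp add: set_lebesgue_integral_def)
  then show ?case using 0 by (intro exI[of _ "{}"] exI[of _ "{I}"]) simp
next
  case (Suc n)
  obtain L R where LR: "L \<in> F" "R \<in> F" "L \<union> R = I" "L \<inter> R = {}"
    "measure M I \<le> 3 * measure M L" "measure M I \<le> 3 * measure M R"
    using F_split[OF Suc.prems(1)] by metis
  have int: "set_integrable M A v" if "A \<in> sets M" for A
    using vB v0 that by (intro bdd_set_integrable[where B=B]) (auto simp: abs_of_nonneg)
  have Is[measurable]: "I \<in> sets M" using F_sets Suc by auto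
  have mI: "measure M I = measure M L + measure M R"
    using LR F_sets finite_measure_Union by metis
  \<comment> \<open>One half at a time: with average at most \<open>\<kappa>\<close> it is
    decomposed by the induction hypothesis, otherwise the whole half goes into
    \<open>U\<close>.\<close>
  have child: "\<exists>U D. U \<subseteq> J \<and> U \<in> sets M \<and>
    (LINT x:U|M. v x) \<le> 6 * \<kappa> * measure M {x\<in>J. v x > \<beta> * \<kappa>} \<and>
    finite D \<and> D \<subseteq> F \<and> disjoint D \<and> \<Union>D = J - U \<and>
    (\<forall>J'\<in>D. (LINT x:J'|M. v x) \<le> \<kappa> * measure M J' \<and> measure M J' \<le> (2/3)^Suc n * measure M I)"
    (is "\<exists>U D. ?Q J U D")
    if J: "J \<in> F" "J \<subseteq> I" "measure M I \<le> 3 * measure M J" "measure M J \<le> 2/3 * measure M I" for J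
  proof (cases "(LINT x:J|M. v x) \<le> \<kappa> * measure M J")
    case True
    have "J \<subseteq> I0" using J(2) Suc.prems(2) by simp
    from Suc.IH[OF J(1) this True] obtain U D where UD: "?P J n U D" by (elim exE)
    have "(2/3)^n * measure M J \<le> (2/3)^Suc n * measure M I"
      using mult_left_mono[OF J(4), of "(2/3)^n"] by simp
    then have "\<forall>J'\<in>D. measure M J' \<le> (2/3)^Suc n * measure M I" using UD order_trans by blast
    then have "\<forall>J'\<in>D. (LINT x:J'|M. v x) \<le> \<kappa> * measure M J' \<and> measure M J' \<le> (2/3)^Suc n * measure M I"
      using UD by blast
    with UD have "?Q J U D" by (elim conjE, intro conjI) assumption+
    then show ?thesis by (intro exI)
  next
    case False
    have [measurable]: "J \<in> sets M" using F_sets J by auto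
    let ?S = "(LINT x:J|M. v x) / measure M J"
    have S: "\<kappa> < ?S" using False F_pos[OF J(1)] by (simp add: field_simps)
    have "(LINT x:J|M. v x) \<le> (LINT x:I|M. v x)"
      using J v0 by (intro set_integral_subset_le int) auto
    also have "\<dots> \<le> \<kappa> * measure M I" by (rule Suc.prems(3))
    also have "\<dots> \<le> \<kappa> * (3 * measure M J)" using J(3) k0 by (intro mult_left_mono) simp_all
    also have "\<dots> = 3 * \<kappa> * measure M J" by simp
    also have "\<dots> \<le> 3 * \<kappa> * (2 * measure M {x\<in>J. v x > \<beta> * ?S})"
      using k0 large[OF J(1)] J(2) Suc.prems(2) by (intro mult_left_mono) simp_all
    also have "\<dots> \<le> 3 * \<kappa> * (2 * measure M {x\<in>J. v x > \<beta> * \<kappa>})"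
    proof -
      have "\<beta> * \<kappa> \<le> \<beta> * ?S" using S \<beta> by (intro mult_left_mono) simp_all
      then have "measure M {x\<in>J. v x > \<beta> * ?S} \<le> measure M {x\<in>J. v x > \<beta> * \<kappa>}"
        by (intro finite_measure_mono) auto
      then show ?thesis using k0 by simp
    qed
    finally have "?Q J J {}" by simp
    then show ?thesis by (intro exI)
  qed
  have "\<exists>U D. ?Q L U D" using LR mI by (intro child) auto
  then obtain U1 D1 where 1: "?Q L U1 D1" by (elim exE)
  have "\<exists>U D. ?Q R U D" using LR mI by (intro child) auto
  then obtain U2 D2 where 2: "?Q R U2 D2" by (elim exE)
  have [measurable]: "U1 \<in> sets M" "U2 \<in> sets M" "L \<in> sets M" "R \<in> sets M" using 1 2 LR(1,2) F_sets by blast+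
  have "(LINT x:U1\<union>U2|M. v x) = (LINT x:U1|M. v x) + (LINT x:U2|M. v x)"
    using LR(4) 1 2 by (intro set_integral_Un int) blast+
  also have "\<dots> \<le> 6 * \<kappa> * (measure M {x\<in>L. v x > \<beta> * \<kappa>} + measure M {x\<in>R. v x > \<beta> * \<kappa>})"
    using conjunct1[OF conjunct2[OF conjunct2[OF 1]]] conjunct1[OF conjunct2[OF conjunct2[OF 2]]]
    by (simp add: distrib_left)
  also have "measure M {x\<in>L. v x > \<beta> * \<kappa>} + measure M {x\<in>R. v x > \<beta> * \<kappa>}
      = measure M ({x\<in>L. v x > \<beta> * \<kappa>} \<union> {x\<in>R. v x > \<beta> * \<kappa>})"
    using LR(4) by (intro finite_measure_Union[symmetric]) auto
  also have "{x\<in>L. v x > \<beta> * \<kappa>} \<union> {x\<in>R. v x > \<beta> * \<kappa>} = {x\<in>I. v x > \<beta> * \<kappa>}"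
    using LR(3) by auto
  finally have A: "(LINT x:U1\<union>U2|M. v x) \<le> 6 * \<kappa> * measure M {x\<in>I. v x > \<beta> * \<kappa>}" .
  have D1: "finite D1" "D1 \<subseteq> F" "disjoint D1" "\<Union>D1 = L - U1" and U1: "U1 \<subseteq> L" using 1 by blast+
  have D2: "finite D2" "D2 \<subseteq> F" "disjoint D2" "\<Union>D2 = R - U2" and U2: "U2 \<subseteq> R" using 2 by blast+
  have "\<Union>D1 \<inter> \<Union>D2 = {}" unfolding D1 D2 using LR(4) by blast
  then have dj: "disjoint (D1 \<union> D2)" using D1 D2 by (intro disjoint_union) blast+
  have un: "\<Union>(D1 \<union> D2) = I - (U1 \<union> U2)"
    unfolding Union_Un_distrib D1 D2 using U1 U2 LR(3,4) by blast
  have sub: "U1 \<union> U2 \<subseteq> I" using U1 U2 LR(3) by blast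
  have "\<forall>J\<in>D1 \<union> D2. (LINT x:J|M. v x) \<le> \<kappa> * measure M J \<and> measure M J \<le> (2/3)^Suc n * measure M I"
    using 1 2 by blast
  then have "?P I (Suc n) (U1 \<union> U2) (D1 \<union> D2)"
    using A dj un sub D1(1,2) D2(1,2) by simp
  then show ?case by (intro exI)
qed

lemma sum_measure_disjoint:
  assumes "finite D" "disjoint D" "D \<subseteq> sets M" and [measurable]: "X \<in> sets M"
  shows "(\<Sum>J\<in>D. measure M (X \<inter> J)) = measure M (X \<inter> \<Union>D)"
proof -
  have "measure M (\<Union>J\<in>D. X \<inter> J) = (\<Sum>J\<in>D. measure M (X \<inter> J))"
    using assms by (intro finite_measure_finite_Union)
      (auto simp: disjoint_family_on_def pairwise_def disjnt_def)
  moreover have "(\<Union>J\<in>D. X \<inter> J) = X \<inter> \<Union>D" by blast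
  ultimately show ?thesis by simp
qed

text \<open>The gap between the levels \<open>\<kappa>\<close> and \<open>2 * \<kappa>\<close>
  replaces pointwise differentiation. On a surviving piece the average is at most
  \<open>\<kappa>\<close>, so by Markov's inequality at most half of it lies above
  \<open>2 * \<kappa>\<close>; but very small pieces lie almost entirely inside or outside the level
  set, up to a total error \<open>\<epsilon>\<close>.\<close>

lemma integral_above_level_le:
  fixes v :: "'a \<Rightarrow> real"
  assumes v[measurable]: "v \<in> borel_measurable M" and v0: "\<And>x. 0 \<le> v x" and vB: "\<And>x. x \<in> space M \<Longrightarrow> v x \<le> B"
    and \<beta>: "0 < \<beta>" and k0: "0 < \<kappa>"
    and large: "\<And>J. J \<in> F \<Longrightarrow> J \<subseteq> I \<Longrightarrow>
      measure M J \<le> 2 * measure M {x\<in>J. v x > \<beta> * ((LINT x:J|M. v x) / measure M J)}"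
    and I: "I \<in> F" and avg: "(LINT x:I|M. v x) \<le> \<kappa> * measure M I"
  shows "(LINT x:{x\<in>I. v x > 2 * \<kappa>}|M. v x) \<le> 6 * \<kappa> * measure M {x\<in>I. v x > \<beta> * \<kappa>}"
proof (rule field_le_epsilon)
  fix \<epsilon> :: real assume "0 < \<epsilon>"
  define B1 where "B1 = max B 1"
  have B1: "0 < B1" "\<And>x. x \<in> space M \<Longrightarrow> v x \<le> B1" using vB by (auto simp: B1_def le_max_iff_disj)
  have int: "set_integrable M A v" if "A \<in> sets M" for A
    using vB v0 that by (intro bdd_set_integrable[where B=B]) (auto simp: abs_of_nonneg)
  define E where "E = {x\<in>I. v x > 2 * \<kappa>}"
  have Is[measurable]: "I \<in> sets M" using F_sets I by auto
  have E[measurable]: "E \<in> sets M" by (simp add: E_def)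
  \<comment> \<open>The accuracy is divided by the bound \<open>B1\<close> of \<open>v\<close>, so
    that the integral over the uncovered part of \<open>E\<close> is at most
    \<open>\<epsilon>\<close>.\<close>
  obtain A \<eta> where A[measurable]: "A \<in> sets M" and AE: "measure M (E - A) + measure M (A - E) < \<epsilon> / B1"
    and \<eta>: "0 < \<eta>" "\<And>J. J \<in> F \<Longrightarrow> measure M J < \<eta> \<Longrightarrow> J \<subseteq> A \<or> J \<inter> A = {}"
    using F_dense[OF E, of "\<epsilon> / B1"] \<open>0 < \<epsilon>\<close> B1(1) by auto
  obtain n where n: "(2/3)^n < \<eta>" using real_arch_pow_inv[of \<eta> "2/3"] \<eta>(1) by auto
  have "\<exists>U D. U \<subseteq> I \<and> U \<in> sets M \<and>
    (LINT x:U|M. v x) \<le> 6 * \<kappa> * measure M {x\<in>I. v x > \<beta> * \<kappa>} \<and>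
    finite D \<and> D \<subseteq> F \<and> disjoint D \<and> \<Union>D = I - U \<and>
    (\<forall>J\<in>D. (LINT x:J|M. v x) \<le> \<kappa> * measure M J \<and> measure M J \<le> (2/3)^n * measure M I)"
    by (rule calderon_zygmund[where ?I0.0=I and B=B, OF v v0 _ \<beta> k0 _ I order_refl avg]) (use vB large in blast)+
  then obtain U D where "U \<subseteq> I \<and> U \<in> sets M \<and>
    (LINT x:U|M. v x) \<le> 6 * \<kappa> * measure M {x\<in>I. v x > \<beta> * \<kappa>} \<and>
    finite D \<and> D \<subseteq> F \<and> disjoint D \<and> \<Union>D = I - U \<and>
    (\<forall>J\<in>D. (LINT x:J|M. v x) \<le> \<kappa> * measure M J \<and> measure M J \<le> (2/3)^n * measure M I)"
    by (elim exE)
  then have U: "U \<subseteq> I" and U2[measurable]: "U \<in> sets M"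
    and U3: "(LINT x:U|M. v x) \<le> 6 * \<kappa> * measure M {x\<in>I. v x > \<beta> * \<kappa>}"
    and D: "finite D" "D \<subseteq> F" "disjoint D" "\<Union>D = I - U"
    and DJ: "\<And>J. J \<in> D \<Longrightarrow> (LINT x:J|M. v x) \<le> \<kappa> * measure M J"
      "\<And>J. J \<in> D \<Longrightarrow> measure M J \<le> (2/3)^n * measure M I"
    by blast+
  have Ds: "D \<subseteq> sets M" using D(2) F_sets by blast
  \<comment> \<open>If \<open>J\<close> lies in \<open>A\<close>, the half of \<open>J\<close>
    outside \<open>E\<close> belongs to \<open>A - E\<close> and dominates
    \<open>E \<inter> J\<close>; if \<open>J\<close> misses \<open>A\<close>, then
    \<open>E \<inter> J\<close> belongs to \<open>E - A\<close>.\<close>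
  have piece: "measure M (E \<inter> J) \<le> measure M ((E - A) \<inter> J) + measure M ((A - E) \<inter> J)" if J: "J \<in> D" for J
  proof -
    have JF: "J \<in> F" using D J by auto
    then have [measurable]: "J \<in> sets M" by (rule F_sets)
    have "(2/3)^n * measure M I \<le> (2/3)^n" by (simp add: mult_left_le)
    then have "measure M J < \<eta>" using DJ(2)[OF J] n by linarith
    from \<eta>(2)[OF JF this] show ?thesis
    proof
      assume JA: "J \<subseteq> A"
      have "2 * \<kappa> * measure M (E \<inter> J) = (LINT x:E \<inter> J|M. 2 * \<kappa>)"
        by (rule set_integral_const'[symmetric]) simp
      also have "\<dots> \<le> (LINT x:E \<inter> J|M. v x)"
        by (intro set_integral_mono int bdd_set_integrable[where B="\<bar>2 * \<kappa>\<bar>"]) (auto simp: E_def)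
      also have "\<dots> \<le> (LINT x:J|M. v x)" using v0 by (intro set_integral_subset_le int) auto
      also have "\<dots> \<le> \<kappa> * measure M J" by (rule DJ(1)[OF J])
      finally have "2 * measure M (E \<inter> J) \<le> measure M J" using k0 by simp
      moreover have "measure M J = measure M (J - E) + measure M (E \<inter> J)"
        using finite_measure_Diff'[of J E] by (simp add: Int_commute)
      moreover have "(A - E) \<inter> J = J - E" using JA by blast
      ultimately have "measure M (E \<inter> J) \<le> measure M ((A - E) \<inter> J)" by simp
      then show ?thesis by (simp add: add_increasing)
    next
      assume "J \<inter> A = {}"
      then have "(E - A) \<inter> J = E \<inter> J" by blast
      then show ?thesis by simp
    qed
  qed
  have "E - U = E \<inter> \<Union>D" unfolding D(4) by (auto simp: E_def)
  then have "measure M (E - U) = (\<Sum>J\<in>D. measure M (E \<inter> J))"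
    using sum_measure_disjoint[OF D(1,3) Ds E] by simp
  also have "\<dots> \<le> (\<Sum>J\<in>D. measure M ((E - A) \<inter> J) + measure M ((A - E) \<inter> J))"
    by (intro sum_mono piece)
  also have "\<dots> = measure M ((E - A) \<inter> \<Union>D) + measure M ((A - E) \<inter> \<Union>D)"
    unfolding sum.distrib by (intro arg_cong2[where f="(+)"] sum_measure_disjoint D Ds) auto
  also have "\<dots> \<le> measure M (E - A) + measure M (A - E)"
    by (intro add_mono finite_measure_mono) auto
  finally have EU: "measure M (E - U) \<le> \<epsilon> / B1" using AE by linarith
  have "(LINT x:E|M. v x) \<le> (LINT x:U \<union> (E - U)|M. v x)"
    using v0 by (intro set_integral_subset_le int) auto
  also have "\<dots> = (LINT x:U|M. v x) + (LINT x:E - U|M. v x)"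
    by (intro set_integral_Un int) auto
  also have "(LINT x:E - U|M. v x) \<le> (LINT x:E - U|M. B1)"
    using B1 sets.sets_into_space[OF E] by (intro set_integral_mono int bdd_set_integrable[where B=B1]) auto
  also have "\<dots> = B1 * measure M (E - U)" by (rule set_integral_const') simp
  also have "\<dots> \<le> \<epsilon>" using EU B1 by (simp add: field_simps)
  finally show "(LINT x:E|M. v x) \<le> 6 * \<kappa> * measure M {x\<in>I. v x > \<beta> * \<kappa>} + \<epsilon>"
    using U3 by simp
qed

lemma set_integral_sum':
  fixes f :: "nat \<Rightarrow> 'a \<Rightarrow> real"
  assumes "\<And>k. set_integrable M A (f k)"
  shows "(LINT x:A|M. (\<Sum>k<N. f k x)) = (\<Sum>k<N. (LINT x:A|M. f k x))"
    and "set_integrable M A (\<lambda>x. \<Sum>k<N. f k x)"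
  using assms unfolding set_lebesgue_integral_def set_integrable_def scaleR_sum_right
  by (intro Bochner_Integration.integral_sum Bochner_Integration.integrable_sum; simp)+

text \<open>The level estimates at \<open>\<kappa> = 2 ^ k\<close>, weighted by the dyadic
  increments and summed, bound the integral of \<open>v powr (1 + \<delta>)\<close> by
  \<open>2 * measure M I\<close> plus at most \<open>24 * \<delta> / \<beta>\<^sup>2\<close> times
  itself. The choice \<open>\<delta> = \<beta>\<^sup>2 / 48\<close> makes this factor
  \<open>1/2\<close>.\<close>

lemma gehring:
  fixes v :: "'a \<Rightarrow> real"
  assumes v[measurable]: "v \<in> borel_measurable M" and v0: "\<And>x. 0 \<le> v x" and vB: "\<And>x. x \<in> space M \<Longrightarrow> v x \<le> B"
    and \<beta>: "0 < \<beta>" "\<beta> \<le> 1"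
    and large: "\<And>J. J \<in> F \<Longrightarrow> J \<subseteq> I \<Longrightarrow>
      measure M J \<le> 2 * measure M {x\<in>J. v x > \<beta> * ((LINT x:J|M. v x) / measure M J)}"
    and I: "I \<in> F" and avg: "(LINT x:I|M. v x) \<le> measure M I"
  shows "(LINT x:I|M. v x powr (1 + \<beta>\<^sup>2 / 48)) \<le> 4 * measure M I"
proof -
  define \<delta> where "\<delta> = \<beta>\<^sup>2 / 48"
  have \<delta>: "0 < \<delta>" "\<delta> \<le> 1" using \<beta> power_le_one[of \<beta> 2] by (auto simp: \<delta>_def)
  have Is[measurable]: "I \<in> sets M" using F_sets I by auto
  have int: "set_integrable M A (\<lambda>x. v x powr (1 + \<delta>))" if "A \<in> sets M" for A
    using vB v0 \<delta> that
    by (intro bdd_set_integrable[where B="B powr (1 + \<delta>)"]) (auto intro!: powr_mono2)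
  have intv: "set_integrable M A v" if "A \<in> sets M" for A
    using vB v0 that by (intro bdd_set_integrable[where B=B]) (auto simp: abs_of_nonneg)
  \<comment> \<open>Boundedness of \<open>v\<close> makes the dyadic sum finite and the integral to
    be absorbed finite; the final bound depends on neither \<open>N\<close> nor
    \<open>B\<close>.\<close>
  obtain N where N: "B \<le> 2 ^ N" using real_arch_pow[of 2 B] by (auto intro: less_imp_le)
  define c where "c = (\<lambda>k. 2 powr (real (k + 2) * \<delta>) - 2 powr (real (k + 1) * \<delta>))"
  have c: "0 \<le> c k" "c k \<le> 2 * \<delta> * 2 powr (real k * \<delta>)" for k
  proof -
    show "0 \<le> c k" using \<delta> by (simp add: c_def powr_mono mult_right_mono)
    have "2 powr (real (k + 2) * \<delta>) = 2 powr (real k * \<delta>) * 2 powr \<delta> * 2 powr \<delta>"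
      "2 powr (real (k + 1) * \<delta>) = 2 powr (real k * \<delta>) * 2 powr \<delta>"
      by (simp_all add: powr_add[symmetric] algebra_simps)
    then have "c k = 2 powr (real k * \<delta>) * (2 powr \<delta> * (2 powr \<delta> - 1))"
      by (simp add: c_def algebra_simps)
    also have "2 powr \<delta> * (2 powr \<delta> - 1) \<le> 2 * \<delta>"
      using two_powr_minus_one_le[of \<delta>] \<delta> by (intro mult_mono) (auto simp: ge_one_powr_ge_zero)
    finally show "c k \<le> 2 * \<delta> * 2 powr (real k * \<delta>)" by (simp add: mult_left_mono algebra_simps)
  qed
  have ind: "(LINT x:I|M. v x * of_bool (2 ^ (k + 1) < v x)) = (LINT x:{x\<in>I. v x > 2 * 2 ^ k}|M. v x)" for k
    unfolding set_lebesgue_integral_def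
    by (intro Bochner_Integration.integral_cong) (auto split: split_indicator)
  have intk: "set_integrable M I (\<lambda>x. a * (v x * of_bool (2 ^ (k + 1) < v x)))" for k and a :: real
  proof (intro bdd_set_integrable[where B="\<bar>a\<bar> * B"])
    fix x assume "x \<in> space M"
    then have "v x * of_bool (2 ^ (k + 1) < v x) \<le> B" using v0[of x] vB[of x] by auto
    then show "\<bar>a * (v x * of_bool (2 ^ (k + 1) < v x))\<bar> \<le> \<bar>a\<bar> * B"
      using v0[of x] by (simp add: abs_mult mult_left_mono)
  qed auto
  have intd: "set_integrable M I (\<lambda>x. a * of_bool (2 ^ k < v x / \<beta>))" for k and a :: real
    by (intro bdd_set_integrable[where B="\<bar>a\<bar>"]) (auto simp: abs_mult)
  let ?X = "LINT x:I|M. v x powr (1 + \<delta>)"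
  \<comment> \<open>Only \<open>v powr \<delta>\<close> is expanded dyadically. The remaining factor
    \<open>v\<close> turns each term into the integral of \<open>v\<close> above the level
    \<open>2 * 2 ^ k\<close>.\<close>
  have "?X \<le> (LINT x:I|M. 2 powr \<delta> * v x + (\<Sum>k<N. c k * (v x * of_bool (2 ^ (k + 1) < v x))))"
  proof (rule set_integral_mono)
    show "set_integrable M I (\<lambda>x. 2 powr \<delta> * v x + (\<Sum>k<N. c k * (v x * of_bool (2 ^ (k + 1) < v x))))"
      by (intro set_integral_add(1) set_integrable_mult_right intv set_integral_sum'(2) intk) auto
    fix x assume "x \<in> I"
    then have "x \<in> space M" using sets.sets_into_space[OF Is] by blast
    then have "v x \<le> 2 ^ N" using vB[of x] N by linarith
    also have "(2::real) ^ N \<le> 2 ^ (N + 1)" by simp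
    finally have "v x \<le> 2 ^ (N + 1)" .
    from powr_le_dyadic_sum[OF \<delta>(1) v0 this]
    have "v x powr \<delta> \<le> 2 powr \<delta> + (\<Sum>k<N. c k * of_bool (2 ^ (k + 1) < v x))" by (simp add: c_def)
    then have "v x * v x powr \<delta> \<le> v x * (2 powr \<delta> + (\<Sum>k<N. c k * of_bool (2 ^ (k + 1) < v x)))"
      using v0 by (intro mult_left_mono)
    then show "v x powr (1 + \<delta>) \<le> 2 powr \<delta> * v x + (\<Sum>k<N. c k * (v x * of_bool (2 ^ (k + 1) < v x)))"
      using v0[of x] unfolding distrib_left sum_distrib_left by (simp only: powr_mult_base mult_ac)
  qed (intro int Is)
  also have "\<dots> = 2 powr \<delta> * (LINT x:I|M. v x) + (\<Sum>k<N. c k * (LINT x:I|M. v x * of_bool (2 ^ (k + 1) < v x)))"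
  proof -
    let ?f = "\<lambda>k x. c k * (v x * of_bool (2 ^ (k + 1) < v x))"
    have f: "set_integrable M I (?f k)" for k by (rule intk)
    have g: "set_integrable M I (\<lambda>x. 2 powr \<delta> * v x)" using intv by simp
    show ?thesis
      using set_integral_add(2)[OF g set_integral_sum'(2)[where f = ?f and N = N, OF f]]
        set_integral_sum'(1)[where f = ?f and N = N, OF f]
      by (simp only: set_integral_mult_right)
  qed
  also have "\<dots> \<le> 2 * measure M I + (\<Sum>k<N. (2 * \<delta> * 2 powr (real k * \<delta>)) *
      (6 * 2 ^ k * measure M {x\<in>I. v x > \<beta> * 2 ^ k}))"
  proof (intro add_mono mult_mono sum_mono)
    show "2 powr \<delta> \<le> 2" using powr_mono[of \<delta> 1 2] \<delta> by simp
    show "c k \<le> 2 * \<delta> * 2 powr (real k * \<delta>)" for k by (rule c)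
    have I2: "(LINT x:I|M. v x) \<le> 2 ^ k * measure M I" for k
      using avg mult_right_mono[of 1 "2 ^ k" "measure M I"] by simp
    show "(LINT x:I|M. v x * of_bool (2 ^ (k + 1) < v x)) \<le> 6 * 2 ^ k * measure M {x\<in>I. v x > \<beta> * 2 ^ k}" for k
      unfolding ind by (rule integral_above_level_le[OF v v0 vB \<beta>(1) _ large I I2]) auto
    show "0 \<le> (LINT x:I|M. v x)" "0 \<le> (LINT x:I|M. v x * of_bool (2 ^ (k + 1) < v x))" for k
      using v0 by (auto simp: set_lebesgue_integral_def intro!: Bochner_Integration.integral_nonneg)
  qed (use avg \<delta> in auto)
  also have "(\<Sum>k<N. (2 * \<delta> * 2 powr (real k * \<delta>)) * (6 * 2 ^ k * measure M {x\<in>I. v x > \<beta> * 2 ^ k}))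
      = 12 * \<delta> * (\<Sum>k<N. 2 powr (real k * (1 + \<delta>)) * measure M {x\<in>I. v x > \<beta> * 2 ^ k})"
    unfolding sum_distrib_left
  proof (intro sum.cong refl)
    fix k
    have "2 powr (real k * (1 + \<delta>)) = 2 powr (real k * \<delta>) * 2 ^ k"
      by (simp add: distrib_left powr_add powr_realpow)
    then show "(2 * \<delta> * 2 powr (real k * \<delta>)) * (6 * 2 ^ k * measure M {x\<in>I. v x > \<beta> * 2 ^ k})
      = 12 * \<delta> * (2 powr (real k * (1 + \<delta>)) * measure M {x\<in>I. v x > \<beta> * 2 ^ k})" by simp
  qed
  also have "(\<Sum>k<N. 2 powr (real k * (1 + \<delta>)) * measure M {x\<in>I. v x > \<beta> * 2 ^ k})
      = (\<Sum>k<N. (LINT x:I|M. 2 powr (real k * (1 + \<delta>)) * of_bool (2 ^ k < v x / \<beta>)))"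
  proof (intro sum.cong refl)
    fix k
    have "(LINT x:I|M. 2 powr (real k * (1 + \<delta>)) * of_bool (2 ^ k < v x / \<beta>))
      = (LINT x:{x\<in>I. v x > \<beta> * 2 ^ k}|M. 2 powr (real k * (1 + \<delta>)))"
      unfolding set_lebesgue_integral_def using \<beta>
      by (intro Bochner_Integration.integral_cong) (auto split: split_indicator simp: field_simps)
    then show "2 powr (real k * (1 + \<delta>)) * measure M {x\<in>I. v x > \<beta> * 2 ^ k} =
      (LINT x:I|M. 2 powr (real k * (1 + \<delta>)) * of_bool (2 ^ k < v x / \<beta>))"
      by (simp add: set_integral_const')
  qed
  also have "\<dots> = (LINT x:I|M. \<Sum>k<N. 2 powr (real k * (1 + \<delta>)) * of_bool (2 ^ k < v x / \<beta>))"
    by (rule set_integral_sum'(1)[symmetric]) (rule intd)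
  also have "\<dots> \<le> (LINT x:I|M. 2 / \<beta>\<^sup>2 * v x powr (1 + \<delta>))"
  proof (rule set_integral_mono)
    fix x assume "x \<in> I"
    have "(2::real) powr -(1 + \<delta>) \<le> 2 powr -1" using \<delta> by (intro powr_mono) auto
    then have *: "1 - 2 powr -(1 + \<delta>) \<ge> 1/2" by (simp add: powr_minus)
    have "(\<Sum>k<N. 2 powr (real k * (1 + \<delta>)) * of_bool (2 ^ k < v x / \<beta>))
        \<le> (v x / \<beta>) powr (1 + \<delta>) / (1 - 2 powr -(1 + \<delta>))"
      using \<delta> v0[of x] \<beta> by (intro dyadic_sum_le) auto
    also have "\<dots> \<le> (v x / \<beta>) powr (1 + \<delta>) / (1/2)"
      using * by (intro divide_left_mono) auto
    also have "(v x / \<beta>) powr (1 + \<delta>) = v x powr (1 + \<delta>) / \<beta> powr (1 + \<delta>)"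
      using v0[of x] \<beta> by (simp add: powr_divide)
    also have "\<dots> / (1/2) \<le> v x powr (1 + \<delta>) / \<beta>\<^sup>2 / (1/2)"
    proof -
      have "\<beta> powr 2 \<le> \<beta> powr (1 + \<delta>)" using \<beta> \<delta> by (intro powr_mono') auto
      then have "\<beta>\<^sup>2 \<le> \<beta> powr (1 + \<delta>)" using \<beta> by simp
      then show ?thesis using \<beta> by (intro divide_right_mono divide_left_mono) auto
    qed
    finally show "(\<Sum>k<N. 2 powr (real k * (1 + \<delta>)) * of_bool (2 ^ k < v x / \<beta>)) \<le> 2 / \<beta>\<^sup>2 * v x powr (1 + \<delta>)"
      by (simp add: mult.commute)
  qed (intro set_integral_sum'(2) intd set_integrable_mult_right int Is)+
  also have "\<dots> = 2 / \<beta>\<^sup>2 * ?X" by simp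
  finally have "?X \<le> 2 * measure M I + 12 * \<delta> * (2 / \<beta>\<^sup>2 * ?X)" using \<delta> by (simp add: mult_left_mono)
  also have "12 * \<delta> * (2 / \<beta>\<^sup>2 * ?X) = ?X / 2" using \<beta> by (simp add: \<delta>_def)
  finally show ?thesis by (simp add: \<delta>_def)
qed

section \<open>Muckenhoupt conditions for variable exponents\<close>

text \<open>The bounds hold at every point, not just almost everywhere; a general exponent is
  brought to this form by a change on a null set.\<close>

definition expo :: "('a \<Rightarrow> real) \<Rightarrow> real \<Rightarrow> real \<Rightarrow> bool" where
  "expo e a b \<longleftrightarrow> e \<in> borel_measurable M \<and> 1 < a \<and> (\<forall>x\<in>space M. a \<le> e x \<and> e x \<le> b)"

text \<open>The modular of \<open>t\<close> times the indicator of \<open>I\<close>, and equally the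
  measure of \<open>I\<close> under the weight \<open>t powr e\<close>; the argument moves between
  these two readings.\<close>

definition mass :: "('a \<Rightarrow> real) \<Rightarrow> real \<Rightarrow> 'a set \<Rightarrow> real" where
  "mass e t I = (LINT x:I|M. t powr e x)"

text \<open>The Muckenhoupt dual weight \<open>w powr (-1 / (e - 1))\<close> of
  \<open>w = t powr e\<close>, with the average of \<open>w\<close> placed inside the variable
  power: scaling \<open>w\<close> does not change it, and it is 1 where \<open>w\<close> equals its
  average.\<close>

definition dual_density :: "('a \<Rightarrow> real) \<Rightarrow> real \<Rightarrow> 'a set \<Rightarrow> 'a \<Rightarrow> real" where
  "dual_density e t I x = (mass e t I / measure M I / t powr e x) powr (1 / (e x - 1))"

text \<open>
  For constant \<open>e\<close> this is the \<open>A\<^sub>e\<close> condition for the weight \<open>t powr e\<close>; for variable \<open>e\<close> only sets of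
  mass at most 1 may be tested.
\<close>

definition muckenhoupt :: "('a \<Rightarrow> real) \<Rightarrow> real \<Rightarrow> bool" where
  "muckenhoupt e C \<longleftrightarrow> (\<forall>I\<in>F. \<forall>t\<ge>1. mass e t I \<le> 1 \<longrightarrow>
     (LINT x:I|M. dual_density e t I x) \<le> C * measure M I)"

lemma expo_measurable[measurable_dest]: "expo e a b \<Longrightarrow> e \<in> borel_measurable M"
  by (simp add: expo_def)

lemma expoD:
  assumes "expo e a b" "x \<in> space M"
  shows "a \<le> e x" "e x \<le> b" "1 < e x" "1 < a"
  using assms by (auto simp: expo_def)

lemma expo_le: "expo e a b \<Longrightarrow> a \<le> b"
proof -
  assume "expo e a b"
  moreover obtain x where "x \<in> space M" using not_empty by blast
  ultimately show "a \<le> b" unfolding expo_def by force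
qed

lemma expo_conj:
  assumes "expo e a b"
  shows "expo (conj_exp e) (b / (b - 1)) (a / (a - 1))"
proof -
  note [measurable] = expo_measurable[OF assms]
  have ab: "1 < a" "a \<le> b" using assms expo_le[OF assms] by (auto simp: expo_def)
  have "b / (b - 1) \<le> conj_exp e x \<and> conj_exp e x \<le> a / (a - 1)" if "x \<in> space M" for x
  proof -
    have eq: "y / (y - 1) = 1 + 1 / (y - 1)" if "1 < y" for y :: real using that by (simp add: field_simps)
    have "1 / (b - 1) \<le> 1 / (e x - 1)" "1 / (e x - 1) \<le> 1 / (a - 1)"
      using expoD[OF assms that] by (simp_all add: frac_le)
    then show ?thesis using expoD[OF assms that] ab by (simp add: conj_exp_def eq)
  qed
  moreover have "conj_exp e \<in> borel_measurable M"
    unfolding conj_exp_def[abs_def] by measurable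
  ultimately show ?thesis using ab by (simp add: expo_def)
qed

lemma conj_conj:
  assumes "1 < e x"
  shows "conj_exp (conj_exp e) x = e x"
  using assms by (simp add: conj_exp_def field_simps)

lemma mass_conj_conj:
  assumes "expo e a b" "I \<in> F"
  shows "mass (conj_exp (conj_exp e)) t I = mass e t I"
  unfolding mass_def set_lebesgue_integral_def
  using F_sets[OF assms(2)] sets.sets_into_space
  by (intro Bochner_Integration.integral_cong) (auto simp: conj_conj expoD(3)[OF assms(1)])

section \<open>Growth and normalization of the mass\<close>

lemma integrable_powr_expo:
  assumes "expo e a b" "I \<in> sets M"
  shows "set_integrable M I (\<lambda>x. t powr e x)"
proof -
  note [measurable] = expo_measurable[OF assms(1)] assms(2)
  show ?thesis
    using expoD[OF assms(1)] powr_le_sum_ends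
    by (intro bdd_set_integrable[where B="t powr a + t powr b"]) auto
qed

lemma mass_nonneg: "0 \<le> mass e t I"
  by (auto simp: mass_def set_lebesgue_integral_def intro!: Bochner_Integration.integral_nonneg)

text \<open>The one-sided substitute for homogeneity that survives variable exponents: factors
  \<open>c \<ge> 1\<close> may be moved into the power.\<close>

lemma powr_expo_scale:
  fixes c :: real
  assumes "1 \<le> c" "0 \<le> t" "1 \<le> y"
  shows "c * t powr y \<le> (c * t) powr y"
proof -
  have "c powr 1 \<le> c powr y" using assms by (intro powr_mono) auto
  then show ?thesis using assms by (simp add: powr_mult mult_right_mono)
qed

lemma mass_scale:
  assumes e: "expo e a b" and I: "I \<in> F" and "1 \<le> c" "0 \<le> t"
  shows "c * mass e t I \<le> mass e (c * t) I"
proof -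
  have Is: "I \<in> sets M" using F_sets I .
  have "c * mass e t I = (LINT x:I|M. c * t powr e x)" by (simp add: mass_def)
  also have "\<dots> \<le> mass e (c * t) I" unfolding mass_def
    using expoD(3)[OF e] assms sets.sets_into_space[OF Is]
    by (intro set_integral_mono set_integrable_mult_right integrable_powr_expo[OF e Is] powr_expo_scale) force+
  finally show ?thesis .
qed

lemma mass_ge:
  assumes e: "expo e a b" and I: "I \<in> F" and "1 \<le> t"
  shows "t * measure M I \<le> mass e t I"
proof -
  have Is: "I \<in> sets M" using F_sets I .
  have "mass e 1 I = measure M I" using Is by (simp add: mass_def set_integral_const')
  then show ?thesis using mass_scale[OF e I assms(3), of 1] by simp
qed

lemma mass_pos:
  assumes e: "expo e a b" and I: "I \<in> F" and "1 \<le> t"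
  shows "0 < mass e t I"
  using mass_ge[OF assms] F_pos[OF I] assms(3) by (smt (verit) mult_pos_pos)

text \<open>Its purpose is continuity in \<open>t\<close>, which a convex function on an open set
  has automatically; this feeds the intermediate value theorem.\<close>

lemma convex_on_mass:
  assumes e: "expo e a b" and I: "I \<in> F"
  shows "convex_on {0<..} (\<lambda>t. mass e t I)"
proof (rule convex_onI)
  fix t x y :: real assume t: "0 < t" "t < 1" and xy: "x \<in> {0<..}" "y \<in> {0<..}"
  have Is: "I \<in> sets M" using F_sets I .
  have "mass e ((1 - t) *\<^sub>R x + t *\<^sub>R y) I \<le> (LINT z:I|M. (1 - t) * x powr e z + t * y powr e z)"
    unfolding mass_def
  proof (intro set_integral_mono set_integral_add(1) set_integrable_mult_right integrable_powr_expo[OF e Is])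
    fix z assume "z \<in> I"
    then have "1 < e z" using expoD(3)[OF e] sets.sets_into_space[OF Is] by blast
    then have "convex_on {0<..} (\<lambda>x. x powr e z)"
      using powr_convex[of "e z"] by (auto intro: convex_on_subset)
    then show "((1 - t) *\<^sub>R x + t *\<^sub>R y) powr e z \<le> (1 - t) * x powr e z + t * y powr e z"
      using convex_onD[of "{0<..}" "\<lambda>x. x powr e z" t x y] t xy by simp
  qed
  also have "\<dots> = (1 - t) * mass e x I + t * mass e y I"
    unfolding mass_def
    by (subst set_integral_add(2)) (auto intro!: set_integrable_mult_right integrable_powr_expo[OF e Is])
  finally show "mass e ((1 - t) *\<^sub>R x + t *\<^sub>R y) I \<le> (1 - t) * mass e x I + t * mass e y I" .
qed simp

text \<open>The mass is \<open>measure M I \<le> 1\<close> at \<open>t = 1\<close> and at least 1 at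
  \<open>t = 1 / measure M I\<close>. The intermediate \<open>t\<close> is the reciprocal of the
  norm of the indicator.\<close>

lemma mass_normalize:
  assumes e: "expo e a b" and I: "I \<in> F"
  obtains t where "1 \<le> t" "mass e t I = 1"
proof -
  have Is: "I \<in> sets M" using F_sets I .
  have c: "continuous_on {0<..} (\<lambda>t. mass e t I)"
    by (rule convex_on_continuous[OF _ convex_on_mass[OF e I]]) auto
  have m: "0 < measure M I" "measure M I \<le> 1" using F_pos[OF I] by auto
  have "mass e 1 I = measure M I" using Is by (simp add: mass_def set_integral_const')
  moreover have "1 \<le> mass e (1 / measure M I) I"
    using mass_ge[OF e I, of "1 / measure M I"] m by simp
  ultimately have "\<exists>t\<ge>1. t \<le> 1 / measure M I \<and> mass e t I = 1"
    using m by (intro IVT' continuous_on_subset[OF c]) auto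
  then show ?thesis using that by blast
qed

lemma mass_le_one_imp_le:
  assumes e: "expo e a b" and I: "I \<in> F" and "mass e t I \<le> 1" "mass e s I = 1" "0 < s"
  shows "t \<le> s"
proof (rule ccontr)
  assume "\<not> t \<le> s"
  then have "1 < t / s" using assms by simp
  moreover from this have "t / s * mass e s I \<le> mass e (t / s * s) I" using assms by (intro mass_scale[OF e I]) auto
  ultimately show False using assms(3-5) by (metis linorder_not_less mult.right_neutral nonzero_eq_divide_eq
    order_less_irrefl order_less_le_trans)
qed

lemma mass_mono:
  assumes e: "expo e a b" and I: "I \<in> F" and "0 \<le> t" "t \<le> s"
  shows "mass e t I \<le> mass e s I"
  unfolding mass_def
  using F_sets[OF I] expoD(3)[OF e] sets.sets_into_space assms
  by (intro set_integral_mono integrable_powr_expo[OF e] powr_mono2) force+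

lemma jensen_powr:
  assumes I: "I \<in> F" and X: "set_integrable M I X" "\<And>x. x \<in> I \<Longrightarrow> 0 < X x"
    and "set_integrable M I (\<lambda>x. X x powr \<theta>)"
    and A: "(LINT x:I|M. X x) \<le> A * measure M I" "0 < A" and \<theta>: "0 \<le> \<theta>" "\<theta> \<le> 1"
  shows "(LINT x:I|M. X x powr \<theta>) \<le> A powr \<theta> * measure M I"
proof -
  have Is[measurable]: "I \<in> sets M" using F_sets I .
  have i: "set_integrable M I (\<lambda>x. \<theta> * A powr (\<theta> - 1) * X x)" using X by simp
  have j: "set_integrable M I (\<lambda>x. (1 - \<theta>) * A powr \<theta>)"
    by (rule bdd_set_integrable[where B="\<bar>(1 - \<theta>) * A powr \<theta>\<bar>"]) auto
  have "(LINT x:I|M. X x powr \<theta>) \<le> (LINT x:I|M. \<theta> * A powr (\<theta> - 1) * X x + (1 - \<theta>) * A powr \<theta>)"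
    using assms by (intro set_integral_mono set_integral_add(1) i j powr_interpolate) auto
  also have "\<dots> = \<theta> * A powr (\<theta> - 1) * (LINT x:I|M. X x) + (1 - \<theta>) * A powr \<theta> * measure M I"
    using set_integral_add(2)[OF i j] by (simp add: set_integral_const')
  also have "\<dots> \<le> \<theta> * A powr (\<theta> - 1) * (A * measure M I) + (1 - \<theta>) * A powr \<theta> * measure M I"
    using A \<theta> by (intro add_mono mult_left_mono) auto
  also have "\<dots> = A powr \<theta> * measure M I"
    using A by (simp add: powr_diff algebra_simps)
  finally show ?thesis .
qed

text \<open>Since \<open>1 / (e - 1)\<close> is \<open>conj_exp e - 1\<close>, the powers of the
  average \<open>W\<close> and of \<open>t\<close> collect into
  \<open>(W / t) powr conj_exp e\<close>, up to the constant \<open>W\<close>. So the dual weight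
  belongs to the same family of weights, for the conjugate exponent and the level
  \<open>W / t\<close>.\<close>

lemma dual_density_eq:
  assumes e: "expo e a b" and I: "I \<in> F" and t: "1 \<le> t" and x: "x \<in> space M"
  shows "dual_density e t I x = (mass e t I / measure M I / t) powr conj_exp e x / (mass e t I / measure M I)"
proof -
  let ?W = "mass e t I / measure M I"
  have W: "0 < ?W" using mass_pos[OF e I t] F_pos[OF I] by simp
  have e1: "1 < e x" using expoD(3)[OF e x] .
  have c: "conj_exp e x = 1 + 1 / (e x - 1)" using e1 by (simp add: conj_exp_def field_simps)
  have "dual_density e t I x = ?W powr (1 / (e x - 1)) / t powr (e x / (e x - 1))"
    using W t unfolding dual_density_def by (subst powr_divide) (auto simp: powr_powr)
  also have "e x / (e x - 1) = conj_exp e x" by (simp add: conj_exp_def)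
  also have "?W powr (1 / (e x - 1)) = ?W powr conj_exp e x / ?W"
  proof -
    have "w powr z = w powr (1 + z) / w" if "0 < w" for w z :: real using that by (simp add: powr_add)
    then show ?thesis using W unfolding c by blast
  qed
  also have "?W powr conj_exp e x / ?W / t powr conj_exp e x = (?W / t) powr conj_exp e x / ?W"
    using W t by (subst (2) powr_divide) (auto simp: mult.commute)
  finally show ?thesis .
qed

lemma dual_density_measurable[measurable]:
  assumes "expo e a b"
  shows "dual_density e t I \<in> borel_measurable M"
proof -
  note [measurable] = expo_measurable[OF assms]
  show ?thesis unfolding dual_density_def by measurable
qed

lemma dual_density_integrable:
  assumes e: "expo e a b" and I: "I \<in> F" and t: "1 \<le> t" and c: "0 \<le> c"
  shows "set_integrable M I (\<lambda>x. dual_density e t I x powr c)"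
proof -
  note [measurable] = dual_density_measurable[OF e]
  let ?W = "mass e t I / measure M I"
  define B where "B = ((?W / t) powr (b / (b - 1)) + (?W / t) powr (a / (a - 1))) / ?W"
  have W: "0 < ?W" using mass_pos[OF e I t] F_pos[OF I] by simp
  have "dual_density e t I x \<le> B" if "x \<in> space M" for x
    unfolding dual_density_eq[OF e I t that] B_def
    using W expoD(1,2)[OF expo_conj[OF e] that] by (intro divide_right_mono powr_le_sum_ends) auto
  moreover have "0 \<le> dual_density e t I x" for x by (simp add: dual_density_def)
  ultimately show ?thesis using F_sets[OF I] c
    by (intro bdd_set_integrable[where B="B powr c"]) (auto intro: powr_mono2)
qed

lemma dual_density_pos:
  assumes e: "expo e a b" and I: "I \<in> F" and t: "1 \<le> t"
  shows "0 < dual_density e t I x"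
  using mass_pos[OF e I t] F_pos[OF I] t by (simp add: dual_density_def)

text \<open>At the normalizing level \<open>s\<close> the hypothesis says that
  \<open>1 / (s * measure M I)\<close> is at most \<open>C * u\<close>; raising this to the power
  \<open>conj_exp e\<close> and integrating gives the bound, since \<open>u\<close> is normalized
  too. The factor \<open>C powr conj_exp e x\<close> is at most \<open>C powr (a / (a - 1))\<close>
  because \<open>a / (a - 1)\<close> is the largest conjugate exponent.\<close>

lemma muckenhouptI:
  assumes e: "expo e a b" and C: "1 \<le> C"
    and A: "\<And>I t u. I \<in> F \<Longrightarrow> 1 \<le> t \<Longrightarrow> 1 \<le> u \<Longrightarrow> mass e t I = 1 \<Longrightarrow> mass (conj_exp e) u I = 1 \<Longrightarrow>
      1 \<le> C * t * u * measure M I"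
  shows "muckenhoupt e (C powr (a / (a - 1)))"
  unfolding muckenhoupt_def
proof (intro ballI allI impI)
  fix I t assume I: "I \<in> F" and t: "1 \<le> t" "mass e t I \<le> 1"
  let ?C = "C powr (a / (a - 1))"
  have Is[measurable]: "I \<in> sets M" using F_sets I .
  have m: "0 < measure M I" using F_pos I .
  note e' = expo_conj[OF e]
  obtain s where s: "1 \<le> s" "mass e s I = 1" using mass_normalize[OF e I] .
  obtain u where u: "1 \<le> u" "mass (conj_exp e) u I = 1" using mass_normalize[OF e' I] .
  have "1 < a" using e by (simp add: expo_def)
  then have C1: "1 \<le> ?C" using C by (intro ge_one_powr_ge_zero) auto
  have ts: "t \<le> s" using mass_le_one_imp_le[OF e I t(2) s(2)] s by simp
  have "(LINT x:I|M. dual_density e s I x) \<le> (LINT x:I|M. ?C * measure M I * u powr conj_exp e x)"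
  proof (intro set_integral_mono set_integrable_mult_right integrable_powr_expo[OF e'] Is)
    show "set_integrable M I (dual_density e s I)"
      using dual_density_integrable[OF e I s(1), of 1] dual_density_pos[OF e I s(1)] by (simp add: less_imp_le)
    fix x assume "x \<in> I"
    then have x: "x \<in> space M" using sets.sets_into_space[OF Is] by blast
    have "1 / measure M I / s \<le> C * u"
      using A[OF I s(1) u(1) s(2) u(2)] m s by (simp add: field_simps)
    then have "(1 / measure M I / s) powr conj_exp e x \<le> (C * u) powr conj_exp e x"
      using m s expoD(3)[OF e' x] by (intro powr_mono2) auto
    also have "\<dots> = C powr conj_exp e x * u powr conj_exp e x" using C u by (simp add: powr_mult)
    also have "\<dots> \<le> ?C * u powr conj_exp e x"
      using C expoD(2)[OF e' x] by (intro mult_right_mono powr_mono) auto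
    finally show "dual_density e s I x \<le> ?C * measure M I * u powr conj_exp e x"
      using m by (simp add: dual_density_eq[OF e I s(1) x] s(2) field_simps)
  qed
  also have "\<dots> = ?C * measure M I" using u(2) by (simp add: mass_def)
  finally have S: "(LINT x:I|M. dual_density e s I x) \<le> ?C * measure M I" .
  show "(LINT x:I|M. dual_density e t I x) \<le> ?C * measure M I"
  proof (cases "s = 1")
    case True
    then have "t = s" using t ts by simp
    then show ?thesis using S by simp
  next
    case False
    \<comment> \<open>Writing \<open>t\<close> as \<open>s powr \<theta>\<close> makes the weight at
      \<open>t\<close> the power \<open>\<theta>\<close> of the weight at \<open>s\<close>. Jensen's
      inequality is then used twice, for the average of the weight and for the dual density. The
      case \<open>s = 1\<close>, where \<open>ln s = 0\<close>, forces \<open>t = s\<close> and is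
      settled above.\<close>
    define \<theta> where "\<theta> = ln t / ln s"
    have \<theta>: "0 \<le> \<theta>" "\<theta> \<le> 1" using t ts s False by (auto simp: \<theta>_def)
    have tt: "t = s powr \<theta>" using t s False by (simp add: \<theta>_def powr_def)
    let ?W = "\<lambda>t. mass e t I / measure M I"
    have "(LINT x:I|M. (s powr e x) powr \<theta>) \<le> (1 / measure M I) powr \<theta> * measure M I"
    proof (rule jensen_powr[OF I integrable_powr_expo[OF e Is] _ _ _ _ \<theta>])
      show "set_integrable M I (\<lambda>x. (s powr e x) powr \<theta>)"
        using integrable_powr_expo[OF e Is, of t] by (simp add: tt powr_powr mult.commute)
      show "(LINT x:I|M. s powr e x) \<le> 1 / measure M I * measure M I" using s(2) m by (simp add: mass_def)
    qed (use s m in auto)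
    then have "mass e t I \<le> ?W s powr \<theta> * measure M I"
      using s(2) by (simp add: mass_def tt powr_powr mult.commute)
    then have W: "?W t \<le> ?W s powr \<theta>" using m by (simp add: field_simps)
    have "(LINT x:I|M. dual_density e t I x) \<le> (LINT x:I|M. dual_density e s I x powr \<theta>)"
    proof (rule set_integral_mono)
      show "set_integrable M I (dual_density e t I)"
        using dual_density_integrable[OF e I t(1), of 1] dual_density_pos[OF e I t(1)] by (simp add: less_imp_le)
      show "set_integrable M I (\<lambda>x. dual_density e s I x powr \<theta>)"
        by (rule dual_density_integrable[OF e I s(1) \<theta>(1)])
      fix x assume "x \<in> I"
      then have x: "x \<in> space M" using sets.sets_into_space[OF Is] by blast
      have W0: "0 < ?W t" "0 < ?W s" using mass_pos[OF e I] t s m by auto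
      have "?W t / t powr e x \<le> ?W s powr \<theta> / (s powr e x) powr \<theta>"
      proof -
        have "t powr e x = (s powr e x) powr \<theta>" by (simp add: tt powr_powr mult.commute)
        then show ?thesis using W by (simp only: divide_right_mono powr_ge_zero)
      qed
      also have "\<dots> = (?W s / s powr e x) powr \<theta>" by (rule powr_divide[symmetric])
      finally have "(?W t / t powr e x) powr (1 / (e x - 1)) \<le> ((?W s / s powr e x) powr \<theta>) powr (1 / (e x - 1))"
        using mass_nonneg[of e t I] m expoD(3)[OF e x] by (intro powr_mono2) auto
      then show "dual_density e t I x \<le> dual_density e s I x powr \<theta>"
        by (simp add: dual_density_def powr_powr mult.commute)
    qed
    also have "\<dots> \<le> ?C powr \<theta> * measure M I"
      using S dual_density_pos[OF e I s(1)] dual_density_integrable[OF e I s(1), of 1]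
        dual_density_integrable[OF e I s(1) \<theta>(1)] \<theta> C1
      by (intro jensen_powr I) (auto simp: less_imp_le)
    also have "\<dots> \<le> ?C * measure M I"
      using powr_mono[OF \<theta>(2) C1] C1 m by simp
    finally show ?thesis .
  qed
qed

section \<open>The reverse Hoelder inequality and the open-endedness of the Muckenhoupt
  condition\<close>

text \<open>Where the weight is at most \<open>(2 * C) powr (- (b - 1))\<close> times its average,
  the dual density is at least \<open>2 * C\<close>. As its average is at most \<open>C\<close>,
  this happens on at most half of \<open>J\<close>.\<close>

lemma mass_large_set:
  assumes e: "expo e a b" and C: "1 \<le> C" and mk: "muckenhoupt e C"
    and J: "J \<in> F" and u: "1 \<le> u" "mass e u J \<le> 1"
  shows "measure M J \<le> 2 * measure M {x\<in>J. u powr e x > (2 * C) powr (- (b - 1)) * (mass e u J / measure M J)}"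
proof -
  note [measurable] = expo_measurable[OF e]
  have Js[measurable]: "J \<in> sets M" using F_sets J .
  have m: "0 < measure M J" using F_pos J .
  let ?W = "mass e u J / measure M J" and ?\<beta> = "(2 * C) powr (- (b - 1))"
  have W: "0 < ?W" using mass_pos[OF e J u(1)] m by simp
  let ?S = "{x\<in>J. u powr e x \<le> ?\<beta> * ?W}"
  have b: "1 < b" using e expo_le[OF e] by (simp add: expo_def)
  have "2 * C * measure M ?S = (LINT x:?S|M. 2 * C)" by (simp add: set_integral_const')
  also have "\<dots> \<le> (LINT x:?S|M. dual_density e u J x)"
  proof (rule set_integral_mono)
    have "set_integrable M J (dual_density e u J)"
      using dual_density_integrable[OF e J u(1), of 1] dual_density_pos[OF e J u(1)] by (simp add: less_imp_le)
    then show "set_integrable M ?S (dual_density e u J)" by (rule set_integrable_subset) auto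
    show "set_integrable M ?S (\<lambda>x. 2 * C)" by (intro bdd_set_integrable[where B="\<bar>2*C\<bar>"]) auto
    fix x assume xS: "x \<in> ?S"
    then have x: "x \<in> space M" using sets.sets_into_space[OF Js] by blast
    have "u powr e x \<le> ?W / (2 * C) powr (b - 1)"
      using xS unfolding powr_minus_divide by (simp add: mult.commute)
    then have "(2 * C) powr (b - 1) \<le> ?W / u powr e x"
      using u C by (simp only: le_divide_eq divide_le_eq mult.commute zero_less_mult_iff powr_gt_zero) auto
    then have "((2 * C) powr (b - 1)) powr (1 / (b - 1)) \<le> (?W / u powr e x) powr (1 / (b - 1))"
      using b by (intro powr_mono2) auto
    then have "2 * C \<le> (?W / u powr e x) powr (1 / (b - 1))" using C b by (simp add: powr_powr)
    \<comment> \<open>The base is at least 1, so the smallest possible exponent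
      \<open>1 / (b - 1)\<close> gives the lower bound.\<close>
    also have "\<dots> \<le> (?W / u powr e x) powr (1 / (e x - 1))"
    proof (rule powr_mono)
      show "1 / (b - 1) \<le> 1 / (e x - 1)" using expoD[OF e x] by (simp add: frac_le)
      have "1 \<le> (2 * C) powr (b - 1)" using C b by (intro ge_one_powr_ge_zero) auto
      then show "1 \<le> ?W / u powr e x" using \<open>(2 * C) powr (b - 1) \<le> ?W / u powr e x\<close> by linarith
    qed
    finally show "2 * C \<le> dual_density e u J x" by (simp add: dual_density_def)
  qed
  also have "\<dots> \<le> (LINT x:J|M. dual_density e u J x)"
    using dual_density_integrable[OF e J u(1), of 1] dual_density_pos[OF e J u(1)]
    by (intro set_integral_subset_le) (auto simp: less_imp_le)
  also have "\<dots> \<le> C * measure M J" using mk J u by (auto simp: muckenhoupt_def)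
  finally have "2 * measure M ?S \<le> measure M J" using C by simp
  moreover have "measure M J = measure M ?S + measure M {x\<in>J. u powr e x > ?\<beta> * ?W}"
  proof -
    have "J = ?S \<union> {x\<in>J. u powr e x > ?\<beta> * ?W}" by auto
    then have "measure M J = measure M (?S \<union> {x\<in>J. u powr e x > ?\<beta> * ?W})" by simp
    also have "\<dots> = measure M ?S + measure M {x\<in>J. u powr e x > ?\<beta> * ?W}"
      by (rule finite_measure_Union) auto
    finally show ?thesis .
  qed
  ultimately show ?thesis by linarith
qed

text \<open>Gehring's lemma is applied to the weight divided by its average over \<open>I\<close>;
  the density hypothesis is invariant under this scaling. It holds on every
  \<open>J \<subseteq> I\<close> because the mass of \<open>J\<close> is at most that of
  \<open>I\<close>, hence at most 1. The gain \<open>\<delta>\<close> depends only on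
  \<open>C\<close> and \<open>b\<close>.\<close>

lemma reverse_hoelder:
  assumes e: "expo e a b" and C: "1 \<le> C" and mk: "muckenhoupt e C"
  shows "\<exists>\<delta>>0. \<forall>I\<in>F. \<forall>u\<ge>1. mass e u I \<le> 1 \<longrightarrow>
    (LINT x:I|M. (u powr e x) powr (1 + \<delta>)) \<le> 4 * measure M I * (mass e u I / measure M I) powr (1 + \<delta>)"
proof -
  note [measurable] = expo_measurable[OF e]
  have b: "1 < b" using e expo_le[OF e] by (simp add: expo_def)
  define \<beta> where "\<beta> = (2 * C) powr (- (b - 1))"
  have \<beta>: "0 < \<beta>" using C by (simp add: \<beta>_def)
  have "\<beta> \<le> (2 * C) powr 0" unfolding \<beta>_def using b C by (intro powr_mono) auto
  then have \<beta>1: "\<beta> \<le> 1" using C by simp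
  define \<delta> where "\<delta> = \<beta>\<^sup>2 / 48"
  have "(LINT x:I|M. (u powr e x) powr (1 + \<delta>)) \<le> 4 * measure M I * (mass e u I / measure M I) powr (1 + \<delta>)"
    if I: "I \<in> F" and u: "1 \<le> u" "mass e u I \<le> 1" for I u
  proof -
    have Is[measurable]: "I \<in> sets M" using F_sets I .
    have m: "0 < measure M I" using F_pos I .
    define S where "S = mass e u I / measure M I"
    have S: "0 < S" using mass_pos[OF e I u(1)] m by (simp add: S_def)
    have sc: "(LINT x:J|M. u powr e x / S) = mass e u J / S" for J by (simp add: mass_def)
    have "(LINT x:I|M. (u powr e x / S) powr (1 + \<beta>\<^sup>2 / 48)) \<le> 4 * measure M I"
    proof (rule gehring[OF _ _ _ \<beta> \<beta>1 _ I])
      show "u powr e x / S \<le> (u powr a + u powr b) / S" if "x \<in> space M" for x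
        using S expoD[OF e that] by (intro divide_right_mono powr_le_sum_ends) auto
      show "(LINT x:I|M. u powr e x / S) \<le> measure M I" unfolding sc using S m by (simp add: S_def)
      fix J assume J: "J \<in> F" "J \<subseteq> I"
      have "mass e u J \<le> mass e u I" unfolding mass_def
        using F_sets[OF J(1)] J(2) by (intro set_integral_subset_le integrable_powr_expo[OF e Is]) auto
      then have "mass e u J \<le> 1" using u by simp
      from mass_large_set[OF e C mk J(1) u(1) this]
      have "measure M J \<le> 2 * measure M {x\<in>J. \<beta> * (mass e u J / measure M J) < u powr e x}"
        by (simp add: \<beta>_def)
      also have "{x\<in>J. \<beta> * (mass e u J / measure M J) < u powr e x} =
        {x\<in>J. \<beta> * ((LINT x:J|M. u powr e x / S) / measure M J) < u powr e x / S}"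
        unfolding sc using S by (auto simp: field_simps)
      finally show "measure M J \<le> 2 * measure M {x\<in>J. \<beta> * ((LINT x:J|M. u powr e x / S) / measure M J) < u powr e x / S}" .
    qed (use S in auto)
    also have "(LINT x:I|M. (u powr e x / S) powr (1 + \<beta>\<^sup>2 / 48)) = (LINT x:I|M. (u powr e x) powr (1 + \<delta>)) / S powr (1 + \<delta>)"
    proof -
      have "(u powr e x / S) powr (1 + \<delta>) = (u powr e x) powr (1 + \<delta>) / S powr (1 + \<delta>)" for x
        by (rule powr_divide)
      then show ?thesis by (simp add: \<delta>_def)
    qed
    finally have "(LINT x:I|M. (u powr e x) powr (1 + \<delta>)) \<le> 4 * measure M I * S powr (1 + \<delta>)"
      using S by (simp add: divide_le_eq)
    then show ?thesis by (simp add: S_def)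
  qed
  moreover have "0 < \<delta>" using \<beta> by (simp add: \<delta>_def)
  ultimately show ?thesis by blast
qed

text \<open>The reverse Hoelder inequality is wanted for the dual weight, that is, for the conjugate
  exponent at level \<open>u = W / t\<close>. There the mass is only known to be at most
  \<open>C\<close>, not 1, so \<open>u\<close> is first divided by \<open>C\<close>; bounded
  conjugate exponents make the price a constant.\<close>

lemma muckenhoupt_open:
  assumes e: "expo e a b" and C: "1 \<le> C" and mk: "muckenhoupt e C" and mk': "muckenhoupt (conj_exp e) C"
  shows "\<exists>\<delta>>0. \<exists>K\<ge>1. \<forall>I\<in>F. \<forall>t\<ge>1. mass e t I \<le> 1 \<longrightarrow>
    (LINT x:I|M. dual_density e t I x powr (1 + \<delta>)) \<le> K * measure M I"
proof -
  note e' = expo_conj[OF e]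
  let ?b = "a / (a - 1)"
  obtain \<delta> where \<delta>: "0 < \<delta>" and rh: "\<And>I u. I \<in> F \<Longrightarrow> 1 \<le> u \<Longrightarrow> mass (conj_exp e) u I \<le> 1 \<Longrightarrow>
    (LINT x:I|M. (u powr conj_exp e x) powr (1 + \<delta>)) \<le>
      4 * measure M I * (mass (conj_exp e) u I / measure M I) powr (1 + \<delta>)"
    using reverse_hoelder[OF e' C mk'] by blast
  define K where "K = 4 * C powr (?b * (1 + \<delta>))"
  have "1 < a" using e by (simp add: expo_def)
  then have Cb: "1 \<le> C powr (?b * (1 + \<delta>))" using C \<delta> by (intro ge_one_powr_ge_zero) auto
  have "(LINT x:I|M. dual_density e t I x powr (1 + \<delta>)) \<le> K * measure M I"
    if I: "I \<in> F" and t: "1 \<le> t" "mass e t I \<le> 1" for I t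
  proof -
    have Is[measurable]: "I \<in> sets M" using F_sets I .
    have m: "0 < measure M I" using F_pos I .
    define W where "W = mass e t I / measure M I"
    define u where "u = W / t"
    have u1: "1 \<le> u" using mass_ge[OF e I t(1)] m t by (simp add: u_def W_def field_simps)
    have "1 * 1 \<le> u * t" using u1 t by (intro mult_mono) auto
    then have W1: "1 \<le> W" using t by (simp add: u_def)
    have dd: "dual_density e t I x = u powr conj_exp e x / W" if "x \<in> I" for x
      using dual_density_eq[OF e I t(1)] sets.sets_into_space[OF Is] that by (auto simp: u_def W_def)
    have "mass (conj_exp e) u I / W = (LINT x:I|M. u powr conj_exp e x / W)"
      by (simp add: mass_def)
    also have "\<dots> = (LINT x:I|M. dual_density e t I x)"
      using dd by (intro set_lebesgue_integral_cong) auto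
    also have "\<dots> \<le> C * measure M I" using mk I t by (auto simp: muckenhoupt_def)
    finally have mu: "mass (conj_exp e) u I \<le> C * mass e t I"
      using W1 m by (simp add: W_def field_simps)
    have split: "dual_density e t I x powr (1 + \<delta>) \<le>
        C powr (?b * (1 + \<delta>)) * (((u / C) powr conj_exp e x) powr (1 + \<delta>) / W powr (1 + \<delta>))"
      if "x \<in> I" for x
    proof -
      have x: "x \<in> space M" using sets.sets_into_space[OF Is] that by blast
      have "u powr conj_exp e x = C powr conj_exp e x * (u / C) powr conj_exp e x"
        using C u1 by (simp add: powr_divide)
      also have "\<dots> \<le> C powr ?b * (u / C) powr conj_exp e x"
        using C expoD(2)[OF e' x] by (intro mult_right_mono powr_mono) auto
      finally have "dual_density e t I x \<le> C powr ?b * (u / C) powr conj_exp e x / W"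
        unfolding dd[OF that] using W1 by (intro divide_right_mono) auto
      then have "dual_density e t I x powr (1 + \<delta>) \<le> (C powr ?b * (u / C) powr conj_exp e x / W) powr (1 + \<delta>)"
        using dual_density_pos[OF e I t(1), of x] \<delta> by (intro powr_mono2) auto
      also have "\<dots> = C powr (?b * (1 + \<delta>)) * (((u / C) powr conj_exp e x) powr (1 + \<delta>) / W powr (1 + \<delta>))"
        using C u1 W1 by (simp add: powr_divide powr_mult powr_powr)
      finally show ?thesis .
    qed
    show ?thesis
    \<comment> \<open>The reverse Hoelder inequality requires the level \<open>u / C\<close> to be
      at least 1. If it is smaller, the dual density is bounded pointwise, since
      \<open>W \<ge> 1\<close>.\<close>
    proof (cases "C \<le> u")
      case True
      then have uC: "1 \<le> u / C" using C by simp
      have "C * mass (conj_exp e) (u / C) I \<le> mass (conj_exp e) u I"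
        using mass_scale[OF e' I C, of "u / C"] u1 C by simp
      then have mm: "mass (conj_exp e) (u / C) I \<le> mass e t I"
        using mu C by (meson mult_le_cancel_left_pos order_trans less_le_trans zero_less_one)
      then have "mass (conj_exp e) (u / C) I \<le> 1" using t by simp
      note rh[OF I uC this]
      also have "4 * measure M I * (mass (conj_exp e) (u / C) I / measure M I) powr (1 + \<delta>)
        \<le> 4 * measure M I * W powr (1 + \<delta>)"
        using mm m \<delta> mass_nonneg[of "conj_exp e" "u / C" I] unfolding W_def
        by (intro mult_left_mono powr_mono2 divide_right_mono) auto
      finally have R: "(LINT x:I|M. ((u / C) powr conj_exp e x) powr (1 + \<delta>)) \<le> 4 * measure M I * W powr (1 + \<delta>)" .
      have i: "set_integrable M I (\<lambda>x. ((u / C) powr conj_exp e x) powr (1 + \<delta>))"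
        using integrable_powr_expo[OF e' Is, of "(u / C) powr (1 + \<delta>)"] by (simp add: powr_powr mult.commute)
      have "(LINT x:I|M. dual_density e t I x powr (1 + \<delta>)) \<le>
        (LINT x:I|M. C powr (?b * (1 + \<delta>)) * (((u / C) powr conj_exp e x) powr (1 + \<delta>) / W powr (1 + \<delta>)))"
        using dual_density_integrable[OF e I t(1), of "1 + \<delta>"] \<delta> i
        by (intro set_integral_mono split set_integrable_mult_right set_integrable_divide) auto
      also have "\<dots> = C powr (?b * (1 + \<delta>)) * ((LINT x:I|M. ((u / C) powr conj_exp e x) powr (1 + \<delta>)) / W powr (1 + \<delta>))"
        by simp
      also have "\<dots> \<le> C powr (?b * (1 + \<delta>)) * (4 * measure M I * W powr (1 + \<delta>) / W powr (1 + \<delta>))"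
        by (intro mult_left_mono divide_right_mono R) auto
      also have "\<dots> = K * measure M I" using W1 by (simp add: K_def)
      finally show ?thesis .
    next
      case False
      have "(LINT x:I|M. dual_density e t I x powr (1 + \<delta>)) \<le> (LINT x:I|M. C powr (?b * (1 + \<delta>)))"
      proof (rule set_integral_mono)
        show "set_integrable M I (\<lambda>x. dual_density e t I x powr (1 + \<delta>))"
          using dual_density_integrable[OF e I t(1), of "1 + \<delta>"] \<delta> by auto
        show "set_integrable M I (\<lambda>x. C powr (?b * (1 + \<delta>)))"
          by (intro bdd_set_integrable[where B="C powr (?b * (1 + \<delta>))"]) auto
        fix x assume xI: "x \<in> I"
        then have x: "x \<in> space M" using sets.sets_into_space[OF Is] by blast
        have "(u / C) powr conj_exp e x \<le> 1"
          using False u1 C expoD(3)[OF e' x] by (intro powr_le1) auto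
        then have "((u / C) powr conj_exp e x) powr (1 + \<delta>) \<le> 1" using \<delta> by (intro powr_le1) auto
        moreover have "1 \<le> W powr (1 + \<delta>)" using W1 \<delta> by (intro ge_one_powr_ge_zero) auto
        ultimately have "((u / C) powr conj_exp e x) powr (1 + \<delta>) / W powr (1 + \<delta>) \<le> 1"
          by (simp add: divide_le_eq)
        then have "C powr (?b * (1 + \<delta>)) * (((u / C) powr conj_exp e x) powr (1 + \<delta>) / W powr (1 + \<delta>)) \<le> C powr (?b * (1 + \<delta>))"
          by (intro mult_left_le) auto
        then show "dual_density e t I x powr (1 + \<delta>) \<le> C powr (?b * (1 + \<delta>))"
          using split[OF xI] by linarith
      qed
      also have "\<dots> \<le> K * measure M I" using m Cb by (simp add: K_def set_integral_const')
      finally show ?thesis .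
    qed
  qed
  moreover have "1 \<le> K" using Cb by (simp add: K_def)
  ultimately show ?thesis using \<delta> by blast
qed

section \<open>The maximal function of a basis\<close>

definition maxf :: "('a \<Rightarrow> real) \<Rightarrow> 'a \<Rightarrow> ennreal" where
  "maxf f x = (SUP I\<in>{I \<in> F. x \<in> I}. (\<integral>\<^sup>+ y\<in>I. ennreal (f y) \<partial>M) / emeasure M I)"

definition enlarge :: "'a set \<Rightarrow> 'a set" where
  "enlarge I = (SOME I'. I' \<in> F \<and> I \<subseteq> I' \<and> measure M I' \<le> 3 * measure M I \<and>
    (\<forall>J\<in>F. J \<inter> I \<noteq> {} \<longrightarrow> measure M J \<le> measure M I \<longrightarrow> J \<subseteq> I'))"

lemma enlarge:
  assumes "I \<in> F"
  shows "enlarge I \<in> F" "I \<subseteq> enlarge I" "measure M (enlarge I) \<le> 3 * measure M I"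
    "J \<in> F \<Longrightarrow> J \<inter> I \<noteq> {} \<Longrightarrow> measure M J \<le> measure M I \<Longrightarrow> J \<subseteq> enlarge I"
proof -
  have "\<exists>I'. I' \<in> F \<and> I \<subseteq> I' \<and> measure M I' \<le> 3 * measure M I \<and>
    (\<forall>J\<in>F. J \<inter> I \<noteq> {} \<longrightarrow> measure M J \<le> measure M I \<longrightarrow> J \<subseteq> I')"
    using F_enlarge[OF assms] by (simp add: Bex_def)
  from someI_ex[OF this] show "enlarge I \<in> F" "I \<subseteq> enlarge I" "measure M (enlarge I) \<le> 3 * measure M I"
    "J \<in> F \<Longrightarrow> J \<inter> I \<noteq> {} \<Longrightarrow> measure M J \<le> measure M I \<Longrightarrow> J \<subseteq> enlarge I"
    unfolding enlarge_def[symmetric] by simp_all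
qed

text \<open>Greedy selection: take a set of largest measure and discard all sets meeting it. By the
  enlargement property these lie in its enlargement, and the rest is handled by induction.\<close>

lemma vitali_covering:
  assumes "finite S" "S \<subseteq> F"
  shows "\<exists>D\<subseteq>S. disjoint D \<and> (\<forall>J\<in>S. \<exists>I\<in>D. J \<subseteq> enlarge I)"
  using assms
proof (induction S rule: finite_psubset_induct)
  case (psubset S)
  show ?case
  proof (cases "S = {}")
    case False
    have "Max (measure M ` S) \<in> measure M ` S" using psubset(1) False by (intro Max_in) auto
    then obtain I where "I \<in> S" "measure M I = Max (measure M ` S)" by auto
    then have I: "I \<in> S" "\<And>J. J \<in> S \<Longrightarrow> measure M J \<le> measure M I" using psubset(1) by auto
    let ?S = "{J\<in>S. J \<inter> I = {}}"
    have "I \<in> F" using I(1) psubset.prems by auto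
    then have "I \<noteq> {}" using F_pos[of I] by force
    then have "?S \<subset> S" using I(1) by auto
    moreover have "?S \<subseteq> F" using psubset.prems by auto
    ultimately have "\<exists>D\<subseteq>?S. disjoint D \<and> (\<forall>J\<in>?S. \<exists>I\<in>D. J \<subseteq> enlarge I)" by (rule psubset.IH)
    then obtain D where D: "D \<subseteq> ?S" "disjoint D" "\<forall>J\<in>?S. \<exists>I\<in>D. J \<subseteq> enlarge I" by (elim exE conjE)
    have "disjoint (insert I D)" using D(1,2) by (auto simp: pairwise_insert disjnt_def)
    moreover have "\<exists>I'\<in>insert I D. J \<subseteq> enlarge I'" if J: "J \<in> S" for J
    proof (cases "J \<inter> I = {}")
      case True
      then show ?thesis using D(3) J by blast
    next
      case False
      have "J \<in> F" using J psubset.prems by auto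
      then show ?thesis using enlarge(4)[OF \<open>I \<in> F\<close> _ False] I(2)[OF J] by blast
    qed
    moreover have "insert I D \<subseteq> S" using D(1) I(1) by blast
    ultimately show ?thesis by blast
  qed auto
qed

section \<open>The weighted estimate of the level sets\<close>

lemma mass_eq_nn_integral:
  assumes e: "expo e a b" and I: "I \<in> sets M"
  shows "(\<integral>\<^sup>+ x\<in>I. ennreal (t powr e x) \<partial>M) = ennreal (mass e t I)"
proof -
  have "(\<integral>\<^sup>+ x. ennreal (indicator I x *\<^sub>R t powr e x) \<partial>M) = ennreal (mass e t I)"
    unfolding mass_def set_lebesgue_integral_def
    using integrable_powr_expo[OF assms] unfolding set_integrable_def by (intro nn_integral_eq_integral) auto
  moreover have "(\<integral>\<^sup>+ x\<in>I. ennreal (t powr e x) \<partial>M) = (\<integral>\<^sup>+ x. ennreal (indicator I x *\<^sub>R t powr e x) \<partial>M)"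
    by (intro nn_integral_cong) (auto split: split_indicator)
  ultimately show ?thesis by simp
qed

text \<open>The pointwise duality with \<open>r = (e x - 1) / (1 + \<delta>)\<close>, integrated;
  this \<open>r\<close> turns \<open>(W / w) powr (1 / r)\<close> into the power
  \<open>1 + \<delta>\<close> of the dual density. It serves both at \<open>\<delta> = 0\<close>, as
  a Hoelder inequality for \<open>e\<close> itself, and at the gain from the reverse Hoelder
  inequality.\<close>

lemma integral_le_dual_density:
  fixes g :: "'a \<Rightarrow> real"
  assumes e: "expo e a b" and I: "I \<in> F" and t: "1 \<le> t" and \<delta>: "0 \<le> \<delta>" and \<eta>: "0 < \<eta>" "\<eta> \<le> 1"
    and g[measurable]: "g \<in> borel_measurable M" and g0: "\<And>x. 0 \<le> g x"
  shows "(\<integral>\<^sup>+ x\<in>I. ennreal (g x) \<partial>M) \<le> ennreal (\<eta> * (LINT x:I|M. dual_density e t I x powr (1 + \<delta>))) +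
    ennreal (\<eta> powr (-(b - 1)) / (mass e t I / measure M I)) *
      (\<integral>\<^sup>+ x\<in>I. ennreal (g x powr (1 + (e x - 1) / (1 + \<delta>)) * t powr e x) \<partial>M)"
proof -
  note [measurable] = expo_measurable[OF e] dual_density_measurable[OF e]
  have Is[measurable]: "I \<in> sets M" using F_sets I .
  let ?W = "mass e t I / measure M I" and ?q = "\<lambda>x. 1 + (e x - 1) / (1 + \<delta>)"
  have W: "0 < ?W" using mass_pos[OF e I t] F_pos[OF I] by simp
  have pw: "g x \<le> \<eta> * dual_density e t I x powr (1 + \<delta>) + \<eta> powr (-(b - 1)) / ?W * (g x powr ?q x * t powr e x)"
    if x: "x \<in> space M" for x
  proof -
    define r where "r = (e x - 1) / (1 + \<delta>)"
    have "(e x - 1) / (1 + \<delta>) \<le> (e x - 1) / 1" using expoD[OF e x] \<delta> by (intro divide_left_mono) auto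
    then have r: "0 < r" "r \<le> b - 1" using expoD[OF e x] \<delta> by (auto simp: r_def)
    have "g x \<le> \<eta> * (?W / t powr e x) powr (1 / r) + t powr e x / ?W * \<eta> powr (-r) * g x powr (1 + r)"
      using W t g0 r \<eta> by (intro pointwise_duality) auto
    also have "(?W / t powr e x) powr (1 / r) = dual_density e t I x powr (1 + \<delta>)"
      by (simp add: dual_density_def powr_powr r_def)
    also have "t powr e x / ?W * \<eta> powr (-r) * g x powr (1 + r) \<le> t powr e x / ?W * \<eta> powr (-(b - 1)) * g x powr (1 + r)"
      using mass_nonneg[of e t I] r \<eta> by (intro mult_left_mono mult_right_mono powr_mono') auto
    also have "t powr e x / ?W * \<eta> powr (-(b - 1)) * g x powr (1 + r) =
        \<eta> powr (-(b - 1)) / ?W * (g x powr (1 + r) * t powr e x)" by (simp add: field_simps)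
    finally show ?thesis by (simp add: r_def)
  qed
  have "(\<integral>\<^sup>+ x\<in>I. ennreal (g x) \<partial>M) \<le> (\<integral>\<^sup>+ x. ennreal (indicator I x *\<^sub>R (\<eta> * dual_density e t I x powr (1 + \<delta>))) +
      ennreal (\<eta> powr (-(b - 1)) / ?W) * (ennreal (g x powr ?q x * t powr e x) * indicator I x) \<partial>M)"
  proof (intro nn_integral_mono)
    fix x assume x: "x \<in> space M"
    show "ennreal (g x) * indicator I x \<le> ennreal (indicator I x *\<^sub>R (\<eta> * dual_density e t I x powr (1 + \<delta>))) +
      ennreal (\<eta> powr (-(b - 1)) / ?W) * (ennreal (g x powr ?q x * t powr e x) * indicator I x)"
    proof (cases "x \<in> I")
      case True
      have "ennreal (g x) \<le> ennreal (\<eta> * dual_density e t I x powr (1 + \<delta>) +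
          \<eta> powr (-(b - 1)) / ?W * (g x powr ?q x * t powr e x))" by (intro ennreal_leI pw x)
      also have "\<dots> = ennreal (\<eta> * dual_density e t I x powr (1 + \<delta>)) +
          ennreal (\<eta> powr (-(b - 1)) / ?W) * ennreal (g x powr ?q x * t powr e x)"
      proof -
        have *: "ennreal (X + c * Y) = ennreal X + ennreal c * ennreal Y" if "0 \<le> X" "0 \<le> c" "0 \<le> Y" for X c Y :: real
          using that by (simp add: ennreal_plus ennreal_mult)
        show ?thesis by (rule *) (use mass_nonneg[of e t I] \<eta> in auto)
      qed
      finally show ?thesis using True by simp
    qed simp
  qed
  also have "\<dots> = (\<integral>\<^sup>+ x. ennreal (indicator I x *\<^sub>R (\<eta> * dual_density e t I x powr (1 + \<delta>))) \<partial>M) +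
      ennreal (\<eta> powr (-(b - 1)) / ?W) * (\<integral>\<^sup>+ x\<in>I. ennreal (g x powr ?q x * t powr e x) \<partial>M)"
    by (subst nn_integral_add) (auto simp: nn_integral_cmult)
  also have "(\<integral>\<^sup>+ x. ennreal (indicator I x *\<^sub>R (\<eta> * dual_density e t I x powr (1 + \<delta>))) \<partial>M) =
      ennreal (LINT x:I|M. \<eta> * dual_density e t I x powr (1 + \<delta>))"
  proof -
    have "set_integrable M I (\<lambda>x. \<eta> * dual_density e t I x powr (1 + \<delta>))"
      using dual_density_integrable[OF e I t, of "1 + \<delta>"] \<delta> by simp
    then show ?thesis unfolding set_integrable_def set_lebesgue_integral_def
      using \<eta> by (intro nn_integral_eq_integral) auto
  qed
  also have "(LINT x:I|M. \<eta> * dual_density e t I x powr (1 + \<delta>)) = \<eta> * (LINT x:I|M. dual_density e t I x powr (1 + \<delta>))"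
    by simp
  finally show ?thesis .
qed

lemma mass_le_levels:
  fixes g :: "'a \<Rightarrow> real"
  assumes e: "expo e a b" and \<delta>: "0 < \<delta>" and K: "1 \<le> K"
    and opn: "(LINT x:I|M. dual_density e t I x powr (1 + \<delta>)) \<le> K * measure M I"
    and I: "I \<in> F" and t: "1 \<le> t"
    and g[measurable]: "g \<in> borel_measurable M" and g0: "\<And>x. 0 \<le> g x"
    and avg: "ennreal (measure M I / 6) \<le> (\<integral>\<^sup>+ x\<in>I. ennreal (g x) \<partial>M)"
  shows "ennreal (mass e t I) \<le> ennreal (12 * (12 * K) powr (b - 1)) *
      (\<integral>\<^sup>+ x\<in>I. ennreal (g x powr (1 + (e x - 1) / (1 + \<delta>)) * t powr e x) \<partial>M)"
proof -
  let ?X = "\<integral>\<^sup>+ x\<in>I. ennreal (g x powr (1 + (e x - 1) / (1 + \<delta>)) * t powr e x) \<partial>M"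
  let ?H = "(12 * K) powr (b - 1)" and ?m = "measure M I"
  have m: "0 < ?m" using F_pos I .
  have mp: "0 < mass e t I" using mass_pos[OF e I t] .
  show ?thesis
  proof (cases "?X = \<infinity>")
    case True
    then show ?thesis using K by (simp add: ennreal_mult_top)
  next
    case False
    then obtain X where X: "?X = ennreal X" "0 \<le> X" by (cases ?X) auto
    have pe: "(1 / (12 * K)) powr (-(b - 1)) = ?H"
      unfolding powr_minus_divide powr_divide by simp
    \<comment> \<open>With \<open>\<eta> = 1 / (12 * K)\<close> the dual density contributes at most
      \<open>?m / 12\<close>, half of the left side, so the other term must account for the
      remaining \<open>?m / 12\<close>.\<close>
    have "ennreal (?m / 6) \<le> ennreal (1 / (12 * K) * (LINT x:I|M. dual_density e t I x powr (1 + \<delta>))) +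
      ennreal ((1 / (12 * K)) powr (-(b - 1)) / (mass e t I / ?m)) * ?X"
      using K \<delta> by (intro order_trans[OF avg] integral_le_dual_density[OF e I t _ _ _ g g0]) auto
    also have "\<dots> \<le> ennreal (1 / (12 * K) * (K * ?m)) + ennreal (?H / (mass e t I / ?m)) * ennreal X"
      unfolding X pe using opn K by (intro add_mono ennreal_leI mult_left_mono) auto
    also have "\<dots> = ennreal (?m / 12 + ?H / (mass e t I / ?m) * X)"
      using K m mp X by (simp add: ennreal_plus ennreal_mult[symmetric])
    finally have "?m / 6 \<le> ?m / 12 + ?H / (mass e t I / ?m) * X"
      using X m mp by (subst (asm) ennreal_le_iff) auto
    then have "mass e t I \<le> 12 * ?H * X" using m mp by (simp add: field_simps)
    then show ?thesis unfolding X using X by (simp add: ennreal_mult[symmetric] ennreal_leI)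
  qed
qed

text \<open>For \<open>s \<ge> 0\<close> and nonnegative \<open>f\<close> this is the set where
  \<open>maxf f\<close> exceeds \<open>s\<close>, with the averages cleared of denominators; as a
  countable union it is measurable.\<close>

definition level :: "('a \<Rightarrow> real) \<Rightarrow> real \<Rightarrow> 'a set" where
  "level f s = \<Union>{I\<in>F. ennreal (s * measure M I) < (\<integral>\<^sup>+ x\<in>I. ennreal (f x) \<partial>M)}"

lemma level_sets[measurable]: "level f s \<in> sets M"
  unfolding level_def using F_sets countable_subset[OF _ F_countable]
  by (intro sets.countable_Union) auto

text \<open>The height \<open>3 * (1 + C) * t\<close> is chosen so that the enlarged intervals have
  mass at most 1 at level \<open>t\<close>: the 3 pays for the enlargement, and \<open>1 + C\<close>
  for the duality estimate of \<open>f\<close> against the normalized weight.\<close>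

lemma level_estimate:
  fixes f :: "'a \<Rightarrow> real"
  assumes e: "expo e a b" and C: "1 \<le> C" and mk: "muckenhoupt e C"
    and \<delta>: "0 < \<delta>" and K: "1 \<le> K"
    and opn: "\<And>I t. I \<in> F \<Longrightarrow> 1 \<le> t \<Longrightarrow> mass e t I \<le> 1 \<Longrightarrow>
      (LINT x:I|M. dual_density e t I x powr (1 + \<delta>)) \<le> K * measure M I"
    and f[measurable]: "f \<in> borel_measurable M" and f0: "\<And>x. 0 \<le> f x"
    and f1: "(\<integral>\<^sup>+ x. ennreal (f x powr e x) \<partial>M) \<le> 1"
    and t: "1 \<le> t"
  shows "(\<integral>\<^sup>+ x\<in>level f (3 * (1 + C) * t). ennreal (t powr e x) \<partial>M) \<le> ennreal (12 * (12 * K) powr (b - 1)) *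
    (\<integral>\<^sup>+ x. ennreal (of_bool (t < 2 * f x) * (f x powr (1 + (e x - 1) / (1 + \<delta>)) * t powr (e x - (1 + (e x - 1) / (1 + \<delta>))))) \<partial>M)"
    (is "_ \<le> ?K * (\<integral>\<^sup>+ x. ennreal (?h x) \<partial>M)")
proof -
  note [measurable] = expo_measurable[OF e]
  let ?q = "\<lambda>x. 1 + (e x - 1) / (1 + \<delta>)"
  define G where "G = {I\<in>F. ennreal (3 * (1 + C) * t * measure M I) < (\<integral>\<^sup>+ x\<in>I. ennreal (f x) \<partial>M)}"
  have h[measurable]: "?h \<in> borel_measurable M" by measurable
  have single: "ennreal (mass e t (enlarge I)) \<le> ?K * (\<integral>\<^sup>+ x\<in>I. ennreal (?h x) \<partial>M)" if "I \<in> G" for I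
  proof -
    have I: "I \<in> F" and avg: "ennreal (3 * (1 + C) * t * measure M I) < (\<integral>\<^sup>+ x\<in>I. ennreal (f x) \<partial>M)"
      using that by (auto simp: G_def)
    let ?I = "enlarge I"
    note E = enlarge[OF I]
    have [measurable]: "I \<in> sets M" "?I \<in> sets M" using F_sets I E(1) by auto
    have m: "0 < measure M I" "0 < measure M ?I" using F_pos I E(1) by auto
    \<comment> \<open>At the normalizing level \<open>s\<close> of the enlarged interval, duality
      with the modular bound on \<open>f\<close> shows that the average of \<open>f\<close> is at
      most \<open>(1 + C) * s\<close>. The interval has average above
      \<open>3 * (1 + C) * t\<close>, which forces \<open>t \<le> s\<close>.\<close>
    obtain s where s: "1 \<le> s" "mass e s ?I = 1" using mass_normalize[OF e E(1)] .
    have "t \<le> s"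
    proof -
      have D1: "(LINT x:?I|M. dual_density e s ?I x powr (1 + 0)) \<le> C * measure M ?I"
        using mk E(1) s dual_density_pos[OF e E(1) s(1)] by (simp add: muckenhoupt_def less_imp_le)
      have "(\<integral>\<^sup>+ x\<in>?I. ennreal (f x / s) \<partial>M) \<le> ennreal (1 * (LINT x:?I|M. dual_density e s ?I x powr (1 + 0))) +
        ennreal (1 powr (-(b - 1)) / (mass e s ?I / measure M ?I)) *
        (\<integral>\<^sup>+ x\<in>?I. ennreal ((f x / s) powr (1 + (e x - 1) / (1 + 0)) * s powr e x) \<partial>M)"
        using s f0 by (intro integral_le_dual_density[OF e E(1) s(1)]) auto
      also have "(\<integral>\<^sup>+ x\<in>?I. ennreal ((f x / s) powr (1 + (e x - 1) / (1 + 0)) * s powr e x) \<partial>M) \<le> (\<integral>\<^sup>+ x. ennreal (f x powr e x) \<partial>M)"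
        using s by (intro nn_integral_mono) (auto simp: powr_divide split: split_indicator)
      also note f1
      also have "ennreal (1 * (LINT x:?I|M. dual_density e s ?I x powr (1 + 0))) +
        ennreal (1 powr (-(b - 1)) / (mass e s ?I / measure M ?I)) * 1 \<le> ennreal (C * measure M ?I) + ennreal (measure M ?I)"
        using D1 s by (intro add_mono ennreal_leI) auto
      also have "\<dots> = ennreal ((1 + C) * measure M ?I)"
        using C by (simp add: distrib_right add.commute ennreal_plus)
      finally have *: "(\<integral>\<^sup>+ x\<in>?I. ennreal (f x / s) \<partial>M) \<le> ennreal ((1 + C) * measure M ?I)"
        by (simp add: mult_left_mono)
      have "ennreal (3 * (1 + C) * t * measure M I) \<le> (\<integral>\<^sup>+ x\<in>?I. ennreal (f x) \<partial>M)"
        using E(2) by (intro order_trans[OF less_imp_le[OF avg]] nn_integral_mono) (auto split: split_indicator)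
      also have "\<dots> = (\<integral>\<^sup>+ x. ennreal s * (ennreal (f x / s) * indicator ?I x) \<partial>M)"
        using s f0 by (intro nn_integral_cong) (auto simp: ennreal_mult[symmetric] split: split_indicator)
      also have "\<dots> = ennreal s * (\<integral>\<^sup>+ x\<in>?I. ennreal (f x / s) \<partial>M)"
        by (rule nn_integral_cmult) measurable
      also have "\<dots> \<le> ennreal s * ennreal ((1 + C) * measure M ?I)" by (intro mult_left_mono *) auto
      also have "\<dots> \<le> ennreal (s * ((1 + C) * (3 * measure M I)))"
        using s C E(3) by (simp add: ennreal_mult[symmetric] ennreal_leI mult_left_mono)
      finally have "3 * (1 + C) * t * measure M I \<le> s * ((1 + C) * (3 * measure M I))"
        using s C m by (subst (asm) ennreal_le_iff) auto
      then have "(3 * (1 + C) * measure M I) * t \<le> (3 * (1 + C) * measure M I) * s" by (simp only: mult_ac)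
      moreover have "0 < 3 * (1 + C) * measure M I" using C m by simp
      ultimately show ?thesis by (simp only: mult_le_cancel_left_pos)
    qed
    then have mt: "mass e t ?I \<le> 1" using mass_mono[OF e E(1), of t s] t s by simp
    \<comment> \<open>Discarding the values \<open>f x \<le> t / 2\<close> costs at most
      \<open>t / 2\<close> on average and leaves ample mass. The restriction to \<open>I\<close>,
      rather than to its enlargement, lets the right-hand sides add up over disjoint
      intervals.\<close>
    define g where "g x = f x / t * of_bool (t < 2 * f x \<and> x \<in> I)" for x
    have g[measurable]: "g \<in> borel_measurable M"
    proof -
      have "g = (\<lambda>x. f x / t * of_bool (t < 2 * f x) * indicator I x)"
        by (auto simp: g_def fun_eq_iff split: split_indicator)
      then show ?thesis by simp
    qed
    have g0: "0 \<le> g x" for x using f0 t by (simp add: g_def)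
    have "ennreal (measure M ?I / 6) \<le> (\<integral>\<^sup>+ x\<in>?I. ennreal (g x) \<partial>M)"
    proof -
      have "ennreal (3 * (1 + C) * t * measure M I) \<le> (\<integral>\<^sup>+ x\<in>I. ennreal (f x) \<partial>M)" using avg by simp
      also have "\<dots> \<le> (\<integral>\<^sup>+ x. ennreal t * (ennreal (g x) * indicator ?I x) + ennreal (t / 2) * indicator I x \<partial>M)"
      proof (rule nn_integral_mono)
        fix x
        show "ennreal (f x) * indicator I x \<le> ennreal t * (ennreal (g x) * indicator ?I x) + ennreal (t / 2) * indicator I x"
        proof (cases "x \<in> I")
          case True
          have "f x \<le> t * g x + t / 2" using True t by (auto simp: g_def)
          then have "ennreal (f x) \<le> ennreal (t * g x + t / 2)" by (rule ennreal_leI)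
          then show ?thesis using True E(2) t g0[of x] by (auto simp: ennreal_plus ennreal_mult)
        qed simp
      qed
      also have "\<dots> = ennreal t * (\<integral>\<^sup>+ x\<in>?I. ennreal (g x) \<partial>M) + ennreal (t / 2) * emeasure M I"
        by (subst nn_integral_add) (auto simp: nn_integral_cmult)
      also have "ennreal (t / 2) * emeasure M I = ennreal (t / 2 * measure M I)"
        using t by (simp add: emeasure_eq_measure ennreal_mult[symmetric])
      finally have A: "ennreal (3 * (1 + C) * t * measure M I) \<le>
        ennreal t * (\<integral>\<^sup>+ x\<in>?I. ennreal (g x) \<partial>M) + ennreal (t / 2 * measure M I)" .
      show ?thesis
      proof (cases "(\<integral>\<^sup>+ x\<in>?I. ennreal (g x) \<partial>M)")
        case (real X)
        have "3 * (1 + C) * t * measure M I \<le> t * X + t / 2 * measure M I"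
          using A real t m(1) by (simp add: ennreal_mult[symmetric] ennreal_plus[symmetric] del: ennreal_plus)
        then have "t * (3 * (1 + C) * measure M I) \<le> t * (X + measure M I / 2)" by (simp add: algebra_simps)
        then have "3 * (1 + C) * measure M I \<le> X + measure M I / 2" using t by simp
        moreover have "3 * measure M I \<le> 3 * (1 + C) * measure M I" using C m by simp
        ultimately have "measure M ?I / 6 \<le> X" using E(3) m by linarith
        then show ?thesis using real by (simp add: ennreal_leI)
      qed simp
    qed
    from mass_le_levels[OF e \<delta> K opn[OF E(1) t mt] E(1) t g g0 this]
    have "ennreal (mass e t ?I) \<le> ?K * (\<integral>\<^sup>+ x\<in>?I. ennreal (g x powr ?q x * t powr e x) \<partial>M)" .
    also have "(\<integral>\<^sup>+ x\<in>?I. ennreal (g x powr ?q x * t powr e x) \<partial>M) = (\<integral>\<^sup>+ x\<in>I. ennreal (?h x) \<partial>M)"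
    proof (rule nn_integral_cong)
      fix x assume "x \<in> space M"
      show "ennreal (g x powr ?q x * t powr e x) * indicator ?I x = ennreal (?h x) * indicator I x"
        using E(2) t f0[of x] by (auto simp: g_def powr_divide powr_diff split: split_indicator)
    qed
    finally show ?thesis .
  qed
  define \<nu> where "\<nu> = density M (\<lambda>x. ennreal (t powr e x))"
  have \<nu>: "emeasure \<nu> A = (\<integral>\<^sup>+ x\<in>A. ennreal (t powr e x) \<partial>M)" if "A \<in> sets M" for A
    using that by (simp add: \<nu>_def emeasure_density)
  have \<nu>s[simp]: "sets \<nu> = sets M" by (simp add: \<nu>_def)
  \<comment> \<open>The covering lemma is for finite families; the countable family is exhausted by
    finite ones afterwards, with continuity of the measure from below.\<close>
  have fin: "emeasure \<nu> (\<Union>S) \<le> ?K * (\<integral>\<^sup>+ x. ennreal (?h x) \<partial>M)" if S: "finite S" "S \<subseteq> G" for S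
  proof -
    have "S \<subseteq> F" using S by (auto simp: G_def)
    from vitali_covering[OF S(1) this] obtain D
      where D: "D \<subseteq> S" "disjoint D" "\<forall>J\<in>S. \<exists>I\<in>D. J \<subseteq> enlarge I" by blast
    have fD: "finite D" using D(1) S(1) finite_subset by blast
    have DF: "D \<subseteq> F" using \<open>S \<subseteq> F\<close> D(1) by blast
    have Ds: "D \<subseteq> sets M" "enlarge ` D \<subseteq> sets M" using F_sets enlarge(1) DF by blast+
    have "emeasure \<nu> (\<Union>S) \<le> emeasure \<nu> (\<Union>I\<in>D. enlarge I)"
    proof (intro emeasure_mono)
      show "\<Union>S \<subseteq> (\<Union>I\<in>D. enlarge I)" using D(3) by blast
      show "(\<Union>I\<in>D. enlarge I) \<in> sets \<nu>" using Ds fD by auto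
    qed
    also have "\<dots> \<le> (\<Sum>I\<in>D. emeasure \<nu> (enlarge I))"
      using fD Ds by (intro emeasure_subadditive_finite) auto
    also have "\<dots> \<le> (\<Sum>I\<in>D. ?K * (\<integral>\<^sup>+ x\<in>I. ennreal (?h x) \<partial>M))"
      using single D(1) S(2) Ds by (intro sum_mono) (auto simp: \<nu> mass_eq_nn_integral[OF e])
    also have "\<dots> = ?K * (\<Sum>I\<in>D. emeasure (density M (\<lambda>x. ennreal (?h x))) I)"
      using Ds by (auto simp: sum_distrib_left emeasure_density intro!: sum.cong)
    also have "(\<Sum>I\<in>D. emeasure (density M (\<lambda>x. ennreal (?h x))) I) = emeasure (density M (\<lambda>x. ennreal (?h x))) (\<Union>I\<in>D. I)"
      using D(2) fD Ds by (intro sum_emeasure) (auto simp: disjoint_family_on_def pairwise_def disjnt_def)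
    also have "\<dots> \<le> emeasure (density M (\<lambda>x. ennreal (?h x))) (space M)"
    proof (rule emeasure_mono)
      show "(\<Union>I\<in>D. I) \<subseteq> space M" using Ds sets.sets_into_space by blast
    qed simp
    also have "\<dots> = (\<integral>\<^sup>+ x. ennreal (?h x) \<partial>M)"
      by (simp add: emeasure_density cong: nn_integral_cong)
    finally show ?thesis by (simp add: mult_left_mono)
  qed
  have lev: "level f (3 * (1 + C) * t) = \<Union>G" by (simp add: level_def G_def)
  show ?thesis
  proof (cases "G = {}")
    case True
    then show ?thesis unfolding lev by simp
  next
    case False
    have cG: "countable G" unfolding G_def using F_countable by (rule countable_subset[rotated]) auto
    define S where "S n = from_nat_into G ` {..n}" for n :: nat
    have S: "finite (S n)" "S n \<subseteq> G" for n using from_nat_into[OF False] by (auto simp: S_def)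
    have "\<Union>G = (\<Union>n. \<Union>(S n))"
    proof -
      have "(\<Union>n::nat. {..n}) = UNIV" by auto
      then have "G = (\<Union>n. S n)" using range_from_nat_into[OF False cG] unfolding S_def by (metis image_UN)
      then show ?thesis by auto
    qed
    then have "emeasure \<nu> (\<Union>G) = (SUP n. emeasure \<nu> (\<Union>(S n)))"
    proof (simp, intro SUP_emeasure_incseq[symmetric])
      show "range (\<lambda>n. \<Union>(S n)) \<subseteq> sets \<nu>"
        using S F_sets by (auto simp: G_def intro!: sets.finite_Union)
      show "incseq (\<lambda>n. \<Union>(S n))" by (intro monoI Union_mono) (auto simp: S_def)
    qed
    also have "\<dots> \<le> ?K * (\<integral>\<^sup>+ x. ennreal (?h x) \<partial>M)" by (intro SUP_least fin S)
    finally show ?thesis using \<nu>[OF level_sets[of f "3 * (1 + C) * t"]] unfolding lev by simp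
  qed
qed

text \<open>The summation over \<open>t = 2 ^ k\<close> converges because \<open>e x - q x\<close>
  has the positive lower bound \<open>d\<close>, which comes from \<open>a > 1\<close>: the dyadic
  sum up to \<open>2 * f x\<close> restores exactly the power lost in passing from \<open>e\<close>
  to \<open>q\<close>.\<close>

lemma maximal_modular:
  assumes e: "expo e a b" and C: "1 \<le> C" and mk: "muckenhoupt e C" and mk': "muckenhoupt (conj_exp e) C"
  shows "\<exists>K>0. \<forall>f\<in>borel_measurable M. (\<forall>x. 0 \<le> f x) \<longrightarrow>
    (\<integral>\<^sup>+ x. ennreal (f x powr e x) \<partial>M) \<le> 1 \<longrightarrow> modular M e (maxf f) K \<le> 1"
proof -
  note [measurable] = expo_measurable[OF e]
  obtain \<delta> K where \<delta>: "0 < \<delta>" and K: "1 \<le> K"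
    and opn: "\<And>I t. I \<in> F \<Longrightarrow> 1 \<le> t \<Longrightarrow> mass e t I \<le> 1 \<Longrightarrow>
      (LINT x:I|M. dual_density e t I x powr (1 + \<delta>)) \<le> K * measure M I"
    using muckenhoupt_open[OF e C mk mk'] by blast
  define q where "q x = 1 + (e x - 1) / (1 + \<delta>)" for x
  have [measurable]: "q \<in> borel_measurable M" unfolding q_def[abs_def] by measurable
  define d where "d = (a - 1) * \<delta> / (1 + \<delta>)"
  have "1 < a" using e by (simp add: expo_def)
  then have d: "0 < d" using \<delta> by (simp add: d_def)
  have dq: "d \<le> e x - q x" "e x - q x \<le> b" if "x \<in> space M" for x
  proof -
    have "e x - q x = (e x - 1) * \<delta> / (1 + \<delta>)" using \<delta> by (simp add: q_def field_simps)
    then show "d \<le> e x - q x" unfolding d_def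
      using expoD[OF e that] \<delta> by (simp add: divide_right_mono mult_right_mono)
    have "0 \<le> q x" using expoD[OF e that] \<delta> by (simp add: q_def)
    then show "e x - q x \<le> b" using expoD[OF e that] by simp
  qed
  define K1 where "K1 = 3 * (1 + C)"
  define K3 where "K3 = 12 * (12 * K) powr (b - 1)"
  define K5 where "K5 = 2 powr b / (1 - 2 powr (-d))"
  \<comment> \<open>The bound for the modular before the final scaling: 1 from the points where the
    maximal function is at most \<open>2 * K1\<close>, and \<open>K3 * K5\<close> from the levels.
    Dividing the argument by \<open>K4\<close> gains a factor \<open>1 / K4\<close>, as the exponent
    exceeds 1.\<close>
  define K4 where "K4 = 1 + K3 * K5"
  have K1: "1 \<le> K1" using C by (simp add: K1_def)
  have K3: "0 \<le> K3" by (simp add: K3_def)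
  have "2 powr (-d) < (2::real) powr 0" using d by (intro powr_less_mono) auto
  then have c: "2 powr (-d) < (1::real)" by simp
  then have K5: "0 \<le> K5" by (simp add: K5_def)
  have K4: "1 \<le> K4" using K3 K5 by (simp add: K4_def)
  have main: "modular M e (maxf f) (2 * K1 * K4) \<le> 1"
    if f[measurable]: "f \<in> borel_measurable M" and f0: "\<And>x. 0 \<le> f x"
      and f1: "(\<integral>\<^sup>+ x. ennreal (f x powr e x) \<partial>M) \<le> 1" for f
  proof -
    let ?h = "\<lambda>k x. of_bool (2 ^ k < 2 * f x) * (f x powr q x * (2 ^ k) powr (e x - q x))"
    let ?L = "\<lambda>k. level f (K1 * 2 ^ k)"
    have lev: "(\<integral>\<^sup>+ x\<in>?L k. ennreal ((2 ^ k) powr e x) \<partial>M) \<le> ennreal K3 * (\<integral>\<^sup>+ x. ennreal (?h k x) \<partial>M)" for k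
      unfolding K1_def K3_def q_def by (rule level_estimate[OF e C mk \<delta> K opn f f0 f1]) simp_all
    have sum_h: "(\<Sum>k. ennreal (?h k x)) \<le> ennreal (K5 * f x powr e x)" if x: "x \<in> space M" for x
    proof (rule suminf_le_const)
      fix n
      have pd: "0 < e x - q x" using dq(1)[OF x] d by linarith
      have "(\<Sum>k<n. ?h k x) = f x powr q x * (\<Sum>k<n. 2 powr (real k * (e x - q x)) * of_bool (2 ^ k < 2 * f x))"
      proof -
        have eq: "((2::real) ^ k) powr y = 2 powr (real k * y)" for k y
          by (simp add: powr_powr flip: powr_realpow)
        show ?thesis unfolding sum_distrib_left by (simp only: eq mult_ac)
      qed
      also have "\<dots> \<le> f x powr q x * ((2 * f x) powr (e x - q x) / (1 - 2 powr (-(e x - q x))))"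
        using f0 by (intro mult_left_mono dyadic_sum_le pd) auto
      also have "\<dots> \<le> f x powr q x * ((2 * f x) powr (e x - q x) / (1 - 2 powr (-d)))"
      proof -
        have "2 powr (-(e x - q x)) \<le> (2::real) powr (-d)" using dq(1)[OF x] by (intro powr_mono) auto
        then have "0 < 1 - 2 powr (-(e x - q x))" "1 - 2 powr (-d) \<le> 1 - 2 powr (-(e x - q x))"
          using c by linarith+
        then show ?thesis using c by (intro mult_left_mono divide_left_mono mult_pos_pos) auto
      qed
      also have "(2 * f x) powr (e x - q x) = 2 powr (e x - q x) * f x powr (e x - q x)"
        using f0 by (simp add: powr_mult)
      also have "f x powr q x * (2 powr (e x - q x) * f x powr (e x - q x) / (1 - 2 powr (-d))) =
          2 powr (e x - q x) / (1 - 2 powr (-d)) * f x powr e x"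
      proof -
        have "f x powr q x * f x powr (e x - q x) = f x powr e x" by (simp add: powr_add[symmetric])
        then show ?thesis by (simp add: field_simps)
      qed
      also have "\<dots> \<le> K5 * f x powr e x"
        unfolding K5_def using dq(2)[OF x] c by (intro mult_right_mono divide_right_mono powr_mono) auto
      finally show "(\<Sum>k<n. ennreal (?h k x)) \<le> ennreal (K5 * f x powr e x)"
        by (subst sum_ennreal) (auto intro: ennreal_leI)
    qed simp
    have pw: "ennpowr (maxf f x / ennreal (2 * K1 * K4)) (e x) \<le>
        ennreal (1 / K4) * (1 + (\<Sum>k. ennreal ((2 ^ k) powr e x) * indicator (?L k) x))" (is "_ \<le> _ * (1 + ?S)")
      if x: "x \<in> space M" for x
    proof -
      have e1: "1 < e x" using expoD(3)[OF e x] .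
      have inL: "x \<in> ?L k" if big: "ennreal (K1 * 2 ^ k) < maxf f x" for k
      proof -
        obtain I where I: "I \<in> F" "x \<in> I" "ennreal (K1 * 2 ^ k) < (\<integral>\<^sup>+ y\<in>I. ennreal (f y) \<partial>M) / emeasure M I"
          using big unfolding maxf_def less_SUP_iff by auto
        have m: "0 < measure M I" using F_pos I by auto
        have "ennreal (K1 * 2 ^ k * measure M I) < (\<integral>\<^sup>+ y\<in>I. ennreal (f y) \<partial>M)"
        proof (cases "\<integral>\<^sup>+ y\<in>I. ennreal (f y) \<partial>M")
          case (real r)
          then have "ennreal (K1 * 2 ^ k) < ennreal (r / measure M I)"
            using I(3) m by (simp add: emeasure_eq_measure divide_ennreal)
          then have "K1 * 2 ^ k < r / measure M I" using K1 by (subst (asm) ennreal_less_iff) auto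
          then show ?thesis using real m K1 by (simp add: ennreal_less_iff field_simps)
        qed simp
        then show ?thesis using I by (auto simp: level_def)
      qed
      show ?thesis
      proof (cases "maxf f x")
        case (real r)
        have rat: "maxf f x / ennreal (2 * K1 * K4) = ennreal (r / (2 * K1) / K4)"
          using real K1 K4 by (simp add: divide_ennreal)
        have bnd: "ennpowr (maxf f x / ennreal (2 * K1 * K4)) (e x) \<le> ennreal (1 / K4 * s powr e x)"
          if "r / (2 * K1) \<le> s" for s
        proof -
          have rs: "0 \<le> r / (2 * K1)" using real K1 by simp
          have s0: "0 \<le> s" using that rs by simp
          have "(r / (2 * K1) / K4) powr e x \<le> (s / K4) powr e x"
          proof (rule powr_mono2)
            show "0 \<le> r / (2 * K1) / K4" using K4 by (intro divide_nonneg_nonneg rs) simp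
            show "r / (2 * K1) / K4 \<le> s / K4" using that K4 by (intro divide_right_mono) auto
          qed (use e1 in simp)
          also have "\<dots> \<le> 1 / K4 * s powr e x"
          proof -
            have "K4 * (s / K4) powr e x \<le> (K4 * (s / K4)) powr e x"
              using K4 s0 e1 by (intro powr_expo_scale) auto
            then show ?thesis using K4 by (simp add: field_simps)
          qed
          finally have "(r / (2 * K1) / K4) powr e x \<le> 1 / K4 * s powr e x" .
          moreover have "enn2real (ennreal (r / (2 * K1) / K4)) = r / (2 * K1) / K4"
            using K4 by (intro enn2real_ennreal divide_nonneg_nonneg[OF rs]) simp
          ultimately show ?thesis unfolding ennpowr_def rat by (simp only: ennreal_neq_top ennreal_leI infinity_ennreal_def if_False)
        qed
        show ?thesis
        proof (cases "r \<le> 2 * K1")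
          case True
          have "ennpowr (maxf f x / ennreal (2 * K1 * K4)) (e x) \<le> ennreal (1 / K4) * 1"
            using bnd[of 1] True K1 by (simp add: field_simps)
          also have "\<dots> \<le> ennreal (1 / K4) * (1 + ?S)" by (intro mult_left_mono) auto
          finally show ?thesis .
        next
          case False
          \<comment> \<open>The level used is \<open>k = n - 1\<close>: minimality puts
            \<open>x\<close> into the level set at \<open>K1 * 2 ^ k\<close>, while
            \<open>r / (2 * K1)\<close> is at most \<open>2 ^ k\<close>.\<close>
          define n where "n = (LEAST n. r \<le> 2 ^ n * K1)"
          obtain n0 where "r < 2 ^ n0" using real_arch_pow[of 2 r] by auto
          moreover have "(2::real) ^ n0 * 1 \<le> 2 ^ n0 * K1" by (intro mult_left_mono K1) simp
          ultimately have "r \<le> 2 ^ n0 * K1" by linarith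
          then have n: "r \<le> 2 ^ n * K1" unfolding n_def by (rule LeastI)
          have "n \<noteq> 0"
          proof
            assume "n = 0"
            then have "r \<le> K1" using n by simp
            then show False using False K1 by linarith
          qed
          then obtain k where k: "n = Suc k" by (cases n) auto
          have "\<not> r \<le> 2 ^ k * K1" using not_less_Least[of k "\<lambda>n. r \<le> 2 ^ n * K1"] k by (simp add: n_def)
          then have "x \<in> ?L k" using real K1 by (intro inL) (simp add: ennreal_less_iff mult.commute)
          have "ennpowr (maxf f x / ennreal (2 * K1 * K4)) (e x) \<le> ennreal (1 / K4 * (2 ^ k) powr e x)"
            using n K1 k by (intro bnd) (simp add: field_simps)
          also have "\<dots> = ennreal (1 / K4) * (ennreal ((2 ^ k) powr e x) * indicator (?L k) x)"
            using \<open>x \<in> ?L k\<close> K4 by (simp add: ennreal_mult[symmetric])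
          also have "\<dots> \<le> ennreal (1 / K4) * (1 + ?S)"
          proof (intro mult_left_mono)
            have "sum g {k} \<le> suminf g" for g :: "nat \<Rightarrow> ennreal"
              by (intro sum_le_suminf) auto
            then have "g k \<le> 1 + suminf g" for g :: "nat \<Rightarrow> ennreal"
              by (simp add: add_increasing)
            then show "ennreal ((2 ^ k) powr e x) * indicator (?L k) x \<le> 1 + ?S" .
          qed simp
          finally show ?thesis .
        qed
      next
        case top
        \<comment> \<open>An infinite maximal function puts \<open>x\<close> into every level set,
          so the series diverges and dominates the infinite left-hand side.\<close>
        have "1 \<le> ennreal ((2 ^ k) powr e x) * indicator (?L k) x" for k
        proof -
          have "x \<in> ?L k" by (rule inL) (simp add: top)
          moreover have "1 \<le> ((2::real) ^ k) powr e x" using e1 by (intro ge_one_powr_ge_zero) auto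
          ultimately show ?thesis using ennreal_leI[of 1 "(2 ^ k) powr e x"] by simp
        qed
        then have "(\<Sum>k. 1) \<le> ?S" by (intro suminf_le) auto
        moreover have "(\<Sum>k. 1 :: ennreal) = \<infinity>"
          by (simp add: suminf_eq_SUP ennreal_SUP_of_nat_eq_top)
        ultimately have "?S = \<infinity>" by (simp add: top_unique)
        then show ?thesis using K4 by (simp add: ennreal_mult_top)
      qed
    qed
    have "modular M e (maxf f) (2 * K1 * K4) \<le>
        (\<integral>\<^sup>+ x. ennreal (1 / K4) * (1 + (\<Sum>k. ennreal ((2 ^ k) powr e x) * indicator (?L k) x)) \<partial>M)"
      unfolding modular_def by (intro nn_integral_mono pw)
    also have "\<dots> = ennreal (1 / K4) * (1 + (\<Sum>k. (\<integral>\<^sup>+ x\<in>?L k. ennreal ((2 ^ k) powr e x) \<partial>M)))"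
      by (simp add: nn_integral_cmult nn_integral_add nn_integral_suminf emeasure_space_1)
    also have "\<dots> \<le> ennreal (1 / K4) * (1 + (\<Sum>k. ennreal K3 * (\<integral>\<^sup>+ x. ennreal (?h k x) \<partial>M)))"
      by (intro mult_left_mono add_left_mono suminf_le lev) auto
    also have "(\<Sum>k. ennreal K3 * (\<integral>\<^sup>+ x. ennreal (?h k x) \<partial>M)) = ennreal K3 * (\<integral>\<^sup>+ x. (\<Sum>k. ennreal (?h k x)) \<partial>M)"
      by (subst nn_integral_suminf) auto
    also have "\<dots> \<le> ennreal K3 * (\<integral>\<^sup>+ x. ennreal K5 * ennreal (f x powr e x) \<partial>M)"
      using sum_h K5 by (intro mult_left_mono nn_integral_mono) (auto simp: ennreal_mult[symmetric])
    also have "\<dots> = ennreal K3 * (ennreal K5 * (\<integral>\<^sup>+ x. ennreal (f x powr e x) \<partial>M))"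
      by (subst nn_integral_cmult) auto
    also have "\<dots> \<le> ennreal K3 * (ennreal K5 * 1)" by (intro mult_left_mono f1) auto
    finally have "modular M e (maxf f) (2 * K1 * K4) \<le> ennreal (1 / K4) * (1 + ennreal K3 * (ennreal K5 * 1))"
      by (simp add: mult_left_mono add_left_mono)
    also have "1 + ennreal K3 * (ennreal K5 * 1) = ennreal K4"
      using K3 K5 by (simp add: K4_def ennreal_mult[symmetric])
    also have "ennreal (1 / K4) * ennreal K4 = 1" using K4 by (simp add: ennreal_mult[symmetric])
    finally show ?thesis .
  qed
  show ?thesis using main K1 K4 by (intro exI[of _ "2 * K1 * K4"]) auto
qed

section \<open>From modulars to norms, and the test functions\<close>

lemma muckenhoupt_mono:
  assumes "muckenhoupt e C" "C \<le> C'"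
  shows "muckenhoupt e C'"
  unfolding muckenhoupt_def
proof (intro ballI allI impI)
  fix I t assume "I \<in> F" "1 \<le> t" "mass e t I \<le> 1"
  then have "(LINT x:I|M. dual_density e t I x) \<le> C * measure M I" using assms(1) by (simp add: muckenhoupt_def)
  also have "\<dots> \<le> C' * measure M I" using assms(2) by (simp add: mult_right_mono)
  finally show "(LINT x:I|M. dual_density e t I x) \<le> C' * measure M I" .
qed

lemma modular_ge_mass:
  assumes e: "expo e a b" and I: "I \<in> F" and "0 < c" "0 < l"
    and g: "\<And>x. x \<in> I \<Longrightarrow> ennreal c \<le> g x"
  shows "ennreal (mass e (c / l) I) \<le> modular M e g l"
  unfolding modular_def mass_eq_nn_integral[OF e F_sets[OF I], symmetric]
proof (rule nn_integral_mono)
  fix x assume x: "x \<in> space M"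
  show "ennreal ((c / l) powr e x) * indicator I x \<le> ennpowr (g x / ennreal l) (e x)"
  proof (cases "x \<in> I")
    case True
    show ?thesis
    proof (cases "g x")
      case (real r)
      then have "c \<le> r" using g[OF True] assms by simp
      then have "c / l \<le> r / l" using assms by (simp add: divide_right_mono)
      then have "(c / l) powr e x \<le> (r / l) powr e x"
        using assms expoD(3)[OF e x] by (intro powr_mono2) auto
      then show ?thesis using real assms True by (simp add: ennpowr_def divide_ennreal ennreal_leI)
    next
      case top
      then show ?thesis using assms by (simp add: ennpowr_def ennreal_top_divide)
    qed
  qed simp
qed

text \<open>With this identification, the norm form of condition A becomes
  \<open>1 \<le> C * t * u * measure M I\<close> for the normalizing levels \<open>t\<close> and
  \<open>u\<close> of the two exponents.\<close>

lemma var_norm_indicator: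
  assumes e: "expo e a b" and I: "I \<in> F" and t: "1 \<le> t" "mass e t I = 1"
  shows "var_norm M e (indicator I) = ennreal (1 / t)"
  unfolding var_norm_def
proof (rule antisym)
  have "modular M e (indicator I) (1 / t) = (\<integral>\<^sup>+ x\<in>I. ennreal (t powr e x) \<partial>M)"
    unfolding modular_def
  proof (rule nn_integral_cong)
    fix x assume "x \<in> space M"
    then show "ennpowr (indicator I x / ennreal (1 / t)) (e x) = ennreal (t powr e x) * indicator I x"
      using t divide_ennreal[of 1 "1 / t"] by (auto simp: ennpowr_def split: split_indicator)
  qed
  then have "modular M e (indicator I) (1 / t) \<le> 1"
    using mass_eq_nn_integral[OF e F_sets[OF I], of t] t by simp
  then show "(INF l\<in>{l. 0 < l \<and> modular M e (indicator I) l \<le> 1}. ennreal l) \<le> ennreal (1 / t)"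
    using t by (intro INF_lower) auto
  show "ennreal (1 / t) \<le> (INF l\<in>{l. 0 < l \<and> modular M e (indicator I) l \<le> 1}. ennreal l)"
  proof (rule INF_greatest)
    fix l assume l: "l \<in> {l. 0 < l \<and> modular M e (indicator I) l \<le> 1}"
    have "ennreal (mass e (1 / l) I) \<le> modular M e (indicator I) l"
      using l by (intro modular_ge_mass[OF e I]) auto
    also have "\<dots> \<le> 1" using l by simp
    finally have "ennreal (mass e (1 / l) I) \<le> 1" .
    then have "mass e (1 / l) I \<le> 1" by simp
    from mass_le_one_imp_le[OF e I this t(2)] have "1 / l \<le> t" using t by simp
    then show "ennreal (1 / t) \<le> ennreal l" using l t by (intro ennreal_leI) (auto simp: field_simps)
  qed
qed

lemma maxf_scale:
  assumes [measurable]: "f \<in> borel_measurable M" and "\<And>x. 0 \<le> f x" "0 < l"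
  shows "maxf (\<lambda>x. f x / l) x = maxf f x / ennreal l"
proof -
  have "(\<integral>\<^sup>+ y\<in>I. ennreal (f y / l) \<partial>M) / emeasure M I = (\<integral>\<^sup>+ y\<in>I. ennreal (f y) \<partial>M) / emeasure M I / ennreal l"
    if "I \<in> F" for I
  proof -
    have [measurable]: "I \<in> sets M" using F_sets that .
    have "(\<integral>\<^sup>+ y\<in>I. ennreal (f y / l) \<partial>M) = (\<integral>\<^sup>+ y. (ennreal (f y) * indicator I y) / ennreal l \<partial>M)"
      using assms by (intro nn_integral_cong) (auto simp: divide_ennreal split: split_indicator)
    also have "\<dots> = (\<integral>\<^sup>+ y\<in>I. ennreal (f y) \<partial>M) / ennreal l"
      by (rule nn_integral_divide) measurable
    finally show ?thesis by (simp add: divide_ennreal_def mult_ac)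
  qed
  then show ?thesis unfolding maxf_def SUP_divide_ennreal by (intro SUP_cong) auto
qed

lemma strong_type_imp_norm_bound:
  assumes e: "expo p a b"
    and C: "\<And>f. f \<in> var_Lp M p \<Longrightarrow> var_norm M p (maxf (\<lambda>x. cmod (f x))) \<le> ennreal C * var_norm M p (\<lambda>x. ennreal (cmod (f x)))"
    and I: "I \<in> F" and t: "1 \<le> t" "mass p t I = 1" and u: "1 \<le> u" "mass (conj_exp p) u I = 1"
  shows "ennreal (1 / (t * u * measure M I)) \<le> ennreal C"
proof -
  note [measurable] = expo_measurable[OF e] expo_measurable[OF expo_conj[OF e]]
  have Is[measurable]: "I \<in> sets M" using F_sets I .
  have m: "0 < measure M I" using F_pos I .
  \<comment> \<open>The extremal function for duality on \<open>I\<close>: the identity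
    \<open>(conj_exp p - 1) * p = conj_exp p\<close> makes its modular equal to the mass of
    \<open>I\<close> for the conjugate exponent, which is 1.\<close>
  define g where "g x = indicator I x * u powr (conj_exp p x - 1)" for x
  have g[measurable]: "g \<in> borel_measurable M" unfolding g_def[abs_def] by measurable
  have g0: "0 \<le> g x" for x by (simp add: g_def)
  define f where "f x = complex_of_real (g x)" for x
  have fm[measurable]: "f \<in> borel_measurable M" unfolding f_def[abs_def] by measurable
  have cf: "cmod (f x) = g x" for x using g0 by (simp add: f_def)
  have "modular M p (\<lambda>x. ennreal (cmod (f x))) 1 = (\<integral>\<^sup>+ x\<in>I. ennreal (u powr conj_exp p x) \<partial>M)"
    unfolding modular_def cf
  proof (rule nn_integral_cong)
    fix x assume "x \<in> space M"
    then have "1 < p x" by (rule expoD(3)[OF e])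
    then have "conj_exp p x - 1 = 1 / (p x - 1)" by (simp add: conj_exp_def field_simps)
    then have "(conj_exp p x - 1) * p x = conj_exp p x" by (simp add: conj_exp_def)
    then show "ennpowr (ennreal (g x) / ennreal 1) (p x) = ennreal (u powr conj_exp p x) * indicator I x"
      using divide_ennreal[OF g0[of x], of 1] g0[of x]
      by (auto simp: ennpowr_def g_def powr_powr split: split_indicator)
  qed
  also have "\<dots> = 1" using mass_eq_nn_integral[OF expo_conj[OF e] Is, of u] u by simp
  finally have mod: "modular M p (\<lambda>x. ennreal (cmod (f x))) 1 = 1" .
  have fL: "f \<in> var_Lp M p" unfolding var_Lp_def using mod by (auto intro!: exI[of _ 1])
  have "var_norm M p (\<lambda>x. ennreal (cmod (f x))) \<le> ennreal 1"
    unfolding var_norm_def using mod by (intro INF_lower) auto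
  then have le: "var_norm M p (maxf g) \<le> ennreal C"
    using C[OF fL] mult_left_mono[of "var_norm M p (\<lambda>x. ennreal (cmod (f x)))" 1 "ennreal C"]
    by (simp add: cf order_trans)
  \<comment> \<open>This is the average of \<open>g\<close> over \<open>I\<close>, hence a lower
    bound for the maximal function on \<open>I\<close>; its norm is then at least
    \<open>c / t\<close>.\<close>
  define c where "c = 1 / (u * measure M I)"
  have c: "0 < c" using u m by (simp add: c_def)
  have "(\<integral>\<^sup>+ y\<in>I. ennreal (g y) \<partial>M) = (\<integral>\<^sup>+ y. ennreal (1 / u) * (ennreal (u powr conj_exp p y) * indicator I y) \<partial>M)"
    using u by (intro nn_integral_cong) (auto simp: g_def powr_diff ennreal_mult[symmetric] split: split_indicator)
  also have "\<dots> = ennreal (1 / u) * (\<integral>\<^sup>+ y\<in>I. ennreal (u powr conj_exp p y) \<partial>M)"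
    by (rule nn_integral_cmult) measurable
  also have "\<dots> = ennreal (1 / u)" using mass_eq_nn_integral[OF expo_conj[OF e] Is, of u] u by simp
  finally have gi: "(\<integral>\<^sup>+ y\<in>I. ennreal (g y) \<partial>M) / emeasure M I = ennreal c"
    using u m by (simp add: c_def emeasure_eq_measure divide_ennreal)
  have mg: "ennreal c \<le> maxf g x" if "x \<in> I" for x
    unfolding maxf_def gi[symmetric] using I that by (intro SUP_upper) auto
  have "ennreal (c / t) \<le> var_norm M p (maxf g)" unfolding var_norm_def
  proof (rule INF_greatest)
    fix l assume l: "l \<in> {l. 0 < l \<and> modular M p (maxf g) l \<le> 1}"
    have "ennreal (mass p (c / l) I) \<le> modular M p (maxf g) l"
      using l by (intro modular_ge_mass[OF e I c] mg) auto
    also have "\<dots> \<le> 1" using l by simp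
    finally have "ennreal (mass p (c / l) I) \<le> 1" .
    then have "mass p (c / l) I \<le> 1" by simp
    from mass_le_one_imp_le[OF e I this t(2)] have "c / l \<le> t" using t by simp
    then show "ennreal (c / t) \<le> ennreal l" using l t by (intro ennreal_leI) (auto simp: field_simps)
  qed
  with le have "ennreal (c / t) \<le> ennreal C" by (rule order_trans[rotated])
  then show ?thesis by (simp add: c_def mult_ac)
qed

lemma norm_bound_imp_strong_type:
  assumes e: "expo p a b"
    and C: "\<And>I t u. I \<in> F \<Longrightarrow> 1 \<le> t \<Longrightarrow> 1 \<le> u \<Longrightarrow> mass p t I = 1 \<Longrightarrow> mass (conj_exp p) u I = 1 \<Longrightarrow>
      1 \<le> C * t * u * measure M I" and C1: "1 \<le> C"
  shows "\<exists>K::real. \<forall>f\<in>var_Lp M p. var_norm M p (maxf (\<lambda>x. cmod (f x))) \<le> ennreal K * var_norm M p (\<lambda>x. ennreal (cmod (f x)))"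
proof -
  note e' = expo_conj[OF e]
  define a' where "a' = b / (b - 1)"
  define D where "D = max (C powr (a / (a - 1))) (C powr (a' / (a' - 1)))"
  have mk: "muckenhoupt p D"
    by (rule muckenhoupt_mono[OF muckenhouptI[OF e C1 C]]) (auto simp: D_def)
  \<comment> \<open>The hypothesis is symmetric in the two exponents: exchanging \<open>t\<close>
    and \<open>u\<close> gives the condition for \<open>conj_exp p\<close>, whose conjugate is
    \<open>p\<close> again.\<close>
  have "muckenhoupt (conj_exp p) (C powr (a' / (a' - 1)))"
    unfolding a'_def
  proof (rule muckenhouptI[OF e' C1])
    fix I t u assume *: "I \<in> F" "1 \<le> t" "1 \<le> u" "mass (conj_exp p) t I = 1" "mass (conj_exp (conj_exp p)) u I = 1"
    then show "1 \<le> C * t * u * measure M I"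
      using C[of I u t] mass_conj_conj[OF e *(1)] by (simp add: mult_ac)
  qed
  then have mk': "muckenhoupt (conj_exp p) D"
    by (rule muckenhoupt_mono) (auto simp: D_def)
  have "1 < a" using e by (simp add: expo_def)
  then have "1 \<le> C powr (a / (a - 1))" using C1 by (intro ge_one_powr_ge_zero) auto
  then have D: "1 \<le> D" by (simp add: D_def)
  obtain K where K: "0 < K" and modK: "\<And>f. f \<in> borel_measurable M \<Longrightarrow> (\<And>x. 0 \<le> f x) \<Longrightarrow>
    (\<integral>\<^sup>+ x. ennreal (f x powr p x) \<partial>M) \<le> 1 \<Longrightarrow> modular M p (maxf f) K \<le> 1"
    using maximal_modular[OF e D mk mk'] by blast
  have "var_norm M p (maxf (\<lambda>x. cmod (f x))) \<le> ennreal K * var_norm M p (\<lambda>x. ennreal (cmod (f x)))"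
    if "f \<in> var_Lp M p" for f
  proof -
    have f[measurable]: "f \<in> borel_measurable M" using that by (simp add: var_Lp_def)
    have step: "var_norm M p (maxf (\<lambda>x. cmod (f x))) \<le> ennreal (K * l)"
      if l: "0 < l" "modular M p (\<lambda>x. ennreal (cmod (f x))) l \<le> 1" for l
    proof -
      have "(\<integral>\<^sup>+ x. ennreal ((cmod (f x) / l) powr p x) \<partial>M) = modular M p (\<lambda>x. ennreal (cmod (f x))) l"
        unfolding modular_def using l by (intro nn_integral_cong) (simp add: ennpowr_def divide_ennreal)
      then have "modular M p (maxf (\<lambda>x. cmod (f x) / l)) K \<le> 1"
        using l by (intro modK) auto
      also have "modular M p (maxf (\<lambda>x. cmod (f x) / l)) K = modular M p (maxf (\<lambda>x. cmod (f x))) (K * l)"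
      proof -
        have "x / ennreal l / ennreal K = x / ennreal (K * l)" for x
          using K l by (cases x) (simp_all add: divide_ennreal ennreal_top_divide mult.commute)
        then show ?thesis using l by (simp add: modular_def maxf_scale)
      qed
      finally show ?thesis unfolding var_norm_def using K l by (intro INF_lower) auto
    qed
    have "var_norm M p (maxf (\<lambda>x. cmod (f x))) / ennreal K \<le> var_norm M p (\<lambda>x. ennreal (cmod (f x)))"
      unfolding var_norm_def[of M p "\<lambda>x. ennreal (cmod (f x))"]
    proof (rule INF_greatest)
      fix l assume "l \<in> {l. 0 < l \<and> modular M p (\<lambda>x. ennreal (cmod (f x))) l \<le> 1}"
      then have l: "0 < l" and "var_norm M p (maxf (\<lambda>x. cmod (f x))) \<le> ennreal (K * l)" using step by auto
      then have "var_norm M p (maxf (\<lambda>x. cmod (f x))) / ennreal K \<le> ennreal (K * l) / ennreal K"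
        by (intro divide_right_mono_ennreal)
      also have "\<dots> = ennreal l" using K l by (simp add: divide_ennreal)
      finally show "var_norm M p (maxf (\<lambda>x. cmod (f x))) / ennreal K \<le> ennreal l" .
    qed
    then have "ennreal K * (var_norm M p (maxf (\<lambda>x. cmod (f x))) / ennreal K) \<le> ennreal K * var_norm M p (\<lambda>x. ennreal (cmod (f x)))"
      by (rule mult_left_mono) simp
    also have "ennreal K * (var_norm M p (maxf (\<lambda>x. cmod (f x))) / ennreal K) = var_norm M p (maxf (\<lambda>x. cmod (f x)))"
      by (subst ennreal_times_divide, subst mult.commute, rule mult_divide_eq_ennreal) (use K in auto)
    finally show ?thesis .
  qed
  then show ?thesis by blast
qed

theorem bounded_iff_norm_condition:
  assumes e: "expo p a b"
  shows "(\<exists>C::real. \<forall>I\<in>F. var_norm M p (indicator I) * var_norm M (conj_exp p) (indicator I) / emeasure M I \<le> ennreal C)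
    \<longleftrightarrow> (\<exists>C::real. \<forall>f\<in>var_Lp M p. var_norm M p (maxf (\<lambda>x. cmod (f x))) \<le> ennreal C * var_norm M p (\<lambda>x. ennreal (cmod (f x))))"
    (is "(\<exists>C. \<forall>I\<in>F. ?N I \<le> ennreal C) \<longleftrightarrow> ?R")
proof -
  have N: "?N I = ennreal (1 / (t * u * measure M I))"
    if "I \<in> F" "1 \<le> t" "mass p t I = 1" "1 \<le> u" "mass (conj_exp p) u I = 1" for I t u
    using that F_pos[OF that(1)] var_norm_indicator[OF e that(1-3)] var_norm_indicator[OF expo_conj[OF e] that(1,4,5)]
    by (simp add: ennreal_mult[symmetric] emeasure_eq_measure divide_ennreal)
  show ?thesis
  proof
    assume "\<exists>C. \<forall>I\<in>F. ?N I \<le> ennreal C"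
    then obtain C0 where C0: "\<And>I. I \<in> F \<Longrightarrow> ?N I \<le> ennreal C0" by blast
    \<comment> \<open>A constant at least 1 is required to derive the Muckenhoupt conditions, and a
      nonnegative one to leave \<open>ennreal\<close>, which sends negative reals to 0.\<close>
    define C where "C = max C0 1"
    show ?R
    proof (rule norm_bound_imp_strong_type[OF e])
      show "1 \<le> C" by (simp add: C_def)
      fix I t u assume *: "I \<in> F" "1 \<le> t" "1 \<le> u" "mass p t I = 1" "mass (conj_exp p) u I = 1"
      have "ennreal (1 / (t * u * measure M I)) \<le> ennreal C"
        using C0[OF *(1)] unfolding N[OF *(1,2,4,3,5)] by (rule order_trans) (simp add: C_def ennreal_leI)
      then have "1 / (t * u * measure M I) \<le> C" by (subst (asm) ennreal_le_iff) (auto simp: C_def)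
      then show "1 \<le> C * t * u * measure M I" using * F_pos[OF *(1)] by (simp add: field_simps)
    qed
  next
    assume ?R
    then obtain C where C: "\<And>f. f \<in> var_Lp M p \<Longrightarrow>
      var_norm M p (maxf (\<lambda>x. cmod (f x))) \<le> ennreal C * var_norm M p (\<lambda>x. ennreal (cmod (f x)))" by blast
    have "?N I \<le> ennreal C" if I: "I \<in> F" for I
    proof -
      obtain t where t: "1 \<le> t" "mass p t I = 1" using mass_normalize[OF e I] .
      obtain u where u: "1 \<le> u" "mass (conj_exp p) u I = 1" using mass_normalize[OF expo_conj[OF e] I] .
      show ?thesis unfolding N[OF I t u] by (rule strong_type_imp_norm_bound[OF e C I t u])
    qed
    then show "\<exists>C. \<forall>I\<in>F. ?N I \<le> ennreal C" by blast
  qed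
qed

end

section \<open>Generalized intervals\<close>

text \<open>A description by conditions on coordinates rather than as a translated image: it
  exhibits an interval as a cylinder set over the coordinates up to \<open>k\<close>, whose measure
  is a finite product.\<close>

definition arc :: "(nat \<Rightarrow> nat) \<Rightarrow> (nat \<Rightarrow> nat) \<Rightarrow> nat \<Rightarrow> nat \<Rightarrow> (nat \<Rightarrow> nat) set" where
  "arc m x k j = {z \<in> G_set m. (\<forall>i<k. z i = x i) \<and> (\<exists>a<j. z k = (x k + a) mod m k)}"

lemma add_mod_exists:
  fixes a n z :: nat
  assumes "z < n"
  shows "\<exists>y<n. z = (a + y) mod n"
proof -
  have "z \<in> (\<lambda>y. (a + y) mod n) ` {..<n}"
    using bij_betw_add_mod[of n a] assms by (auto simp: bij_betw_def)
  then show ?thesis by auto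
qed

lemma add_mod_inj:
  fixes a n y z :: nat
  assumes "(a + y) mod n = (a + z) mod n" "y < n" "z < n"
  shows "y = z"
proof -
  have "inj_on (\<lambda>y. (a + y) mod n) {..<n}"
    using bij_betw_add_mod[of n a] assms by (auto simp: bij_betw_def)
  then show ?thesis by (rule inj_onD) (use assms in auto)
qed

lemma translate_eq_arc:
  assumes m: "\<And>i. 2 \<le> m i" and x: "x \<in> G_set m" and j: "j \<le> m k"
  shows "G_add m x ` {y \<in> G_set m. (\<forall>i<k. y i = 0) \<and> y k < j} = arc m x k j"
proof (intro equalityI subsetI)
  fix z assume "z \<in> G_add m x ` {y \<in> G_set m. (\<forall>i<k. y i = 0) \<and> y k < j}"
  then obtain y where y: "y \<in> G_set m" "\<forall>i<k. y i = 0" "y k < j" "z = G_add m x y" by auto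
  have "0 < m i" for i using m[of i] by simp
  then show "z \<in> arc m x k j" using y x by (auto simp: arc_def G_add_def G_set_def)
next
  fix z assume z: "z \<in> arc m x k j"
  then obtain a where a: "a < j" "z k = (x k + a) mod m k" by (auto simp: arc_def)
  have zG: "z i < m i" and xG: "x i < m i" for i using z x by (auto simp: arc_def G_set_def)
  have zx: "z i = x i" if "i < k" for i using z that by (simp add: arc_def)
  have "\<forall>i. \<exists>y<m i. z i = (x i + y) mod m i" using zG by (intro allI add_mod_exists)
  then obtain y0 where y0: "\<And>i. y0 i < m i" "\<And>i. z i = (x i + y0 i) mod m i" by metis
  \<comment> \<open>At coordinate \<open>k\<close> the offset must be the given
    \<open>a < j\<close>, which puts \<open>y\<close> into the untranslated interval; beyond
    \<open>k\<close> any solution of the congruence will do.\<close>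
  define y where "y i = (if i < k then 0 else if i = k then a else y0 i)" for i
  have "0 < m i" for i using m[of i] by simp
  then have "y \<in> G_set m" using y0(1) a j by (auto simp: y_def G_set_def)
  moreover have "z = G_add m x y"
  proof
    fix i
    consider "i < k" | "i = k" | "k < i" by linarith
    then show "z i = G_add m x y i"
    proof cases
      case 1
      then show ?thesis using zx[OF 1] xG[of i] by (simp add: y_def G_add_def)
    next
      case 2
      then show ?thesis using a by (simp add: y_def G_add_def)
    next
      case 3
      then show ?thesis using y0(2)[of i] by (simp add: y_def G_add_def)
    qed
  qed
  ultimately show "z \<in> G_add m x ` {y \<in> G_set m. (\<forall>i<k. y i = 0) \<and> y k < j}"
    using a by (auto simp: y_def)
qed

lemma gen_intervals_eq:
  assumes m: "\<And>i. 2 \<le> m i"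
  shows "gen_intervals m = {arc m x k j | x k j. x \<in> G_set m \<and> 1 \<le> j \<and> j \<le> m k}"
proof (intro equalityI subsetI)
  fix I assume "I \<in> gen_intervals m"
  then obtain x k j where "I = G_add m x ` {y \<in> G_set m. (\<forall>i<k. y i = 0) \<and> y k < j}"
    and x: "x \<in> G_set m" "1 \<le> j" "j \<le> m k" unfolding gen_intervals_def by blast
  then have "I = arc m x k j" using translate_eq_arc[OF m x(1,3)] by simp
  then show "I \<in> {arc m x k j | x k j. x \<in> G_set m \<and> 1 \<le> j \<and> j \<le> m k}" using x by blast
next
  fix I assume "I \<in> {arc m x k j | x k j. x \<in> G_set m \<and> 1 \<le> j \<and> j \<le> m k}"
  then obtain x k j where "I = arc m x k j" and x: "x \<in> G_set m" "1 \<le> j" "j \<le> m k" by blast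
  then have "I = G_add m x ` {y \<in> G_set m. (\<forall>i<k. y i = 0) \<and> y k < j}"
    using translate_eq_arc[OF m x(1,3)] by simp
  then show "I \<in> gen_intervals m" unfolding gen_intervals_def using x by blast
qed

lemma arc_in_gen_intervals:
  assumes m: "\<And>i. 2 \<le> m i" and "x \<in> G_set m" "1 \<le> j" "j \<le> m k"
  shows "arc m x k j \<in> gen_intervals m"
  using assms(2-4) unfolding gen_intervals_eq[OF m] by blast

lemma arc_full: "arc m x k (m k) = {z \<in> G_set m. \<forall>i<k. z i = x i}"
  using add_mod_exists by (auto simp: arc_def G_set_def)

text \<open>A single coset of the next subgroup is a full circle one level further down. This
  identification lets the bisection continue through all levels.\<close>

lemma arc_one:
  assumes "x \<in> G_set m"
  shows "arc m x k 1 = arc m x (Suc k) (m (Suc k))"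
  unfolding arc_full using assms by (auto simp: arc_def G_set_def less_Suc_eq)

lemma arc_eq_prod_emb:
  "arc m x k j = prod_emb UNIV (\<lambda>i. uniform_count_measure {..<m i}) {..k}
     (Pi\<^sub>E {..k} (\<lambda>i. if i < k then {x i} else (\<lambda>a. (x k + a) mod m k) ` {..<j}))"
proof -
  have all: "(\<forall>i\<in>{..k}. P i) \<longleftrightarrow> (\<forall>i<k. P i) \<and> P k" for P :: "nat \<Rightarrow> bool"
    by (auto simp: le_less)
  show ?thesis
    by (auto simp: arc_def G_set_def prod_emb_def space_PiM space_uniform_count_measure PiE_iff all
        extensional_def restrict_def)
qed

lemma sets_arc:
  assumes m: "\<And>i. 2 \<le> m i" and x: "x \<in> G_set m"
  shows "arc m x k j \<in> sets (haar m)"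
  unfolding arc_eq_prod_emb haar_def
proof (intro sets_PiM_I ballI)
  fix i assume "i \<in> {..k}"
  have "0 < m k" using m[of k] by simp
  then show "(if i < k then {x i} else (\<lambda>a. (x k + a) mod m k) ` {..<j}) \<in> sets (uniform_count_measure {..<m i})"
    using x \<open>i \<in> {..k}\<close> by (auto simp: sets_uniform_count_measure G_set_def)
qed auto

lemma measure_arc:
  assumes m: "\<And>i. 2 \<le> m i" and x: "x \<in> G_set m" and j: "j \<le> m k"
  shows "measure (haar m) (arc m x k j) = real j / real (\<Prod>i<Suc k. m i)"
proof -
  let ?U = "\<lambda>i. uniform_count_measure {..<m i}"
  interpret product_prob_space ?U UNIV by (rule product_prob_space_uniform[OF m])
  let ?A = "\<lambda>i. if i < k then {x i} else (\<lambda>a. (x k + a) mod m k) ` {..<j}"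
  have pos: "0 < m i" for i using m[of i] by simp
  have As: "?A i \<subseteq> {..<m i}" if "i \<in> {..k}" for i
    using x that pos[of k] by (auto simp: G_set_def)
  have "inj_on (\<lambda>a. (x k + a) mod m k) {..<j}"
    using j by (auto intro!: inj_onI dest: add_mod_inj)
  then have cA: "card (?A k) = j" by (simp add: card_image)
  have "measure (haar m) (arc m x k j) = (\<Prod>i\<in>{..k}. measure (?U i) (?A i))"
    unfolding haar_def arc_eq_prod_emb
    using As by (intro measure_PiM_emb) (auto simp: sets_uniform_count_measure)
  also have "\<dots> = (\<Prod>i\<in>{..k}. real (card (?A i)) / real (m i))"
    using As by (intro prod.cong refl) (simp add: measure_uniform_count_measure)
  also have "\<dots> = (\<Prod>i<k. 1 / real (m i)) * (real j / real (m k))"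
    using cA by (simp flip: lessThan_Suc_atMost)
  also have "\<dots> = real j / real (\<Prod>i<Suc k. m i)"
    by (simp add: prod_dividef)
  finally show ?thesis .
qed

section \<open>Countability, bisection and enlargement of intervals\<close>

lemma prod_strict_mono:
  fixes m :: "nat \<Rightarrow> nat"
  assumes m: "\<And>i. 2 \<le> m i"
  shows "strict_mono (\<lambda>k. \<Prod>i<k. m i)"
  unfolding strict_mono_Suc_iff
proof
  fix k
  have "0 < m i" for i using m[of i] by simp
  then have "0 < (\<Prod>i<k. m i)" by (simp add: prod_pos)
  then show "(\<Prod>i<k. m i) < (\<Prod>i<Suc k. m i)" using m[of k] by simp
qed

text \<open>An arc depends on its base point only through the coordinates up to \<open>k\<close>, so
  finite lists of naturals suffice as codes.\<close>

lemma countable_gen_intervals: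
  assumes m: "\<And>i. 2 \<le> m i"
  shows "countable (gen_intervals m)"
proof (rule countable_subset)
  let ?f = "\<lambda>(xs, k, j). arc m (\<lambda>i. if i < length xs then xs ! i else 0) k j"
  show "gen_intervals m \<subseteq> range ?f"
  proof
    fix I assume "I \<in> gen_intervals m"
    then obtain x k j where I: "I = arc m x k j" using gen_intervals_eq[OF m] by auto
    have "I = ?f (map x [0..<Suc k], k, j)"
      unfolding I by (simp add: arc_def del: upt_Suc cong: conj_cong)
    then show "I \<in> range ?f" by blast
  qed
qed auto

lemma arc_split:
  assumes m: "\<And>i. 2 \<le> m i" and x: "x \<in> G_set m" and j: "2 \<le> j" "j \<le> m k"
  shows "\<exists>L\<in>gen_intervals m. \<exists>R\<in>gen_intervals m. L \<union> R = arc m x k j \<and> L \<inter> R = {} \<and>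
    measure (haar m) (arc m x k j) \<le> 3 * measure (haar m) L \<and>
    measure (haar m) (arc m x k j) \<le> 3 * measure (haar m) R"
proof -
  \<comment> \<open>Halving rounded down; the ratio 3 is attained at \<open>j = 3\<close>, where the
    left part is a single coset. The right part starts \<open>h\<close> steps further along the
    circle.\<close>
  define h where "h = j div 2"
  define y where "y = x(k := (x k + h) mod m k)"
  have h: "1 \<le> h" "h < j" "j \<le> 3 * h" "j \<le> 3 * (j - h)" using j by (auto simp: h_def)
  have pos: "0 < m i" for i using m[of i] by simp
  have y: "y \<in> G_set m" using x pos by (auto simp: y_def G_set_def)
  let ?L = "arc m x k h" and ?R = "arc m y k (j - h)"
  have yk: "(y k + c) mod m k = (x k + (h + c)) mod m k" for c
    by (simp add: y_def mod_add_left_eq add.assoc)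
  have R: "?R = {z \<in> G_set m. (\<forall>i<k. z i = x i) \<and> (\<exists>c<j - h. z k = (x k + (h + c)) mod m k)}"
    unfolding arc_def yk by (simp add: y_def)
  have un: "?L \<union> ?R = arc m x k j"
  proof (intro equalityI subsetI)
    fix z assume "z \<in> ?L \<union> ?R"
    then show "z \<in> arc m x k j"
    proof
      assume "z \<in> ?L"
      then show ?thesis using h(2) by (auto simp: arc_def intro: less_trans)
    next
      assume "z \<in> ?R"
      then obtain c where c: "z \<in> G_set m" "\<forall>i<k. z i = x i" "c < j - h" "z k = (x k + (h + c)) mod m k"
        unfolding R by auto
      then have "h + c < j" by simp
      then show ?thesis using c unfolding arc_def by blast
    qed
  next
    fix z assume "z \<in> arc m x k j"
    then obtain a where a: "z \<in> G_set m" "\<forall>i<k. z i = x i" "a < j" "z k = (x k + a) mod m k"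
      by (auto simp: arc_def)
    show "z \<in> ?L \<union> ?R"
    proof (cases "a < h")
      case True
      then show ?thesis using a by (auto simp: arc_def)
    next
      case False
      then have "a - h < j - h" "a = h + (a - h)" using a(3) by auto
      then have "z \<in> ?R" unfolding R using a by (auto intro!: exI[of _ "a - h"])
      then show ?thesis ..
    qed
  qed
  have dj: "?L \<inter> ?R = {}"
  proof (rule ccontr)
    assume "?L \<inter> ?R \<noteq> {}"
    then obtain z a c where "a < h" "c < j - h" "z k = (x k + a) mod m k" "z k = (x k + (h + c)) mod m k"
      unfolding R by (auto simp: arc_def)
    then have "a = h + c" using j(2) h by (intro add_mod_inj[of "x k" a "m k" "h + c"]) auto
    then show False using \<open>a < h\<close> by simp
  qed
  have L: "?L \<in> gen_intervals m" and R: "?R \<in> gen_intervals m"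
    using h j by (auto intro!: arc_in_gen_intervals[OF m] x y)
  have P: "0 < real (\<Prod>i<Suc k. m i)" using pos by (simp add: prod_pos)
  have "real j \<le> 3 * real h" "real j \<le> 3 * real (j - h)" using h by linarith+
  then have "measure (haar m) (arc m x k j) \<le> 3 * measure (haar m) ?L"
    "measure (haar m) (arc m x k j) \<le> 3 * measure (haar m) ?R"
    using P h j by (simp_all add: measure_arc[OF m x] measure_arc[OF m y] divide_right_mono del: prod.lessThan_Suc of_nat_prod)
  then show ?thesis using L R un dj by blast
qed

lemma gen_intervals_split:
  assumes m: "\<And>i. 2 \<le> m i" and I: "I \<in> gen_intervals m"
  shows "\<exists>L\<in>gen_intervals m. \<exists>R\<in>gen_intervals m. L \<union> R = I \<and> L \<inter> R = {} \<and>
    measure (haar m) I \<le> 3 * measure (haar m) L \<and> measure (haar m) I \<le> 3 * measure (haar m) R"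
proof -
  obtain x k j where I: "I = arc m x k j" "x \<in> G_set m" "1 \<le> j" "j \<le> m k"
    using I gen_intervals_eq[OF m] by auto
  show ?thesis
  proof (cases "j = 1")
    case True
    then have "I = arc m x (Suc k) (m (Suc k))" using arc_one I by simp
    then show ?thesis using arc_split[OF m I(2) m order_refl] by simp
  next
    case False
    then show ?thesis using arc_split[OF m I(2) _ I(4)] I by simp
  qed
qed

lemma gen_intervals_enlarge:
  assumes m: "\<And>i. 2 \<le> m i" and I: "I \<in> gen_intervals m"
  shows "\<exists>I'\<in>gen_intervals m. I \<subseteq> I' \<and> measure (haar m) I' \<le> 3 * measure (haar m) I \<and>
      (\<forall>J\<in>gen_intervals m. J \<inter> I \<noteq> {} \<longrightarrow> measure (haar m) J \<le> measure (haar m) I \<longrightarrow> J \<subseteq> I')"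
proof -
  obtain x k j where I: "I = arc m x k j" and x: "x \<in> G_set m" and j: "1 \<le> j" "j \<le> m k"
    using I gen_intervals_eq[OF m] by auto
  have pos: "0 < m i" for i using m[of i] by simp
  let ?P = "\<lambda>k. \<Prod>i<k. m i"
  have P: "0 < ?P k" for k using pos by (simp add: prod_pos)
  have sm: "strict_mono ?P" by (rule prod_strict_mono[OF m])
  \<comment> \<open>The enlargement adds \<open>j\<close> cosets on either side, so it starts
    \<open>j\<close> steps before \<open>x\<close>; adding \<open>m k - j\<close> performs this
    subtraction modulo \<open>m k\<close>. If \<open>3 * j\<close> reaches \<open>m k\<close>, the
    whole circle is taken.\<close>
  define x' where "x' = x(k := (x k + (m k - j)) mod m k)"
  have x': "x' \<in> G_set m" using x pos by (auto simp: x'_def G_set_def)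
  define I' where "I' = (if m k \<le> 3 * j then arc m x k (m k) else arc m x' k (3 * j))"
  have I'F: "I' \<in> gen_intervals m"
    using j pos by (auto simp: I'_def Suc_le_eq intro!: arc_in_gen_intervals[OF m] x x')
  have meas: "measure (haar m) I' \<le> 3 * measure (haar m) I"
  proof -
    have "real (if m k \<le> 3 * j then m k else 3 * j) / real (?P (Suc k)) \<le> 3 * real j / real (?P (Suc k))"
      by (intro divide_right_mono of_nat_0_le_iff) auto
    moreover have "measure (haar m) I' = real (if m k \<le> 3 * j then m k else 3 * j) / real (?P (Suc k))"
      using j by (simp add: I'_def measure_arc[OF m x] measure_arc[OF m x'])
    moreover have "measure (haar m) I = real j / real (?P (Suc k))"
      using j by (simp add: I measure_arc[OF m x])
    ultimately show ?thesis by simp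
  qed
  have x'k: "(x' k + (j + c)) mod m k = (x k + c) mod m k" for c
  proof -
    have "(x' k + (j + c)) mod m k = (x k + (m k - j) + (j + c)) mod m k"
      by (simp add: x'_def mod_add_left_eq)
    also have "x k + (m k - j) + (j + c) = x k + c + m k" using j by simp
    finally show ?thesis by simp
  qed
  have inI': "z' \<in> I'" if z': "z' \<in> G_set m" "\<forall>i<k. z' i = x i"
    and c: "m k \<le> 3 * j \<or> (\<exists>d<3*j. z' k = (x' k + d) mod m k)" for z'
  proof (cases "m k \<le> 3 * j")
    case True
    then show ?thesis using z' by (simp add: I'_def arc_full)
  next
    case False
    then show ?thesis using z' c by (auto simp: I'_def arc_def x'_def)
  qed
  have sub: "I \<subseteq> I'"
  proof
    fix z assume "z \<in> I"
    then obtain a where a: "z \<in> G_set m" "\<forall>i<k. z i = x i" "a < j" "z k = (x k + a) mod m k"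
      by (auto simp: I arc_def)
    have "z k = (x' k + (j + a)) mod m k" using a x'k by simp
    moreover have "j + a < 3 * j" using a by simp
    ultimately show "z \<in> I'" using a by (intro inI') blast+
  qed
  have "J \<subseteq> I'" if J: "J \<in> gen_intervals m" and ne: "J \<inter> I \<noteq> {}"
    and le: "measure (haar m) J \<le> measure (haar m) I" for J
  proof -
    obtain y l i where J: "J = arc m y l i" and y: "y \<in> G_set m" and i: "1 \<le> i" "i \<le> m l"
      using J gen_intervals_eq[OF m] by auto
    obtain z where z: "z \<in> J" "z \<in> I" using ne by auto
    obtain a where a: "\<forall>i<k. z i = x i" "a < j" "z k = (x k + a) mod m k"
      using z by (auto simp: I arc_def)
    obtain b where b: "\<forall>i<l. z i = y i" "b < i" "z l = (y l + b) mod m l"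
      using z by (auto simp: J arc_def)
    have "real i / real (?P (Suc l)) \<le> real j / real (?P (Suc k))"
      using le i j by (simp add: I J measure_arc[OF m x] measure_arc[OF m y] del: prod.lessThan_Suc)
    then have "real i * real (?P (Suc k)) \<le> real j * real (?P (Suc l))"
      using P[of "Suc k"] P[of "Suc l"] by (simp add: frac_le_eq divide_le_eq pos_le_divide_eq mult.commute del: prod.lessThan_Suc of_nat_prod)
    then have ij: "i * ?P (Suc k) \<le> j * ?P (Suc l)"
      by (simp only: of_nat_mult[symmetric] of_nat_le_iff)
    show ?thesis
    proof
      fix z' assume "z' \<in> J"
      then obtain c where c: "z' \<in> G_set m" "\<forall>i<l. z' i = y i" "c < i" "z' l = (y l + c) mod m l"
        by (auto simp: J arc_def)
      consider "l < k" | "l = k" | "k < l" by linarith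
      then show "z' \<in> I'"
      proof cases
        case 1
        \<comment> \<open>A coarser \<open>J\<close> is no larger than \<open>I\<close> only if it
          is one coset at the level just above and \<open>I\<close> is a full circle; they then
          coincide, being the same coset.\<close>
        have "?P (Suc k) \<le> i * ?P (Suc k)" using i by simp
        also note ij
        also have "j * ?P (Suc l) \<le> m k * ?P (Suc l)" using j by simp
        finally have "?P k \<le> ?P (Suc l)" using pos[of k] by (simp add: mult.commute)
        then have "k \<le> Suc l" using strict_mono_less_eq[OF sm, of k "Suc l"] by (simp only:)
        then have k: "k = Suc l" using 1 by simp
        have "?P k * (i * m k) = i * ?P (Suc k)" by (simp only: prod.lessThan_Suc mult_ac)
        also note ij
        also have "j * ?P (Suc l) = ?P k * j" by (simp only: k mult.commute)
        finally have "i * m k \<le> j" using P[of k] by (simp only: mult_le_cancel1)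
        have i1: "i = 1"
        proof (rule ccontr)
          assume "i \<noteq> 1"
          then have "2 * m k \<le> i * m k" using i by (intro mult_le_mono1) simp
          then show False using \<open>i * m k \<le> j\<close> j pos[of k] by linarith
        qed
        then have "j = m k" using \<open>i * m k \<le> j\<close> j by simp
        have "b = 0" "c = 0" using b c i1 by auto
        then have "z' l = z l" using b(3) c(4) by simp
        moreover have "z' i = z i" if "i < l" for i using b(1) c(2) that by simp
        ultimately have "\<forall>i<k. z' i = x i" using a(1) k by (simp add: less_Suc_eq)
        then show ?thesis using c \<open>j = m k\<close> by (intro inI') auto
      next
        case 2
        have "i \<le> j" using ij P[of "Suc k"] 2 by simp
        \<comment> \<open>Measured from \<open>x'\<close>, the point \<open>z'\<close> has offset
          \<open>j + a + c - b\<close>, obtained by travelling through the common point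
          \<open>z\<close>; this inequality keeps the natural subtraction from truncating.\<close>
        have bm: "b \<le> j + a" using b \<open>i \<le> j\<close> by simp
        have "\<exists>d<3*j. z' k = (x' k + d) mod m k"
        proof (intro exI conjI)
          show "j + a + c - b < 3 * j" using a b c \<open>i \<le> j\<close> by simp
          have "y k + b + (m k - b) + c = (y k + c) + m k" using b i 2 by simp
          then have "z' k = (y k + b + (m k - b) + c) mod m k"
            using c(4) 2 by (simp only: mod_add_self2)
          also have "\<dots> = (z k + (m k - b) + c) mod m k"
            using b(3) 2 by (simp add: mod_add_left_eq add.assoc)
          also have "\<dots> = (x k + a + (m k - b) + c) mod m k"
            using a(3) by (simp add: mod_add_left_eq add.assoc)
          also have "\<dots> = (x k + (m k - j) + (j + a + c - b)) mod m k"
            using j b i 2 \<open>i \<le> j\<close> by (intro arg_cong[where f="\<lambda>n. n mod m k"]) simp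
          also have "\<dots> = (x' k + (j + a + c - b)) mod m k"
            by (simp add: x'_def mod_add_left_eq)
          finally show "z' k = (x' k + (j + a + c - b)) mod m k" .
        qed
        moreover have "\<forall>i<k. z' i = x i" using a b c 2 by auto
        ultimately show ?thesis using c by (intro inI') auto
      next
        case 3
        \<comment> \<open>A finer interval fixes the coordinates up to \<open>k\<close>, so once it
          meets \<open>I\<close> it is contained in \<open>I\<close>.\<close>
        then have "\<forall>i<k. z' i = x i" "z' k = z k" using a b c by auto
        then have "z' \<in> I" using c a by (auto simp: I arc_def)
        then show ?thesis using sub by blast
      qed
    qed
  qed
  then show ?thesis using I'F sub meas by blast
qed

section \<open>Approximation by cylinder sets\<close>

text \<open>The sets that can be approximated in measure by sets depending on finitely many
  coordinates form a sigma-algebra, and it contains the generators of the product.\<close>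

lemma approx_by_cylinder:
  assumes m: "\<And>i. 2 \<le> m i" and E: "E \<in> sets (haar m)" and \<epsilon>: "0 < \<epsilon>"
  shows "\<exists>k. \<exists>A\<in>sets (haar m). (\<forall>x\<in>G_set m. \<forall>y\<in>G_set m. (\<forall>i<k. x i = y i) \<longrightarrow> (x \<in> A \<longleftrightarrow> y \<in> A)) \<and>
    measure (haar m) (E - A) + measure (haar m) (A - E) < \<epsilon>"
proof -
  let ?M = "haar m" and ?U = "\<lambda>i. uniform_count_measure {..<m i}"
  interpret prob_space ?M by (rule prob_space_haar[OF m])
  define Cyl where "Cyl k A \<longleftrightarrow> A \<in> sets ?M \<and> (\<forall>x\<in>G_set m. \<forall>y\<in>G_set m. (\<forall>i<k. x i = y i) \<longrightarrow> (x \<in> A \<longleftrightarrow> y \<in> A))"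
    for k :: nat and A
  have S: "sets ?M = sigma_sets (G_set m) {{f\<in>G_set m. f i \<in> A} | i A. i \<in> UNIV \<and> A \<in> sets (?U i)}"
    using sets_PiM_single[of UNIV ?U] space_haar[of m] by (simp add: haar_def space_PiM)
  have "\<forall>\<epsilon>>0. \<exists>k A. Cyl k A \<and> measure ?M (E - A) + measure ?M (A - E) < \<epsilon>"
    using E[unfolded S]
  proof (induction rule: sigma_sets.induct)
    case (Basic E)
    then obtain i A where E: "E = {f\<in>G_set m. f i \<in> A}" by blast
    have "E \<in> sets ?M" unfolding S by (rule sigma_sets.Basic[OF Basic])
    moreover have "\<forall>x\<in>G_set m. \<forall>y\<in>G_set m. (\<forall>l<Suc i. x l = y l) \<longrightarrow> (x \<in> E \<longleftrightarrow> y \<in> E)"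
      unfolding E by auto
    ultimately have cyl: "Cyl (Suc i) E" unfolding Cyl_def by (rule conjI)
    show ?case
    proof (intro allI impI)
      fix \<epsilon> :: real assume "0 < \<epsilon>"
      then have "measure ?M (E - E) + measure ?M (E - E) < \<epsilon>" by simp
      with cyl have *: "Cyl (Suc i) E \<and> measure ?M (E - E) + measure ?M (E - E) < \<epsilon>" by (rule conjI)
      show "\<exists>k A. Cyl k A \<and> measure ?M (E - A) + measure ?M (A - E) < \<epsilon>"
        by (rule exI[of _ "Suc i"], rule exI[of _ E], rule *)
    qed
  next
    case Empty
    show ?case
    proof (intro allI impI)
      fix \<epsilon> :: real assume "0 < \<epsilon>"
      show "\<exists>k A. Cyl k A \<and> measure ?M ({} - A) + measure ?M (A - {}) < \<epsilon>"
        by (rule exI[of _ 0], rule exI[of _ "{}"]) (use \<open>0 < \<epsilon>\<close> in \<open>simp add: Cyl_def\<close>)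
    qed
  next
    case (Compl E)
    show ?case
    proof (intro allI impI)
      fix \<epsilon> :: real assume "0 < \<epsilon>"
      then obtain k A where A: "Cyl k A" "measure ?M (E - A) + measure ?M (A - E) < \<epsilon>"
        using Compl.IH by blast
      have "A \<subseteq> G_set m" using A(1)[unfolded Cyl_def, THEN conjunct1] sets.sets_into_space[of A ?M] space_haar[of m] by auto
      moreover have "E \<subseteq> G_set m" using Compl.hyps sigma_sets_into_sp[OF _ Compl.hyps] by (auto simp: S)
      ultimately have "(G_set m - E) - (G_set m - A) = A - E" "(G_set m - A) - (G_set m - E) = E - A" by auto
      moreover have "Cyl k (G_set m - A)"
      proof -
        have "G_set m - A \<in> sets ?M" using A(1)[unfolded Cyl_def, THEN conjunct1] sets.compl_sets[of A ?M] space_haar[of m] by auto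
        then show ?thesis using A(1) unfolding Cyl_def by blast
      qed
      ultimately have *: "Cyl k (G_set m - A) \<and>
          measure ?M ((G_set m - E) - (G_set m - A)) + measure ?M ((G_set m - A) - (G_set m - E)) < \<epsilon>"
        using A(2) by (simp only: add.commute)
      show "\<exists>k A. Cyl k A \<and> measure ?M ((G_set m - E) - A) + measure ?M (A - (G_set m - E)) < \<epsilon>"
        by (rule exI[of _ k], rule exI[of _ "G_set m - A"], rule *)
    qed
  next
    case (Union E)
    show ?case
    proof (intro allI impI)
      fix \<epsilon> :: real assume \<epsilon>: "0 < \<epsilon>"
      have Es[measurable]: "E i \<in> sets ?M" for i using Union.hyps by (simp add: S)
      have "(\<lambda>n. measure ?M (\<Union>i<n. E i)) \<longlonglongrightarrow> measure ?M (\<Union>n. \<Union>i<n. E i)"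
      proof (intro finite_Lim_measure_incseq)
        show "incseq (\<lambda>n. \<Union>i<n. E i)" by (intro monoI UN_mono) auto
      qed auto
      moreover have "(\<Union>n. \<Union>i<n. E i) = (\<Union>i. E i)" by auto
      ultimately have "\<exists>n. dist (measure ?M (\<Union>i<n. E i)) (measure ?M (\<Union>i. E i)) < \<epsilon> / 2"
        using \<epsilon> by (metis LIMSEQ_D dist_norm half_gt_zero order_refl real_norm_def)
      then obtain n where n: "\<bar>measure ?M (\<Union>i<n. E i) - measure ?M (\<Union>i. E i)\<bar> < \<epsilon> / 2"
        by (auto simp: dist_real_def)
      have rest: "measure ?M ((\<Union>i. E i) - (\<Union>i<n. E i)) < \<epsilon> / 2"
      proof -
        have "measure ?M ((\<Union>i. E i) - (\<Union>i<n. E i)) = measure ?M (\<Union>i. E i) - measure ?M (\<Union>i<n. E i)"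
          by (rule finite_measure_Diff) auto
        then show ?thesis using n by linarith
      qed
      \<comment> \<open>Half of \<open>\<epsilon>\<close> covers the tail of the union, the other
        half is shared by the first \<open>n\<close> sets; \<open>n + 1\<close> avoids dividing by
        zero when \<open>n = 0\<close>.\<close>
      define \<eta> where "\<eta> = \<epsilon> / 2 / (real n + 1)"
      have n1: "0 < real n + 1" by simp
      then have \<eta>0: "0 < \<eta>" unfolding \<eta>_def using \<epsilon> by (intro divide_pos_pos) simp_all
      have "\<eta> * (real n + 1) = \<epsilon> / 2"
        by (rule iffD1[OF nonzero_eq_divide_eq]) (use n1 in \<open>simp_all add: \<eta>_def\<close>)
      then have \<eta>: "0 < \<eta>" "real n * \<eta> \<le> \<epsilon> / 2" using \<eta>0 by (simp_all add: distrib_left mult.commute)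
      have "\<forall>i. \<exists>k A. Cyl k A \<and> measure ?M (E i - A) + measure ?M (A - E i) < \<eta>"
        using Union.IH \<eta>(1) by blast
      then obtain k A where A: "\<And>i. Cyl (k i) (A i)" "\<And>i. measure ?M (E i - A i) + measure ?M (A i - E i) < \<eta>"
        by metis
      have As[measurable]: "A i \<in> sets ?M" for i using A(1)[of i] unfolding Cyl_def by (rule conjunct1)
      define B where "B = (\<Union>i<n. A i)"
      have Bs[measurable]: "B \<in> sets ?M" by (simp add: B_def)
      have "Cyl (Max (k ` {..<n})) B"
        unfolding Cyl_def
      proof (intro conjI ballI impI Bs)
        fix x y assume xy: "x \<in> G_set m" "y \<in> G_set m" "\<forall>i<Max (k ` {..<n}). x i = y i"
        have "x \<in> A i \<longleftrightarrow> y \<in> A i" if "i < n" for i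
        proof -
          have "k i \<le> Max (k ` {..<n})" using that by (intro Max_ge) auto
          then show ?thesis using A(1)[of i] xy unfolding Cyl_def by (meson less_le_trans)
        qed
        then show "x \<in> B \<longleftrightarrow> y \<in> B" by (auto simp: B_def)
      qed
      moreover have "measure ?M ((\<Union>i. E i) - B) + measure ?M (B - (\<Union>i. E i)) < \<epsilon>"
      proof -
        have "measure ?M ((\<Union>i. E i) - B) \<le> measure ?M (((\<Union>i. E i) - (\<Union>i<n. E i)) \<union> (\<Union>i<n. E i - A i))"
          by (intro finite_measure_mono) (auto simp: B_def)
        also have "\<dots> \<le> measure ?M ((\<Union>i. E i) - (\<Union>i<n. E i)) + measure ?M (\<Union>i<n. E i - A i)"
          by (intro measure_Un_le) auto
        also have "measure ?M (\<Union>i<n. E i - A i) \<le> (\<Sum>i<n. measure ?M (E i - A i))"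
          by (intro finite_measure_subadditive_finite) auto
        finally have 1: "measure ?M ((\<Union>i. E i) - B) < \<epsilon> / 2 + (\<Sum>i<n. measure ?M (E i - A i))"
          using rest by linarith
        have "measure ?M (B - (\<Union>i. E i)) \<le> measure ?M (\<Union>i<n. A i - E i)"
          by (intro finite_measure_mono) (auto simp: B_def)
        also have "\<dots> \<le> (\<Sum>i<n. measure ?M (A i - E i))"
          by (intro finite_measure_subadditive_finite) auto
        finally have 2: "measure ?M (B - (\<Union>i. E i)) \<le> (\<Sum>i<n. measure ?M (A i - E i))" .
        have "(\<Sum>i<n. measure ?M (E i - A i)) + (\<Sum>i<n. measure ?M (A i - E i)) \<le> (\<Sum>i<n. \<eta>)"
          unfolding sum.distrib[symmetric] using A(2) by (intro sum_mono) (simp add: less_imp_le)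
        also have "\<dots> \<le> \<epsilon> / 2" using \<eta>(2) by simp
        finally show ?thesis using 1 2 by linarith
      qed
      ultimately have *: "Cyl (Max (k ` {..<n})) B \<and> measure ?M ((\<Union>i. E i) - B) + measure ?M (B - (\<Union>i. E i)) < \<epsilon>"
        by (rule conjI)
      show "\<exists>k A. Cyl k A \<and> measure ?M ((\<Union>i. E i) - A) + measure ?M (A - (\<Union>i. E i)) < \<epsilon>"
        by (rule exI[of _ "Max (k ` {..<n})"], rule exI[of _ B], rule *)
    qed
  qed
  then obtain k A where "Cyl k A" "measure ?M (E - A) + measure ?M (A - E) < \<epsilon>" using \<epsilon> by blast
  then show ?thesis unfolding Cyl_def by blast
qed

text \<open>An interval smaller than a coset of the \<open>k\<close>-th subgroup lies inside one
  such coset, so a set depending only on the first \<open>k\<close> coordinates contains it or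
  misses it.\<close>

lemma gen_intervals_dense:
  assumes m: "\<And>i. 2 \<le> m i" and E: "E \<in> sets (haar m)" and \<epsilon>: "0 < \<epsilon>"
  shows "\<exists>A\<in>sets (haar m). measure (haar m) (E - A) + measure (haar m) (A - E) < \<epsilon> \<and>
    (\<exists>\<eta>>0. \<forall>J\<in>gen_intervals m. measure (haar m) J < \<eta> \<longrightarrow> J \<subseteq> A \<or> J \<inter> A = {})"
proof -
  obtain k A where A: "A \<in> sets (haar m)" "measure (haar m) (E - A) + measure (haar m) (A - E) < \<epsilon>"
    and cyl: "\<And>x y. x \<in> G_set m \<Longrightarrow> y \<in> G_set m \<Longrightarrow> (\<And>i. i < k \<Longrightarrow> x i = y i) \<Longrightarrow> x \<in> A \<longleftrightarrow> y \<in> A"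
    using approx_by_cylinder[OF m E \<epsilon>] by metis
  let ?P = "\<lambda>k. \<Prod>i<k. m i"
  have "0 < m i" for i using m[of i] by simp
  then have P: "0 < ?P k" for k by (simp add: prod_pos)
  have sm: "strict_mono ?P" by (rule prod_strict_mono[OF m])
  have "J \<subseteq> A \<or> J \<inter> A = {}" if J: "J \<in> gen_intervals m" and small: "measure (haar m) J < 1 / real (?P k)" for J
  proof -
    obtain y l i where J: "J = arc m y l i" and y: "y \<in> G_set m" and i: "1 \<le> i" "i \<le> m l"
      using J gen_intervals_eq[OF m] by auto
    have "1 / real (?P (Suc l)) \<le> real i / real (?P (Suc l))"
      using i by (intro divide_right_mono of_nat_0_le_iff) simp
    also have "\<dots> < 1 / real (?P k)" using small i by (simp add: J measure_arc[OF m y] del: prod.lessThan_Suc)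
    finally have "real (?P k) < real (?P (Suc l))"
      using P[of k] P[of "Suc l"] by (simp add: field_simps del: prod.lessThan_Suc of_nat_prod)
    then have "?P k < ?P (Suc l)" by (simp only: of_nat_less_iff)
    then have "k < Suc l" using strict_mono_less[OF sm, of k "Suc l"] by (simp only:)
    then have agree: "z i = z' i" if "z \<in> J" "z' \<in> J" "i < k" for z z' i
      using that by (auto simp: J arc_def)
    have JG: "J \<subseteq> G_set m" by (auto simp: J arc_def)
    have "z \<in> A \<longleftrightarrow> z' \<in> A" if "z \<in> J" "z' \<in> J" for z z'
      using that JG agree by (intro cyl) auto
    then show ?thesis by blast
  qed
  then show ?thesis using A P[of k]
    by (intro bexI[of _ A] conjI exI[of _ "1 / real (?P k)"]) (auto simp del: of_nat_prod)
qed

section \<open>Instantiation and reduction to everywhere bounded exponents\<close>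

lemma maximal_basis_gen_intervals:
  assumes m: "\<And>i. 2 \<le> m i"
  shows "maximal_basis (haar m) (gen_intervals m)"
proof (rule maximal_basis.intro[OF prob_space_haar[OF m] maximal_basis_axioms.intro])
  show "countable (gen_intervals m)" by (rule countable_gen_intervals[OF m])
  fix I assume I: "I \<in> gen_intervals m"
  then obtain x k j where xkj: "I = arc m x k j" "x \<in> G_set m" "1 \<le> j" "j \<le> m k"
    using gen_intervals_eq[OF m] by auto
  show "I \<in> sets (haar m)" using sets_arc[OF m xkj(2)] xkj(1) by simp
  have "0 < m i" for i using m[of i] by simp
  then have "0 < (\<Prod>i<Suc k. m i)" by (simp add: prod_pos)
  then show "0 < measure (haar m) I"
    using xkj by (simp add: measure_arc[OF m] del: prod.lessThan_Suc of_nat_prod)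
qed (rule gen_intervals_enlarge[OF m] gen_intervals_split[OF m] gen_intervals_dense[OF m], assumption+)+

lemma esssup_bounds:
  assumes "1 < exp_minus M p" "exp_plus M p < \<infinity>"
  obtains a b where "1 < a" "AE x in M. a \<le> p x" "AE x in M. p x \<le> b"
proof -
  have E: "(1::ereal) < - esssup M (\<lambda>x. - ereal (p x))" using assms by (simp add: exp_minus_def)
  then obtain a where a: "1 < ereal a" "ereal a < - esssup M (\<lambda>x. - ereal (p x))"
    using ereal_dense2[OF E] by (metis one_ereal_def)
  have "AE x in M. - ereal (p x) \<le> esssup M (\<lambda>x. - ereal (p x))" by (rule esssup_AE)
  then have A: "AE x in M. a \<le> p x"
  proof eventually_elim
    case (elim x)
    then have "- esssup M (\<lambda>x. - ereal (p x)) \<le> ereal (p x)" by (simp add: ereal_uminus_le_reorder)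
    then have "ereal a \<le> ereal (p x)" using a(2) by (meson less_imp_le order_trans)
    then show ?case by simp
  qed
  obtain b where b: "exp_plus M p < ereal b" using ereal_dense2[OF assms(2)] by auto
  have "AE x in M. ereal (p x) \<le> exp_plus M p" unfolding exp_plus_def by (rule esssup_AE)
  then have "AE x in M. p x \<le> b"
  proof eventually_elim
    case (elim x)
    then have "ereal (p x) \<le> ereal b" using b by (meson less_imp_le order_trans)
    then show ?case by simp
  qed
  then show ?thesis using that[of a b] a(1) A by simp
qed

lemma modular_cong_AE:
  assumes "AE x in M. p x = q x"
  shows "modular M p g l = modular M q g l"
  unfolding modular_def using assms by (intro nn_integral_cong_AE) auto

theorem theorem1p6:
  fixes m :: "nat \<Rightarrow> nat" and p :: "(nat \<Rightarrow> nat) \<Rightarrow> real"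
  assumes "\<And>i. 2 \<le> m i"
    and "p \<in> borel_measurable (haar m)"
    and "\<And>x. x \<in> G_set m \<Longrightarrow> 1 \<le> p x"
    and "1 < exp_minus (haar m) p"
    and "exp_minus (haar m) p \<le> exp_plus (haar m) p"
    and "exp_plus (haar m) p < \<infinity>"
  shows "cond_A m p \<longleftrightarrow>
    (\<exists>C::real. \<forall>f \<in> var_Lp (haar m) p.
       var_norm (haar m) p (maximal_fun m f)
         \<le> ennreal C * var_norm (haar m) p (\<lambda>x. ennreal (cmod (f x))))"
proof -
  interpret maximal_basis "haar m" "gen_intervals m"
    by (rule maximal_basis_gen_intervals[OF assms(1)])
  note [measurable] = assms(2)
  obtain a b where ab: "1 < a" "AE x in haar m. a \<le> p x" "AE x in haar m. p x \<le> b"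
    using esssup_bounds[OF assms(4,6)] .
  \<comment> \<open>Truncation between the essential bounds changes \<open>p\<close> only on a null
    set, so the modulars for \<open>p\<close> and for its conjugate stay the same, while the bounds
    now hold at every point.\<close>
  define P where "P x = max a (min (max a b) (p x))" for x
  have e: "expo P a (max a b)" using ab(1) by (auto simp: expo_def P_def[abs_def])
  have eq: "AE x in haar m. p x = P x" using ab(2,3) by eventually_elim (auto simp: P_def)
  then have eq': "AE x in haar m. conj_exp p x = conj_exp P x"
    by eventually_elim (simp add: conj_exp_def)
  have norm: "var_norm (haar m) p = var_norm (haar m) P"
    "var_norm (haar m) (conj_exp p) = var_norm (haar m) (conj_exp P)"
    by (simp_all add: var_norm_def fun_eq_iff modular_cong_AE[OF eq] modular_cong_AE[OF eq'])
  have Lp: "var_Lp (haar m) p = var_Lp (haar m) P"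
    by (simp add: var_Lp_def modular_cong_AE[OF eq])
  have max: "maximal_fun m f = maxf (\<lambda>x. cmod (f x))" for f
    by (simp add: fun_eq_iff maximal_fun_def maxf_def)
  show ?thesis
    unfolding cond_A_def norm Lp max bounded_iff_norm_condition[OF e, symmetric]
    using assms(4-6) by blast
qed

end
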